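(* Let $\Omega\subsetneq\mathbb{C}$ be a simply connected domain, let $\varphi:\mathbb{D}\to\Omega$ be a conformal mapping, and let $1<p<\infty$. Then the Bergman projection $\mathcal{B}$ of $\Omega$ satisfies $$c\left[|\varphi'|^{2-p}\right]_{A_p^+}^{\frac1{2p}}\le\|\mathcal{B}\|_{L^p(\Omega)\to L^p(\Omega)}\le C\,C_p\left[|\varphi'|^{2-p}\right]_{A_p^+}^{\max\{1,\frac1{p-1}\}},$$ where $C_p=\max\{p,\frac1{p-1}\}$ and $c,C>0$ are constants independent of $p$ and $\Omega$ (and of $\varphi$).
   Context: $\mathbb{D}$ is the open unit disc, $dA$ is (normalized) Lebesgue area measure in the plane, $D_r(z_0)=\{z\in\mathbb{C}:|z-z_0|<r\}$, $|E|=A(E)$. A conformal mapping is a biholomorphic map. The Bergman projection $\mathcal{B}$ of $\Omega$ is the orthogonal projection of $L^2(\Omega)$ onto the Bergman space $A^2(\Omega)$ of square-integrable holomorphic functions on $\Omega$; its $L^p$ operator norm is understood through extension from $L^2\cap L^p$ (and is $+\infty$ if $\mathcal{B}$ is not bounded on $L^p$). For an a.e. positive function $\omega$ on $\mathbb{D}$ and $1<p<\infty$, $$[\omega]_{A_p^+}=\sup_{z\in\partial\mathbb{D},\,r>0}\left(\frac1{|D_r(z)\cap\mathbb{D}|}\int_{D_r(z)\cap\mathbb{D}}\omega\,dA\right)\left(\frac1{|D_r(z)\cap\mathbb{D}|}\int_{D_r(z)\cap\mathbb{D}}\omega^{-\frac1{p-1}}dA\right)^{p-1}\in[1,\infty].$$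 *)

theory Defs
  imports "HOL-Complex_Analysis.Complex_Analysis"
begin

definition area :: "complex measure" where
  "area = density lebesgue (\<lambda>_. ennreal (1 / pi))"

abbreviation area_on :: "complex set \<Rightarrow> complex measure" where
  "area_on \<Omega> \<equiv> restrict_space area \<Omega>"

(* Real powers of extended nonnegative reals; only used with exponents a > 0. *)
definition ennpowr :: "ennreal \<Rightarrow> real \<Rightarrow> ennreal" where
  "ennpowr x a = (if x = \<infinity> then \<infinity> else ennreal (enn2real x powr a))"

definition Lp_norm :: "real \<Rightarrow> complex set \<Rightarrow> (complex \<Rightarrow> complex) \<Rightarrow> ennreal" where
  "Lp_norm p \<Omega> f = ennpowr (\<integral>\<^sup>+z. ennreal (cmod (f z) powr p) \<partial>area_on \<Omega>) (1 / p)"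

(* Functions rather than classes modulo null sets; the values outside \<Omega> are irrelevant. *)
definition Lp_space :: "real \<Rightarrow> complex set \<Rightarrow> (complex \<Rightarrow> complex) set" where
  "Lp_space p \<Omega> = {f \<in> borel_measurable (area_on \<Omega>). Lp_norm p \<Omega> f < \<infinity>}"

definition L2_inner :: "complex set \<Rightarrow> (complex \<Rightarrow> complex) \<Rightarrow> (complex \<Rightarrow> complex) \<Rightarrow> complex" where
  "L2_inner \<Omega> f g = (\<integral>z. f z * cnj (g z) \<partial>area_on \<Omega>)"

definition bergman_space :: "complex set \<Rightarrow> (complex \<Rightarrow> complex) set" where
  "bergman_space \<Omega> = {f \<in> Lp_space 2 \<Omega>. f holomorphic_on \<Omega>}"

(* The orthogonal projection onto the Bergman space: the g in the Bergman space with
   f - g orthogonal to that space. It is determined on \<Omega> (continuous functions that agree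
   almost everywhere on an open set agree there); the value 0 outside \<Omega> makes it unique
   as a function on the whole plane. *)
definition bergman_projection :: "complex set \<Rightarrow> (complex \<Rightarrow> complex) \<Rightarrow> complex \<Rightarrow> complex" where
  "bergman_projection \<Omega> f =
     (THE g. g \<in> bergman_space \<Omega> \<and> (\<forall>z. z \<notin> \<Omega> \<longrightarrow> g z = 0) \<and>
             (\<forall>h \<in> bergman_space \<Omega>. L2_inner \<Omega> (\<lambda>z. f z - g z) h = 0))"

(* Taken over L^2 \<inter> L^p, which is dense in L^p; the value is \<infinity> exactly if the
   projection has no bounded extension to L^p. *)
definition bergman_opnorm :: "real \<Rightarrow> complex set \<Rightarrow> ennreal" where
  "bergman_opnorm p \<Omega> =
     (SUP f \<in> {f \<in> Lp_space 2 \<Omega> \<inter> Lp_space p \<Omega>. Lp_norm p \<Omega> f \<le> 1}.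
        Lp_norm p \<Omega> (bergman_projection \<Omega> f))"

definition average :: "complex set \<Rightarrow> (complex \<Rightarrow> real) \<Rightarrow> ennreal" where
  "average E w = (\<integral>\<^sup>+z \<in> E. ennreal (w z) \<partial>area) / emeasure area E"

definition Ap_plus :: "real \<Rightarrow> (complex \<Rightarrow> real) \<Rightarrow> ennreal" where
  "Ap_plus p w =
     (SUP z \<in> sphere 0 1. SUP r \<in> {0<..}.
        average (ball z r \<inter> ball 0 1) w *
        ennpowr (average (ball z r \<inter> ball 0 1) (\<lambda>\<zeta>. w \<zeta> powr (- 1 / (p - 1)))) (p - 1))"

definition conformal_mapping :: "(complex \<Rightarrow> complex) \<Rightarrow> complex set \<Rightarrow> complex set \<Rightarrow> bool" where
  "conformal_mapping \<phi> U V \<longleftrightarrow>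
     \<phi> holomorphic_on U \<and> bij_betw \<phi> U V \<and> inv_into U \<phi> holomorphic_on V"

end

theory Submission
  imports Defs
begin

text \<open>
  Pulling back along \<open>\<phi>\<close> turns the Bergman projection of \<open>\<Omega>\<close> into that of the disc, acting on the
  weighted space with weight \<open>w = |\<phi>'|\<^sup>2\<^sup>-\<^sup>p\<close>; write \<open>s = w\<^sup>-\<^sup>1\<^sup>/\<^sup>(\<^sup>p\<^sup>-\<^sup>1\<^sup>)\<close> for the dual weight.

  Upper bound. The modulus of the Bergman kernel is dominated by two averaging operators, each over
  a family of sets \<open>D\<^sub>r(z) \<inter> \<D>\<close> that are pairwise nested or disjoint. It matters that these are the
  very sets in the definition of the constant: comparing averages over different shapes costs a
  factor exponential in \<open>p\<close>. For \<open>p \<ge> 2\<close> the condition is applied once on each set, after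
  \<open>(\<Sum>a)\<^sup>p\<close> has been summed by parts along the chain of sets containing a point, and what
  remains is Doob's maximal function with respect to \<open>s\<close>. The case \<open>p < 2\<close> follows by duality.

  Lower bound. If \<open>T = D\<^sub>r(z) \<inter> \<D>\<close> and \<open>G\<close> is a Whitney disc near \<open>T\<close>, the real part of the kernel is
  at least a constant times \<open>r\<^sup>-\<^sup>2\<close> on \<open>T \<times> G\<close>. Testing the projection on \<open>s\<close> restricted to \<open>T\<close> and on
  \<open>s\<close> restricted to \<open>G\<close>, and multiplying the two estimates, bounds the product of averages over \<open>T\<close>,
  because the product over \<open>G\<close> is at least 1. The two tests account for the exponent \<open>1/(2p)\<close>.
\<close>

text \<open>The estimates are for \<open>p\<close>-th powers, so a factor raised to the power
  \<open>p\<close> at the end is harmless. The \<open>A_p\<close> condition, however, is used before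
  Young's inequality, which raises \<open>W\<close> and all that multiplies it to the power
  \<open>p\<close> once more. Comparing a set with the part not covered by its descendants costs a
  factor exponential in \<open>p\<close> at that point. \<open>depth_weight\<close> replaces this
  part by a density of average at most \<open>C\<close> whose reciprocals along a chain add up to at
  most 2. This needs the areas of descendants to be summable even when generation \<open>d\<close>
  counts \<open>2 ^ d\<close> times; for tents a generation has about 8 times as many members with
  1/64 of the area.

  Integrability shapes the rest. In the upper bound the families are cut off at level
  \<open>n\<close>, so that averages are bounded and terms can be absorbed on the left; Fatou's
  lemma removes the cut-off. In the lower bound the test functions first live on compact sets, so
  that they lie in \<open>L^2\<close>, and finiteness of the integrals of the weights follows from
  the operator bound. The unweighted case of the upper bound is also what makes the kernel operator
  of the disc act on \<open>L^2\<close>.\<close>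

section \<open>Inequalities for sequences\<close>

lemma young_powr:
  fixes s t p :: real
  assumes "p > 1" "s \<ge> 0" "t \<ge> 0"
  shows "s * t powr (p - 1) \<le> s powr p / p + (1 - 1 / p) * t powr p"
proof -
  define q where "q = p / (p - 1)"
  have q: "q > 1" "1 / p + 1 / q = 1" "(p - 1) * q = p" "1 / q = 1 - 1 / p"
    using assms by (auto simp: q_def field_simps)
  have "s * t powr (p - 1) \<le> s powr p / p + (t powr (p - 1)) powr q / q"
    using assms q by (intro Youngs_inequality) auto
  also have "(t powr (p - 1)) powr q / q = (1 - 1 / p) * t powr p"
    unfolding powr_powr q(3) q(4)[symmetric] by simp
  finally show ?thesis .
qed

text \<open>A discrete form of \<open>d (t^p) = p * t^(p-1) dt\<close>: one more term raises the
  power by at most \<open>p\<close> times that term times the new sum to the power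
  \<open>p - 1\<close>. The convexity behind this enters as Young's inequality for the old and the
  new sum.\<close>

lemma powr_sum_le:
  fixes b :: "nat \<Rightarrow> real"
  assumes "p > 1" "\<And>m. b m \<ge> 0"
  shows "(\<Sum>m<n. b m) powr p \<le> p * (\<Sum>m<n. b m * (\<Sum>l\<le>m. b l) powr (p - 1))"
proof (induction n)
  case (Suc n)
  define s where "s = (\<Sum>m<n. b m)"
  define t where "t = s + b n"
  have st: "s \<ge> 0" "t \<ge> 0" and t: "t = (\<Sum>l\<le>n. b l)"
    using assms by (auto simp: s_def t_def sum_nonneg lessThan_Suc_atMost[symmetric])
  have "t powr p = t * t powr (p - 1)"
    using st assms by (cases "t = 0") (auto simp: powr_mult_base)
  then have "p * t powr p - p * s * t powr (p - 1) = p * b n * t powr (p - 1)"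
    by (simp add: t_def algebra_simps)
  moreover have "p * (s * t powr (p - 1)) \<le> p * (s powr p / p + (1 - 1 / p) * t powr p)"
    using young_powr[OF assms(1) st] assms(1) by (intro mult_left_mono) auto
  moreover have "p * (s powr p / p + (1 - 1 / p) * t powr p) = s powr p + (p - 1) * t powr p"
    using assms(1) by (simp add: field_simps)
  ultimately have "t powr p \<le> s powr p + p * (b n * t powr (p - 1))"
    by (simp add: algebra_simps)
  also have "\<dots> \<le> p * (\<Sum>m<Suc n. b m * (\<Sum>l\<le>m. b l) powr (p - 1))"
    using Suc by (simp add: s_def t algebra_simps)
  finally show ?case by (simp add: t_def s_def)
qed simp

text \<open>The value at \<open>n\<close> covers the entries below \<open>n\<close> and starts at 0.
  Hence the entry \<open>c m\<close> takes effect at index \<open>Suc m\<close>, powers telescope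
  from 0, and the maximum is nonnegative for every sequence.\<close>

fun running_max :: "(nat \<Rightarrow> real) \<Rightarrow> nat \<Rightarrow> real" where
  "running_max c 0 = 0"
| "running_max c (Suc n) = max (running_max c n) (c n)"

lemma running_max_nonneg: "running_max c n \<ge> 0"
  by (induction n) auto

lemma running_max_mono: "m \<le> n \<Longrightarrow> running_max c m \<le> running_max c n"
  by (induction rule: dec_induct) auto

lemma running_max_ge: "m < n \<Longrightarrow> c m \<le> running_max c n"
  by (induction n) (auto simp: less_Suc_eq)

lemma running_max_cong: "(\<And>l. l < n \<Longrightarrow> c l = d l) \<Longrightarrow> running_max c n = running_max d n"
  by (induction n) auto

lemma running_max_le: "(\<And>l. l < n \<Longrightarrow> c l \<le> K) \<Longrightarrow> 0 \<le> K \<Longrightarrow> running_max c n \<le> K"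
  by (induction n) auto

text \<open>The pathwise form of Doob's maximal inequality.\<close>

lemma running_max_powr_le:
  assumes "p > 1"
  shows "running_max c n powr p \<le> p / (p - 1) *
    (\<Sum>m<n. c m * (running_max c (Suc m) powr (p - 1) - running_max c m powr (p - 1)))"
proof (induction n)
  case (Suc n)
  define a b where "a = running_max c n" and "b = c n"
  have a: "a \<ge> 0" by (simp add: a_def running_max_nonneg)
  \<comment> \<open>Only a new record \<open>b > a\<close> changes the maximum. The claim is then
    Young's inequality for \<open>b * a powr (p - 1)\<close>, multiplied by the conjugate
    exponent.\<close>
  have "max a b powr p \<le> a powr p + p / (p - 1) * (b * (max a b powr (p - 1) - a powr (p - 1)))"
  proof (cases "b \<le> a")
    case False
    then have b: "b > a" "b > 0" using a by auto
    have "b * a powr (p - 1) \<le> b powr p / p + (1 - 1 / p) * a powr p"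
      using a b assms by (intro young_powr) auto
    then have "p / (p - 1) * (b * a powr (p - 1)) \<le> p / (p - 1) * (b powr p / p + (1 - 1 / p) * a powr p)"
      using assms by (intro mult_left_mono) auto
    also have "\<dots> = (p / (p - 1) - 1) * b powr p + a powr p"
      using assms by (simp add: field_simps)
    finally have "b powr p \<le> a powr p + p / (p - 1) * (b powr p - b * a powr (p - 1))"
      by (simp add: algebra_simps)
    moreover have "b powr p = b * b powr (p - 1)"
      using b by (simp add: powr_mult_base)
    ultimately show ?thesis using b by (simp add: max_def right_diff_distrib)
  qed (auto simp: max_def)
  then show ?case using Suc
    by (simp add: a_def b_def distrib_left)
qed simp

lemma running_max_telescope:
  "(\<Sum>m<n. running_max c (Suc m) powr q - running_max c m powr q) = running_max c n powr q"
  by (induction n) auto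

text \<open>Apply \<open>ln t \<le> t - 1\<close> to the three quotients by the weighted mean and
  add with the weights. Exponents may vanish, so that \<open>p = 2\<close> is included later, where
  the middle exponent \<open>(p - 2) / p\<close> is 0.\<close>

lemma weighted_amgm3:
  fixes x y z :: real
  assumes "x > 0" "y > 0" "z > 0" "a \<ge> 0" "b \<ge> 0" "c \<ge> 0" "a + b + c = 1"
  shows "x powr a * y powr b * z powr c \<le> a * x + b * y + c * z"
proof -
  define s where "s = a * x + b * y + c * z"
  have "s > 0"
  proof -
    have "a > 0 \<or> b > 0 \<or> c > 0" using assms by linarith
    then have "a * x > 0 \<or> b * y > 0 \<or> c * z > 0" using assms by auto
    moreover have "a * x \<ge> 0" "b * y \<ge> 0" "c * z \<ge> 0" using assms by auto
    ultimately show ?thesis unfolding s_def by linarith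
  qed
  have "ln (x / s) \<le> x / s - 1" "ln (y / s) \<le> y / s - 1" "ln (z / s) \<le> z / s - 1"
    using assms \<open>s > 0\<close> by (auto intro!: ln_le_minus_one)
  then have "a * ln (x / s) + b * ln (y / s) + c * ln (z / s)
      \<le> a * (x / s - 1) + b * (y / s - 1) + c * (z / s - 1)"
    using assms by (intro add_mono mult_left_mono) auto
  also have "\<dots> = (a * x + b * y + c * z) / s - (a + b + c)" unfolding add_divide_distrib
    by (simp add: algebra_simps)
  also have "\<dots> = 0" using \<open>s > 0\<close> assms by (simp add: s_def)
  finally have "a * ln x + b * ln y + c * ln z \<le> (a + b + c) * ln s"
    using assms(1-3) \<open>s > 0\<close> by (simp add: ln_div algebra_simps)
  then have "exp (a * ln x + b * ln y + c * ln z) \<le> s"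
    using assms \<open>s > 0\<close> by (simp add: ln_ge_iff)
  then show ?thesis using assms by (simp add: powr_def exp_add s_def)
qed

lemma integrable_bounded_mult:
  fixes f g :: "'a \<Rightarrow> real"
  assumes "integrable M f" "g \<in> borel_measurable M" "\<And>x. x \<in> space M \<Longrightarrow> \<bar>g x\<bar> \<le> B"
  shows "integrable M (\<lambda>x. g x * f x)"
proof (rule Bochner_Integration.integrable_bound)
  show "integrable M (\<lambda>x. B * f x)" using assms by simp
  show "AE x in M. norm (g x * f x) \<le> norm (B * f x)"
  proof (intro AE_I2)
    fix x assume "x \<in> space M"
    then have "\<bar>g x\<bar> \<le> \<bar>B\<bar>" using assms(3)[of x] by linarith
    then show "norm (g x * f x) \<le> norm (B * f x)"
      by (simp add: abs_mult mult_right_mono)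
  qed
qed (use assms in auto)

section \<open>Averaging operators over laminar families\<close>

lemma borel_measurable_running_max:
  assumes "\<And>l. (\<lambda>x. c x l) \<in> borel_measurable M"
  shows "(\<lambda>x. running_max (c x) n) \<in> borel_measurable M"
  by (induction n) (use assms in auto)

text \<open>A finite forest graded by \<open>lev\<close>: distinct members meet only if one lies in
  the other at a strictly larger level. \<open>packing\<close> is stronger than a Carleson
  condition, since a descendant counts with 2 to the number of levels in between. The later
  estimates depend on the family through \<open>C\<close> alone.\<close>

locale laminar_family = finite_measure M for M :: "'a measure" +
  fixes I :: "'i set" and Q :: "'i \<Rightarrow> 'a set" and lev :: "'i \<Rightarrow> nat" and C :: real
  assumes finite_I: "finite I"
    and sets_Q [measurable]: "\<And>i. i \<in> I \<Longrightarrow> Q i \<in> sets M"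
    and measure_Q_pos: "\<And>i. i \<in> I \<Longrightarrow> measure M (Q i) > 0"
    and laminar: "\<And>i j. i \<in> I \<Longrightarrow> j \<in> I \<Longrightarrow> i \<noteq> j \<Longrightarrow> lev i \<le> lev j \<Longrightarrow>
      Q i \<inter> Q j = {} \<or> lev i < lev j \<and> Q j \<subseteq> Q i"
    and packing: "\<And>i. i \<in> I \<Longrightarrow>
      (\<Sum>j\<in>{j\<in>I. lev i \<le> lev j \<and> Q j \<subseteq> Q i}. 2 ^ (lev j - lev i) * measure M (Q j))
        \<le> C * measure M (Q i)"
begin

definition height :: nat where "height = Suc (\<Sum>i\<in>I. lev i)"

text \<open>At most one member of each level contains \<open>x\<close>, so this is the coefficient
  of that member, or 0. Coefficients on the family become a sequence along the chain through
  \<open>x\<close>, to which the inequalities for sequences apply.\<close>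

definition level_sum :: "('i \<Rightarrow> real) \<Rightarrow> 'a \<Rightarrow> nat \<Rightarrow> real" where
  "level_sum c x m = (\<Sum>i\<in>{i\<in>I. lev i = m}. c i * indicator (Q i) x)"

text \<open>A quantity at \<open>x\<close> that involves only levels up to \<open>lev i\<close> is
  constant on \<open>Q i\<close>; evaluating it at \<open>pt i\<close> makes it a coefficient on the
  family.\<close>

definition pt :: "'i \<Rightarrow> 'a" where "pt i = (SOME x. x \<in> Q i)"

definition mass :: "('a \<Rightarrow> real) \<Rightarrow> 'i \<Rightarrow> real" where
  "mass f i = (\<integral>x. indicator (Q i) x * f x \<partial>M)"

definition avg :: "('a \<Rightarrow> real) \<Rightarrow> 'i \<Rightarrow> real" where
  "avg f i = mass f i / measure M (Q i)"

definition sparse_op :: "('a \<Rightarrow> real) \<Rightarrow> 'a \<Rightarrow> real" where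
  "sparse_op f x = (\<Sum>i\<in>I. avg f i * indicator (Q i) x)"

text \<open>At a point of \<open>Q i\<close> whose deepest member lies \<open>d\<close> levels below
  \<open>i\<close>, the value is between \<open>2 ^ d\<close> and \<open>2 ^ (d + 1)\<close>. The
  reciprocal plays the part of the indicator of the region of \<open>Q i\<close> not covered by
  descendants.\<close>

definition depth_weight :: "'i \<Rightarrow> 'a \<Rightarrow> real" where
  "depth_weight i x =
     (\<Sum>j\<in>{j\<in>I. lev i \<le> lev j \<and> Q j \<subseteq> Q i}. 2 ^ (lev j - lev i) * indicator (Q j) x)"

section \<open>Chains of members containing a point\<close>

lemma lev_less_height: "i \<in> I \<Longrightarrow> lev i < height"
  by (simp add: height_def less_Suc_eq_le member_le_sum finite_I)

lemma Q_space: "i \<in> I \<Longrightarrow> x \<in> Q i \<Longrightarrow> x \<in> space M"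
  using sets.sets_into_space[OF sets_Q] by auto

lemma pt: "i \<in> I \<Longrightarrow> pt i \<in> Q i"
proof -
  assume "i \<in> I"
  then have "Q i \<noteq> {}" using measure_Q_pos[of i] by auto
  then show ?thesis unfolding pt_def by (simp add: some_in_eq)
qed

lemma same_level_eq:
  assumes "i \<in> I" "j \<in> I" "x \<in> Q i" "x \<in> Q j" "lev i = lev j"
  shows "i = j"
  using laminar[of i j] assms by auto

lemma ancestor_iff:
  assumes "i \<in> I" "j \<in> I" "x \<in> Q i" "y \<in> Q i" "lev j \<le> lev i"
  shows "x \<in> Q j \<longleftrightarrow> y \<in> Q j"
  using laminar[of j i] assms by (cases "i = j") auto

lemma level_sum_cong:
  assumes "i \<in> I" "x \<in> Q i" "y \<in> Q i" "m \<le> lev i"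
  shows "level_sum c x m = level_sum c y m"
  unfolding level_sum_def using ancestor_iff[OF assms(1) _ assms(2,3)] assms(4)
  by (intro sum.cong) (auto simp: indicator_def)

lemma level_sum_eq:
  assumes "i \<in> I" "x \<in> Q i"
  shows "level_sum c x (lev i) = c i"
proof -
  have "level_sum c x (lev i) = (\<Sum>j\<in>{i}. c j * indicator (Q j) x)"
    unfolding level_sum_def using assms finite_I
    by (intro sum.mono_neutral_right) (auto dest: same_level_eq[OF assms(1) _ assms(2)] simp: indicator_def)
  then show ?thesis using assms by simp
qed

lemma level_sum_nonneg: "(\<And>i. i \<in> I \<Longrightarrow> c i \<ge> 0) \<Longrightarrow> level_sum c x m \<ge> 0"
  by (auto simp: level_sum_def intro!: sum_nonneg)

lemma level_sum_one_le: "level_sum (\<lambda>_. 1) x m \<le> 1"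
proof (cases "\<exists>i\<in>I. lev i = m \<and> x \<in> Q i")
  case True
  then show ?thesis using level_sum_eq[where c = "\<lambda>_. 1"] by fastforce
next
  case False
  then have "level_sum (\<lambda>_. 1) x m = 0"
    unfolding level_sum_def by (intro sum.neutral) auto
  then show ?thesis by simp
qed

lemma level_sum_measurable [measurable]: "(\<lambda>x. level_sum c x m) \<in> borel_measurable M"
proof -
  have "(\<lambda>x. c i * indicator (Q i) x) \<in> borel_measurable M" if "i \<in> {i\<in>I. lev i = m}" for i
    using that by (intro borel_measurable_times borel_measurable_const borel_measurable_indicator sets_Q) auto
  then show ?thesis unfolding level_sum_def by (intro borel_measurable_sum)
qed

text \<open>The left side is where inequalities for sequences apply at a fixed point; the right side
  can be integrated member by member. The factor \<open>g\<close> carries whatever else varies along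
  the chain.\<close>

lemma sum_levels:
  "(\<Sum>m<height. level_sum c x m * g m) = (\<Sum>i\<in>I. c i * indicator (Q i) x * g (lev i))"
proof -
  have "(\<Sum>m<height. level_sum c x m * g m) =
      (\<Sum>m<height. \<Sum>i\<in>{i\<in>I. lev i = m}. c i * indicator (Q i) x * g (lev i))"
    by (simp add: level_sum_def sum_distrib_right)
  also have "\<dots> = (\<Sum>i\<in>I. c i * indicator (Q i) x * g (lev i))"
    using finite_I lev_less_height by (intro sum.group) auto
  finally show ?thesis .
qed

lemma sum_level_sum: "(\<Sum>m<height. level_sum c x m) = (\<Sum>i\<in>I. c i * indicator (Q i) x)"
  using sum_levels[of c x "\<lambda>_. 1"] by simp

lemma sparse_op_eq: "sparse_op f x = (\<Sum>m<height. level_sum (avg f) x m)"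
  by (simp add: sparse_op_def sum_level_sum)

lemma sparse_op_measurable [measurable]: "sparse_op f \<in> borel_measurable M"
  unfolding sparse_op_eq[abs_def] by measurable

lemma mass_nonneg: "(\<And>x. x \<in> space M \<Longrightarrow> f x \<ge> 0) \<Longrightarrow> mass f i \<ge> 0"
  unfolding mass_def by (intro Bochner_Integration.integral_nonneg) auto

lemma avg_nonneg: "(\<And>x. x \<in> space M \<Longrightarrow> f x \<ge> 0) \<Longrightarrow> avg f i \<ge> 0"
  unfolding avg_def using mass_nonneg[of f i] by simp

lemma sparse_op_nonneg: "(\<And>x. x \<in> space M \<Longrightarrow> f x \<ge> 0) \<Longrightarrow> sparse_op f x \<ge> 0"
  unfolding sparse_op_def by (intro sum_nonneg) (simp add: avg_nonneg)

lemma integrable_Q: "i \<in> I \<Longrightarrow> integrable M f \<Longrightarrow> integrable M (\<lambda>x. indicator (Q i) x * f x :: real)"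
  by (rule integrable_bounded_mult[where B = 1]) (auto simp: indicator_def)

lemma mass_pos:
  assumes "i \<in> I" "integrable M f" "\<And>x. x \<in> space M \<Longrightarrow> f x > (0::real)"
  shows "mass f i > 0"
proof -
  have "mass f i \<ge> 0" using assms(3) by (intro mass_nonneg) (simp add: less_imp_le)
  moreover have "mass f i \<noteq> 0"
  proof
    assume "mass f i = 0"
    then have "AE x in M. indicator (Q i) x * f x = 0"
      unfolding mass_def using assms
      by (subst (asm) integral_nonneg_eq_0_iff_AE) (auto simp: integrable_Q less_imp_le)
    then have "AE x in M. x \<notin> Q i"
      by (rule AE_mp) (use assms(3) in \<open>force simp: indicator_def split: if_splits\<close>)
    then have "emeasure M (Q i) = 0"
      using assms(1) sets_Q by (subst (asm) AE_iff_measurable[where N = "Q i"]) (auto dest: Q_space)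
    then show False using measure_Q_pos[OF assms(1)] by (simp add: measure_def)
  qed
  ultimately show ?thesis by simp
qed

lemma integral_sum_mass:
  assumes "integrable M f"
  shows "integrable M (\<lambda>x. (\<Sum>i\<in>I. c i * indicator (Q i) x) * f x)"
    and "(\<integral>x. (\<Sum>i\<in>I. c i * indicator (Q i) x) * f x \<partial>M) = (\<Sum>i\<in>I. c i * mass f i)"
proof -
  have eq: "(\<lambda>x. (\<Sum>i\<in>I. c i * indicator (Q i) x) * f x) =
      (\<lambda>x. \<Sum>i\<in>I. c i * (indicator (Q i) x * f x))"
    by (simp add: sum_distrib_right mult.assoc)
  show "integrable M (\<lambda>x. (\<Sum>i\<in>I. c i * indicator (Q i) x) * f x)"
    unfolding eq using assms by (intro Bochner_Integration.integrable_sum integrable_mult_right integrable_Q)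
  show "(\<integral>x. (\<Sum>i\<in>I. c i * indicator (Q i) x) * f x \<partial>M) = (\<Sum>i\<in>I. c i * mass f i)"
    unfolding eq mass_def using assms
    by (subst Bochner_Integration.integral_sum) (auto intro!: integrable_Q integrable_mult_right)
qed

lemma sparse_op_duality:
  assumes "integrable M f" "integrable M g"
  shows "(\<integral>x. sparse_op f x * g x \<partial>M) = (\<integral>x. sparse_op g x * f x \<partial>M)"
  unfolding sparse_op_def using integral_sum_mass(2)[OF assms(1), of "avg g"]
    integral_sum_mass(2)[OF assms(2), of "avg f"] by (simp add: avg_def mult.commute)

lemma sparse_op_bounded:
  assumes "\<And>x. x \<in> space M \<Longrightarrow> f x \<ge> 0"
  shows "sparse_op f x \<le> (\<Sum>i\<in>I. avg f i)"
  unfolding sparse_op_def using avg_nonneg[OF assms] by (intro sum_mono) (auto simp: indicator_def)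

section \<open>Doob's maximal function of the family\<close>

definition maxi :: "('i \<Rightarrow> real) \<Rightarrow> 'a \<Rightarrow> real" where
  "maxi c x = running_max (level_sum c x) height"

lemma maxi_measurable [measurable]: "maxi c \<in> borel_measurable M"
  unfolding maxi_def by (intro borel_measurable_running_max) measurable

lemma maxi_nonneg: "maxi c x \<ge> 0"
  by (simp add: maxi_def running_max_nonneg)

lemma maxi_ge: "i \<in> I \<Longrightarrow> x \<in> Q i \<Longrightarrow> c i \<le> maxi c x"
  unfolding maxi_def using running_max_ge[OF lev_less_height, of i "level_sum c x"] level_sum_eq[of i x c] by simp

lemma level_sum_le:
  assumes "\<And>i. i \<in> I \<Longrightarrow> c i \<ge> 0"
  shows "level_sum c x m \<le> (\<Sum>i\<in>I. c i)"
proof -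
  have "level_sum c x m \<le> (\<Sum>i\<in>{i\<in>I. lev i = m}. c i)"
    unfolding level_sum_def using assms by (intro sum_mono) (auto simp: indicator_def)
  also have "\<dots> \<le> (\<Sum>i\<in>I. c i)" using assms finite_I by (intro sum_mono2) auto
  finally show ?thesis .
qed

lemma maxi_bounded:
  assumes "\<And>i. i \<in> I \<Longrightarrow> c i \<ge> 0"
  shows "maxi c x \<le> (\<Sum>i\<in>I. c i)"
  unfolding maxi_def using level_sum_le[OF assms] assms by (intro running_max_le) (auto intro: sum_nonneg)

lemma integrable_sparse_powr_mult:
  assumes "\<And>x. x \<in> space M \<Longrightarrow> f x \<ge> 0" "integrable M g" "q \<ge> 0"
  shows "integrable M (\<lambda>x. sparse_op f x powr q * g x)"
  using assms by (intro integrable_bounded_mult[where B = "(\<Sum>i\<in>I. avg f i) powr q"])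
    (auto intro!: powr_mono2 sparse_op_nonneg sparse_op_bounded)

lemma integrable_maxi_powr_mult:
  assumes "\<And>i. i \<in> I \<Longrightarrow> c i \<ge> 0" "integrable M g" "q \<ge> 0"
  shows "integrable M (\<lambda>x. maxi c x powr q * g x)"
  using assms by (intro integrable_bounded_mult[where B = "(\<Sum>i\<in>I. c i) powr q"])
    (auto intro!: powr_mono2 maxi_nonneg maxi_bounded)

text \<open>The chains of members act as a martingale filtration, and
  \<open>mass f i / mass s i\<close> is the average of \<open>f / s\<close> over \<open>Q i\<close>
  with respect to the measure with density \<open>s\<close>. Integrating the pathwise inequality
  replaces averages by \<open>f / s\<close> itself; Young's inequality and absorption then give the
  constant \<open>p / (p - 1)\<close>, whatever the weight and the family.\<close>

lemma doob_maximal: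
  assumes p: "p > 1" and s: "integrable M s" "\<And>x. x \<in> space M \<Longrightarrow> s x > 0"
    and f: "integrable M f" "\<And>x. x \<in> space M \<Longrightarrow> f x \<ge> 0"
    and fs: "integrable M (\<lambda>x. (f x / s x) powr p * s x)"
  defines "c \<equiv> \<lambda>i. mass f i / mass s i"
  shows "(\<integral>x. maxi c x powr p * s x \<partial>M) \<le> (p / (p - 1)) powr p * (\<integral>x. (f x / s x) powr p * s x \<partial>M)"
proof -
  define q where "q = p / (p - 1)"
  have q: "q > 1" using p by (simp add: q_def field_simps)
  define D where "D = (\<lambda>x m. running_max (level_sum c x) (Suc m) powr (p - 1)
    - running_max (level_sum c x) m powr (p - 1))"
  \<comment> \<open>The increment at level \<open>lev i\<close> depends on levels up to
    \<open>lev i\<close> only, so on \<open>Q i\<close> it is the constant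
    \<open>d i\<close>.\<close>
  define d where "d = (\<lambda>i. D (pt i) (lev i))"
  have c: "c i \<ge> 0" for i
    using f s by (auto simp: c_def mass_nonneg less_imp_le)
  have rm: "running_max (level_sum c x) m = running_max (level_sum c (pt i)) m"
    if "i \<in> I" "x \<in> Q i" "m \<le> Suc (lev i)" for i x m
    using that pt by (intro running_max_cong level_sum_cong[of i]) auto
  have D: "indicator (Q i) x * D x (lev i) = indicator (Q i) x * d i" if "i \<in> I" for i x
    using rm[OF that, of x] by (auto simp: d_def D_def indicator_def simp del: running_max.simps)
  have D_nonneg: "D x m \<ge> 0" for x m
    unfolding D_def using p running_max_mono[of m "Suc m" "level_sum c x"]
    by (auto intro!: powr_mono2 running_max_nonneg simp del: running_max.simps)
  have 1: "maxi c x powr p \<le> q * (\<Sum>i\<in>I. (c i * d i) * indicator (Q i) x)" for x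
  proof -
    have "maxi c x powr p \<le> q * (\<Sum>m<height. level_sum c x m * D x m)"
      unfolding maxi_def q_def D_def by (rule running_max_powr_le[OF p])
    also have "(\<Sum>m<height. level_sum c x m * D x m) = (\<Sum>i\<in>I. c i * indicator (Q i) x * D x (lev i))"
      by (rule sum_levels)
    also have "\<dots> = (\<Sum>i\<in>I. (c i * d i) * indicator (Q i) x)"
      by (intro sum.cong refl) (simp add: mult.assoc D mult.commute[of "d _"])
    finally show ?thesis .
  qed
  have 2: "(\<Sum>i\<in>I. d i * indicator (Q i) x) \<le> maxi c x powr (p - 1)" for x
  proof -
    have "(\<Sum>i\<in>I. d i * indicator (Q i) x) = (\<Sum>i\<in>I. 1 * indicator (Q i) x * D x (lev i))"
      by (intro sum.cong refl) (simp add: D mult.commute[of "d _"])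
    also have "\<dots> = (\<Sum>m<height. level_sum (\<lambda>_. 1) x m * D x m)" by (simp add: sum_levels)
    also have "\<dots> \<le> (\<Sum>m<height. D x m)"
      using level_sum_one_le D_nonneg by (intro sum_mono) (simp add: mult_left_le_one_le level_sum_nonneg)
    also have "\<dots> = maxi c x powr (p - 1)"
      unfolding D_def maxi_def by (rule running_max_telescope)
    finally show ?thesis .
  qed
  have int: "integrable M (\<lambda>x. maxi c x powr r * g x)" if "integrable M g" "r \<ge> 0" for g r
    using c that by (intro integrable_maxi_powr_mult) auto
  let ?X = "\<integral>x. maxi c x powr p * s x \<partial>M" and ?Y = "\<integral>x. (f x / s x) powr p * s x \<partial>M"
  have "?X \<le> (\<integral>x. q * ((\<Sum>i\<in>I. (c i * d i) * indicator (Q i) x) * s x) \<partial>M)"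
  proof (intro integral_mono)
    show "integrable M (\<lambda>x. q * ((\<Sum>i\<in>I. (c i * d i) * indicator (Q i) x) * s x))"
      by (intro integrable_mult_right integral_sum_mass s)
    fix x assume "x \<in> space M"
    then show "maxi c x powr p * s x \<le> q * ((\<Sum>i\<in>I. (c i * d i) * indicator (Q i) x) * s x)"
      using mult_right_mono[OF 1[of x], of "s x"] s(2)[of x] by (simp add: mult.assoc)
  qed (use int s p in auto)
  also have "\<dots> = q * (\<Sum>i\<in>I. (c i * d i) * mass s i)"
    using s by (simp add: integral_sum_mass)
  \<comment> \<open>The martingale step: \<open>c i * mass s i\<close> is \<open>mass f i\<close>,
    so the average disappears in favour of \<open>f\<close>.\<close>
  also have "(\<Sum>i\<in>I. (c i * d i) * mass s i) = (\<Sum>i\<in>I. d i * mass f i)"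
    using mass_pos[OF _ s] by (intro sum.cong) (fastforce simp: c_def)+
  also have "q * \<dots> = (\<integral>x. q * ((\<Sum>i\<in>I. d i * indicator (Q i) x) * f x) \<partial>M)"
    using f by (simp add: integral_sum_mass)
  also have "\<dots> \<le> (\<integral>x. q powr p / p * ((f x / s x) powr p * s x) + (1 - 1 / p) * (maxi c x powr p * s x) \<partial>M)"
  proof (intro integral_mono)
    show "integrable M (\<lambda>x. q * ((\<Sum>i\<in>I. d i * indicator (Q i) x) * f x))"
      by (intro integrable_mult_right integral_sum_mass f)
    show "integrable M (\<lambda>x. q powr p / p * ((f x / s x) powr p * s x) + (1 - 1 / p) * (maxi c x powr p * s x))"
      using fs int s p by (intro Bochner_Integration.integrable_add integrable_mult_right) auto
    fix x assume x: "x \<in> space M"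
    have "q * ((\<Sum>i\<in>I. d i * indicator (Q i) x) * f x) \<le> q * (maxi c x powr (p - 1) * f x)"
      using 2[of x] f(2)[OF x] q by (intro mult_left_mono mult_right_mono) auto
    also have "\<dots> = s x * ((q * (f x / s x)) * maxi c x powr (p - 1))"
      using s(2)[OF x] by (simp add: field_simps)
    also have "\<dots> \<le> s x * ((q * (f x / s x)) powr p / p + (1 - 1 / p) * maxi c x powr p)"
      using s(2)[OF x] f(2)[OF x] q p maxi_nonneg[of c x] by (intro mult_left_mono young_powr) auto
    also have "(q * (f x / s x)) powr p = q powr p * (f x / s x) powr p"
      using s(2)[OF x] f(2)[OF x] q by (subst powr_mult) auto
    finally show "q * ((\<Sum>i\<in>I. d i * indicator (Q i) x) * f x)
        \<le> q powr p / p * ((f x / s x) powr p * s x) + (1 - 1 / p) * (maxi c x powr p * s x)"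
      by (simp add: algebra_simps)
  qed
  also have "\<dots> = q powr p / p * ?Y + (1 - 1 / p) * ?X"
    using fs int[OF s(1), of p] p by simp
  \<comment> \<open>The multiple \<open>(1 - 1 / p) * ?X\<close> is absorbed on the left. This is
    legitimate because \<open>?X\<close> is the integral of a bounded function against
    \<open>s\<close>, hence finite.\<close>
  finally have "?X / p \<le> q powr p / p * ?Y" by (simp add: algebra_simps)
  then show ?thesis using p by (simp add: q_def field_simps)
qed

section \<open>Depth weights\<close>

lemma depth_weight_measurable [measurable]: "depth_weight i \<in> borel_measurable M"
proof -
  have "(\<lambda>x. 2 ^ (lev j - lev i) * indicator (Q j) x :: real) \<in> borel_measurable M"
    if "j \<in> {j\<in>I. lev i \<le> lev j \<and> Q j \<subseteq> Q i}" for j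
    using that by (intro borel_measurable_times borel_measurable_const borel_measurable_indicator sets_Q) auto
  then show ?thesis unfolding depth_weight_def[abs_def] by (intro borel_measurable_sum)
qed

lemma depth_weight_ge:
  assumes "i \<in> I" "k \<in> I" "lev i \<le> lev k" "x \<in> Q i" "x \<in> Q k"
  shows "2 ^ (lev k - lev i) \<le> depth_weight i x"
proof -
  have "Q k \<subseteq> Q i" using laminar[of i k] assms by (cases "i = k") auto
  then have "2 ^ (lev k - lev i) * indicator (Q k) x \<le> depth_weight i x"
    unfolding depth_weight_def using assms finite_I
    by (intro member_le_sum[where f = "\<lambda>j. 2 ^ (lev j - lev i) * indicator (Q j) x"]) auto
  then show ?thesis using assms by simp
qed

lemma depth_weight_ge_1: "i \<in> I \<Longrightarrow> x \<in> Q i \<Longrightarrow> 1 \<le> depth_weight i x"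
  using depth_weight_ge[of i i x] by simp

text \<open>Along the chain through \<open>x\<close> the weight of a member is at least 2 to its
  distance from the deepest one, so the reciprocals are dominated by a geometric series. This
  bounded overlap takes the place of disjointness of the uncovered parts.\<close>

lemma sum_inverse_depth_weight:
  "(\<Sum>i\<in>I. indicator (Q i) x / depth_weight i x) \<le> 2"
proof -
  define J where "J = {i\<in>I. x \<in> Q i}"
  have J: "finite J" using finite_I by (simp add: J_def)
  have "(\<Sum>i\<in>I. indicator (Q i) x / depth_weight i x) = (\<Sum>i\<in>J. 1 / depth_weight i x)"
    unfolding J_def using finite_I by (intro sum.mono_neutral_cong_right) (auto simp: indicator_def)
  also have "\<dots> \<le> 2"
  proof (cases "J = {}")
    case False
    define m where "m = Max (lev ` J)"
    have "m \<in> lev ` J" unfolding m_def using J False by (intro Max_in) auto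
    then obtain k where k: "k \<in> J" "lev k = m" by auto
    have le: "lev i \<le> m" if "i \<in> J" for i unfolding m_def using J that by (intro Max_ge) auto
    have inj: "inj_on lev J"
      by (intro inj_onI) (auto simp: J_def intro: same_level_eq)
    have "(\<Sum>i\<in>J. 1 / depth_weight i x) \<le> (\<Sum>i\<in>J. (1 / 2) ^ (m - lev i))"
    proof (intro sum_mono)
      fix i assume i: "i \<in> J"
      have "2 ^ (m - lev i) \<le> depth_weight i x"
        using depth_weight_ge[of i k x] i k le[OF i] by (auto simp: J_def)
      moreover from this have "0 < depth_weight i x" by (rule less_le_trans[rotated]) simp
      ultimately have "1 / depth_weight i x \<le> 1 / 2 ^ (m - lev i)"
        by (intro divide_left_mono) auto
      then show "1 / depth_weight i x \<le> (1 / 2) ^ (m - lev i)" by (simp add: power_one_over)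
    qed
    also have "\<dots> = (\<Sum>l\<in>lev ` J. (1 / 2) ^ (m - l))" using inj by (simp add: sum.reindex)
    also have "\<dots> \<le> (\<Sum>l\<le>m. (1 / 2) ^ (m - l))" using le by (intro sum_mono2) auto
    also have "\<dots> = (\<Sum>l\<le>m. (1 / 2) ^ l)"
      by (rule sum.reindex_bij_witness[where i = "\<lambda>l. m - l" and j = "\<lambda>l. m - l"]) auto
    also have "\<dots> = 2 - (1 / 2) ^ m"
      by (induction m) (auto simp: field_simps)
    finally have "(\<Sum>i\<in>J. 1 / depth_weight i x) \<le> 2 - (1 / 2) ^ m" .
    moreover have "(1 / 2 :: real) ^ m \<ge> 0" by simp
    ultimately show ?thesis by linarith
  qed auto
  finally show ?thesis .
qed

lemma mass_depth_weight: "i \<in> I \<Longrightarrow> mass (depth_weight i) i \<le> C * measure M (Q i)"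
proof -
  assume i: "i \<in> I"
  let ?J = "{j\<in>I. lev i \<le> lev j \<and> Q j \<subseteq> Q i}"
  have "mass (depth_weight i) i = (\<integral>x. (\<Sum>j\<in>?J. 2 ^ (lev j - lev i) * indicator (Q j) x) \<partial>M)"
    unfolding mass_def depth_weight_def
    by (intro Bochner_Integration.integral_cong refl)
       (auto simp: indicator_def intro!: sum.cong sum.neutral split: if_splits)
  also have "\<dots> = (\<Sum>j\<in>?J. 2 ^ (lev j - lev i) * measure M (Q j))"
    by (subst Bochner_Integration.integral_sum)
       (auto simp: Int_absorb2 Q_space subset_iff emeasure_eq_measure intro!: sum.cong integrable_mult_right arg_cong[where f = "measure M"] )
  finally show ?thesis using packing[OF i] by simp
qed

lemma depth_weight_bounded: "\<bar>depth_weight i x\<bar> \<le> (\<Sum>j\<in>I. 2 ^ lev j)"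
proof -
  have "depth_weight i x \<le> (\<Sum>j\<in>{j\<in>I. lev i \<le> lev j \<and> Q j \<subseteq> Q i}. 2 ^ lev j)"
    unfolding depth_weight_def
    by (intro sum_mono) (auto simp: indicator_def intro!: power_increasing)
  also have "\<dots> \<le> (\<Sum>j\<in>I. 2 ^ lev j)" using finite_I by (intro sum_mono2) auto
  finally show ?thesis by (auto simp: depth_weight_def sum_nonneg abs_of_nonneg)
qed

end

section \<open>Weighted bounds for one laminar family\<close>

lemma integral_lincomb3:
  fixes f g h :: "'a \<Rightarrow> real"
  assumes "integrable M f" "integrable M g" "integrable M h"
  shows "(\<integral>x. a * f x + (b * g x + c * h x) \<partial>M)
    = a * integral\<^sup>L M f + (b * integral\<^sup>L M g + c * integral\<^sup>L M h)"
  using assms by simp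

text \<open>The condition \<open>Ap\<close> is kept free of quotients. In this form it is stable
  under duality: exchanging \<open>w\<close> and \<open>s\<close> and passing to the conjugate
  exponent \<open>q\<close> gives another instance, with \<open>W powr (q - 1)\<close> in place of
  \<open>W\<close>.\<close>

locale laminar_Ap = laminar_family M I Q lev C
  for M :: "'a measure" and I :: "'i set" and Q lev and C :: real +
  fixes p W :: real and w s :: "'a \<Rightarrow> real"
  assumes p: "p > 1"
    and int_w: "integrable M w" and int_s: "integrable M s"
    and s_pos: "\<And>x. x \<in> space M \<Longrightarrow> s x > 0"
    and w_eq: "\<And>x. x \<in> space M \<Longrightarrow> w x = s x powr (1 - p)"
    and W_nonneg: "W \<ge> 0" and C_nonneg: "C \<ge> 0"
    and Ap: "\<And>i. i \<in> I \<Longrightarrow> mass w i * mass s i powr (p - 1) \<le> W * measure M (Q i) powr p"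
begin

lemma w_pos: "x \<in> space M \<Longrightarrow> w x > 0"
  using w_eq[of x] s_pos[of x] by simp

text \<open>The exponent \<open>2 - p\<close> lies between \<open>1 - p\<close>, the exponent of
  \<open>w\<close>, and 0, so the power is at most \<open>w\<close> where \<open>s < 1\<close> and
  at most \<open>s\<close> elsewhere.\<close>

lemma integrable_s_powr:
  assumes "p \<ge> 2" shows "integrable M (\<lambda>x. s x powr (2 - p))"
proof (rule Bochner_Integration.integrable_bound)
  show "integrable M (\<lambda>x. s x + w x)" using int_s int_w by auto
  have [measurable]: "s \<in> borel_measurable M" using int_s by auto
  show "(\<lambda>x. s x powr (2 - p)) \<in> borel_measurable M" by measurable
  show "AE x in M. norm (s x powr (2 - p)) \<le> norm (s x + w x)"
  proof (intro AE_I2)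
    fix x assume x: "x \<in> space M"
    have "s x powr (2 - p) \<le> s x + w x"
    proof (cases "s x \<ge> 1")
      case True
      then have "s x powr (2 - p) \<le> s x powr 1" using assms by (intro powr_mono) auto
      then show ?thesis using w_pos[OF x] s_pos[OF x] by simp
    next
      case False
      then have "s x powr (2 - p) \<le> s x powr (1 - p)" using s_pos[OF x] by (intro powr_mono') auto
      then show ?thesis using s_pos[OF x] by (simp add: w_eq[OF x])
    qed
    then show "norm (s x powr (2 - p)) \<le> norm (s x + w x)"
      using s_pos[OF x] w_pos[OF x] by simp
  qed
qed

lemma integrable_depth: 
  assumes "p \<ge> 2" "i \<in> I"
  shows "integrable M (\<lambda>x. (indicator (Q i) x / depth_weight i x) * s x powr (2 - p))"
proof (rule integrable_bounded_mult[where B = 1])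
  show "integrable M (\<lambda>x. s x powr (2 - p))" using assms by (intro integrable_s_powr)
  show "(\<lambda>x. indicator (Q i) x / depth_weight i x) \<in> borel_measurable M"
    using assms by (intro borel_measurable_divide borel_measurable_indicator sets_Q depth_weight_measurable)
  show "\<bar>indicator (Q i) x / depth_weight i x\<bar> \<le> 1" if "x \<in> space M" for x
    using depth_weight_ge_1[OF assms(2), of x] by (auto simp: indicator_def)
qed

text \<open>The $A_p$ condition enters through a single application on each set, so that no
  power of the packing constant is lost: Hoelder's inequality with the exponents
  $1/p$, $(p-2)/p$, $1/p$ replaces the usual comparison of a set with its top half.\<close>

lemma mass_product_le:
  assumes "p \<ge> 2" "i \<in> I"
  shows "mass s i * mass w i / measure M (Q i)
    \<le> W * C * (\<integral>x. (indicator (Q i) x / depth_weight i x) * s x powr (2 - p) \<partial>M)"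
proof -
  define A where "A = (\<integral>x. (indicator (Q i) x / depth_weight i x) * s x powr (2 - p) \<partial>M)"
  define B where "B = mass s i"
  define V where "V = mass (depth_weight i) i"
  define \<mu> where "\<mu> = measure M (Q i)"
  have \<mu>: "\<mu> > 0" using measure_Q_pos assms by (simp add: \<mu>_def)
  have B: "B > 0" unfolding B_def using assms int_s s_pos by (intro mass_pos)
  have int_dw: "integrable M (\<lambda>x. indicator (Q i) x * depth_weight i x)"
    using assms depth_weight_bounded[of i]
    by (intro integrable_Q integrable_const_bound[where B = "\<Sum>j\<in>I. 2 ^ lev j"]) auto
  have V: "V \<ge> \<mu>"
  proof -
    have "\<mu> = (\<integral>x. indicator (Q i) x \<partial>M)" using assms by (simp add: \<mu>_def Int_absorb2 Q_space subset_iff)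
    also have "\<dots> \<le> V" unfolding V_def mass_def
    proof (intro integral_mono int_dw)
      show "integrable M (indicator (Q i) :: 'a \<Rightarrow> real)"
        using integrable_Q[OF assms(2), of "\<lambda>_. 1"] by simp
    qed (use depth_weight_ge_1[OF assms(2)] in \<open>auto simp: indicator_def\<close>)
    finally show ?thesis .
  qed
  have VC: "V \<le> C * \<mu>" using mass_depth_weight assms by (simp add: V_def \<mu>_def)
  have A_eq: "A = mass (\<lambda>x. (indicator (Q i) x / depth_weight i x) * s x powr (2 - p)) i"
    unfolding A_def mass_def by (intro Bochner_Integration.integral_cong) (auto simp: indicator_def)
  have A: "A > 0"
  proof -
    have "A \<noteq> 0"
    proof
      assume "A = 0"
      then have "AE x in M. (indicator (Q i) x / depth_weight i x) * s x powr (2 - p) = 0"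
        unfolding A_def using integrable_depth[OF assms] depth_weight_ge_1[OF assms(2)]
        by (subst (asm) integral_nonneg_eq_0_iff_AE) (force simp: indicator_def)+
      then have "AE x in M. x \<notin> Q i"
        by (rule AE_mp) (use s_pos depth_weight_ge_1[OF assms(2)] in \<open>force simp: indicator_def split: if_splits\<close>)
      then have "emeasure M (Q i) = 0"
        using assms sets_Q by (subst (asm) AE_iff_measurable[where N = "Q i"]) (auto dest: Q_space)
      then show False using \<mu> by (simp add: measure_def \<mu>_def)
    qed
    moreover have "A \<ge> 0" unfolding A_def
      by (intro Bochner_Integration.integral_nonneg) (simp add: depth_weight_def sum_nonneg)
    ultimately show ?thesis by simp
  qed
  define K where "K = (1 / A) powr (1 / p) * (1 / B) powr ((p - 2) / p) * (1 / V) powr (1 / p)"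
  have "\<mu> * K = (\<integral>x. indicator (Q i) x * K \<partial>M)"
    using assms by (simp add: \<mu>_def Int_absorb2 Q_space subset_iff)
  also have "\<dots> \<le> (\<integral>x. (1 / p) / A * ((indicator (Q i) x / depth_weight i x) * s x powr (2 - p))
      + ((p - 2) / p / B * (indicator (Q i) x * s x) + (1 / p) / V * (indicator (Q i) x * depth_weight i x)) \<partial>M)"
  proof (intro integral_mono)
    show "integrable M (\<lambda>x. indicator (Q i) x * K)"
      using assms sets_Q by (auto simp: emeasure_eq_measure)
    show "integrable M (\<lambda>x. (1 / p) / A * ((indicator (Q i) x / depth_weight i x) * s x powr (2 - p))
      + ((p - 2) / p / B * (indicator (Q i) x * s x) + (1 / p) / V * (indicator (Q i) x * depth_weight i x)))"
      using integrable_depth[OF assms] integrable_Q[OF assms(2) int_s] int_dw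
      by (intro Bochner_Integration.integrable_add integrable_mult_right)
    fix x assume x: "x \<in> space M"
    show "indicator (Q i) x * K \<le> (1 / p) / A * ((indicator (Q i) x / depth_weight i x) * s x powr (2 - p))
      + ((p - 2) / p / B * (indicator (Q i) x * s x) + (1 / p) / V * (indicator (Q i) x * depth_weight i x))"
    proof (cases "x \<in> Q i")
      case True
      define v where "v = depth_weight i x"
      have v: "v > 0" using depth_weight_ge_1[OF assms(2) True] by (simp add: v_def)
      have sx: "s x > 0" using s_pos x by auto
      \<comment> \<open>The exponents are chosen so that the powers of \<open>s x\<close> and of
        \<open>v\<close> cancel: the product of the three normalised integrands is the same constant
        at every point of \<open>Q i\<close>.\<close>
      have "K = (s x powr (2 - p) / v / A) powr (1 / p) * (s x / B) powr ((p - 2) / p) * (v / V) powr (1 / p)"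
      proof -
        have "s x powr ((2 - p) * (1 / p)) * s x powr ((p - 2) / p) = 1"
          using sx p by (simp add: powr_add[symmetric] field_simps)
        then have "(s x powr (2 - p) / v / A) powr (1 / p) * (s x / B) powr ((p - 2) / p) * (v / V) powr (1 / p)
          = (1 / A) powr (1 / p) * (1 / B) powr ((p - 2) / p) * (1 / V) powr (1 / p)"
          using sx v A B V \<mu> by (simp add: powr_divide powr_mult powr_powr field_simps)
        then show ?thesis by (simp add: K_def)
      qed
      also have "\<dots> \<le> 1 / p * (s x powr (2 - p) / v / A) + (p - 2) / p * (s x / B) + 1 / p * (v / V)"
        using sx v A B V \<mu> p assms by (intro weighted_amgm3) (auto simp: field_simps)
      finally show ?thesis using True by (simp add: v_def field_simps)
    qed auto
  qed
  also have "\<dots> = 1 / p / A * A + ((p - 2) / p / B * B + 1 / p / V * V)"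
    unfolding A_def B_def V_def mass_def
    by (rule integral_lincomb3[OF integrable_depth[OF assms] integrable_Q[OF assms(2) int_s] int_dw])
  also have "\<dots> = 1" using A B V \<mu> p by (simp add: field_simps)
  finally have "\<mu> * K \<le> 1" .
  then have "(\<mu> * K) powr p \<le> 1 powr p" using \<mu> p by (intro powr_mono2) (auto simp: K_def)
  moreover have "K powr p = 1 / A * (1 / B) powr (p - 2) * (1 / V)"
    using A B V \<mu> p by (simp add: K_def powr_mult powr_powr)
  ultimately have "\<mu> powr p * (1 / A * (1 / B) powr (p - 2) * (1 / V)) \<le> 1"
    using \<mu> by (simp add: powr_mult K_def)
  then have "\<mu> powr p \<le> A * B powr (p - 2) * V"
    using A B V \<mu> by (simp add: powr_divide field_simps)
  also have "\<dots> \<le> A * B powr (p - 2) * (C * \<mu>)" using A VC by (intro mult_left_mono) auto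
  finally have 1: "\<mu> powr p \<le> A * B powr (p - 2) * (C * \<mu>)" .
  have "mass w i * B powr (p - 1) \<le> W * \<mu> powr p" using Ap assms by (simp add: B_def \<mu>_def)
  also have "\<dots> \<le> W * (A * B powr (p - 2) * (C * \<mu>))" using W_nonneg 1 by (intro mult_left_mono)
  finally have "mass w i * B powr (p - 1) \<le> W * (A * B powr (p - 2) * (C * \<mu>))" .
  moreover have "B powr (p - 1) = B * B powr (p - 2)"
    using B powr_mult_base[of B "p - 2"] by simp
  ultimately have "(mass w i * B) * B powr (p - 2) \<le> (W * C * A * \<mu>) * B powr (p - 2)"
    by (simp only: mult_ac)
  then have "mass w i * B \<le> W * C * A * \<mu>" using B by simp
  then show ?thesis using \<mu> by (simp add: A_def B_def \<mu>_def field_simps)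
qed

text \<open>The 4 is a product of two bounds by 2, one for the sum of reciprocal depth weights and
  one for Doob's constant \<open>p / (p - 1)\<close> when \<open>p \<ge> 2\<close>. The factor
  \<open>p\<close> comes from the summation by parts in \<open>powr_sum_le\<close>.\<close>

lemma sparse_bound_ge_2:
  assumes "p \<ge> 2" and f: "integrable M f" "\<And>x. x \<in> space M \<Longrightarrow> f x \<ge> 0"
    and fw: "integrable M (\<lambda>x. f x powr p * w x)"
  shows "(\<integral>x. sparse_op f x powr p * w x \<partial>M) \<le> (4 * C * p * W) powr p * (\<integral>x. f x powr p * w x \<partial>M)"
proof -
  define K where "K = 2 * C * p * W"
  have K: "K \<ge> 0" using p W_nonneg C_nonneg by (simp add: K_def)
  define c where "c = (\<lambda>i. mass f i / mass s i)"
  define S where "S = (\<lambda>i. \<Sum>l\<le>lev i. level_sum (avg f) (pt i) l)"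
  have a: "avg f i \<ge> 0" for i using f by (intro avg_nonneg)
  have c: "c i \<ge> 0" for i using f s_pos by (auto simp: c_def mass_nonneg less_imp_le)
  have S_nonneg: "S i \<ge> 0" for i using a by (auto simp: S_def intro!: sum_nonneg level_sum_nonneg)
  have S: "(\<Sum>l\<le>lev i. level_sum (avg f) x l) = S i" if "i \<in> I" "x \<in> Q i" for i x
    unfolding S_def using that pt by (intro sum.cong level_sum_cong[of i]) auto
  have S_le: "S i \<le> sparse_op f x" if "i \<in> I" "x \<in> Q i" for i x
    unfolding sparse_op_eq S[OF that, symmetric] using lev_less_height[OF that(1)] a
    by (intro sum_mono2 level_sum_nonneg) auto
  have fs: "(f x / s x) powr p * s x = f x powr p * w x" if "x \<in> space M" for x
    using f(2)[OF that] s_pos[OF that] w_eq[OF that]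
    by (simp add: powr_divide powr_diff)
  have int_fs: "integrable M (\<lambda>x. (f x / s x) powr p * s x)"
    using fw Bochner_Integration.integrable_cong[OF refl fs, of M] by simp
  have 1: "sparse_op f x powr p \<le> p * (\<Sum>i\<in>I. (avg f i * S i powr (p - 1)) * indicator (Q i) x)" for x
  proof -
    have "sparse_op f x powr p \<le>
        p * (\<Sum>m<height. level_sum (avg f) x m * (\<Sum>l\<le>m. level_sum (avg f) x l) powr (p - 1))"
      unfolding sparse_op_eq using p a by (intro powr_sum_le level_sum_nonneg)
    also have "(\<Sum>m<height. level_sum (avg f) x m * (\<Sum>l\<le>m. level_sum (avg f) x l) powr (p - 1))
       = (\<Sum>i\<in>I. avg f i * indicator (Q i) x * (\<Sum>l\<le>lev i. level_sum (avg f) x l) powr (p - 1))"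
      by (rule sum_levels)
    also have "\<dots> = (\<Sum>i\<in>I. (avg f i * S i powr (p - 1)) * indicator (Q i) x)"
      using S by (intro sum.cong refl) (auto simp: indicator_def)
    finally show ?thesis .
  qed
  let ?X = "\<integral>x. sparse_op f x powr p * w x \<partial>M"
  have int_X: "integrable M (\<lambda>x. sparse_op f x powr p * w x)"
    using f int_w p by (intro integrable_sparse_powr_mult) auto
  define u where "u = (\<lambda>i x. (indicator (Q i) x / depth_weight i x) * s x powr (2 - p))"
  have int_u: "integrable M (u i)" if "i \<in> I" for i
    unfolding u_def using assms(1) that by (rule integrable_depth)
  have "?X \<le> (\<integral>x. p * ((\<Sum>i\<in>I. (avg f i * S i powr (p - 1)) * indicator (Q i) x) * w x) \<partial>M)"
  proof (intro integral_mono int_X integrable_mult_right integral_sum_mass int_w)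
    fix x assume "x \<in> space M"
    then show "sparse_op f x powr p * w x \<le> p * ((\<Sum>i\<in>I. (avg f i * S i powr (p - 1)) * indicator (Q i) x) * w x)"
      using mult_right_mono[OF 1[of x], of "w x"] w_pos[of x] by (simp add: mult.assoc)
  qed
  also have "\<dots> = p * (\<Sum>i\<in>I. (avg f i * S i powr (p - 1)) * mass w i)"
    using int_w by (simp add: integral_sum_mass)
  also have "\<dots> \<le> p * (\<Sum>i\<in>I. (c i * S i powr (p - 1)) * (W * C * (\<integral>x. u i x \<partial>M)))"
  proof (intro mult_left_mono sum_mono)
    fix i assume i: "i \<in> I"
    have "mass s i > 0" using i int_s s_pos by (intro mass_pos)
    \<comment> \<open>The plain average of \<open>f\<close> is traded for the one with respect to
      \<open>s\<close>. The factor \<open>mass s i\<close> that appears completes the product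
      bounded by \<open>mass_product_le\<close>.\<close>
    then have "(avg f i * S i powr (p - 1)) * mass w i
        = (c i * S i powr (p - 1)) * (mass s i * mass w i / measure M (Q i))"
      by (simp add: c_def avg_def field_simps)
    also have "\<dots> \<le> (c i * S i powr (p - 1)) * (W * C * (\<integral>x. u i x \<partial>M))"
      unfolding u_def using mass_product_le[OF assms(1) i] c by (intro mult_left_mono) auto
    finally show "(avg f i * S i powr (p - 1)) * mass w i
      \<le> (c i * S i powr (p - 1)) * (W * C * (\<integral>x. u i x \<partial>M))" .
  qed (use p in auto)
  also have "\<dots> = p * W * C * (\<integral>x. (\<Sum>i\<in>I. (c i * S i powr (p - 1)) * u i x) \<partial>M)"
    using int_u by (subst Bochner_Integration.integral_sum)
      (auto simp: sum_distrib_left mult_ac intro!: sum.cong)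
  also have "\<dots> \<le> p * W * C * (\<integral>x. (2 * maxi c x * sparse_op f x powr (p - 1)) * s x powr (2 - p) \<partial>M)"
  proof (intro mult_left_mono integral_mono)
    show "integrable M (\<lambda>x. \<Sum>i\<in>I. (c i * S i powr (p - 1)) * u i x)"
      using int_u by (intro Bochner_Integration.integrable_sum integrable_mult_right)
    have "integrable M (\<lambda>x. maxi c x powr 1 * (sparse_op f x powr (p - 1) * s x powr (2 - p)))"
      using integrable_s_powr[OF assms(1)] f c p
      by (intro integrable_maxi_powr_mult integrable_sparse_powr_mult) auto
    then have "integrable M (\<lambda>x. 2 * (maxi c x * (sparse_op f x powr (p - 1) * s x powr (2 - p))))"
      using maxi_nonneg by (intro integrable_mult_right) simp
    then show "integrable M (\<lambda>x. (2 * maxi c x * sparse_op f x powr (p - 1)) * s x powr (2 - p))"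
      by (simp add: mult_ac)
    fix x assume x: "x \<in> space M"
    have "(\<Sum>i\<in>I. (c i * S i powr (p - 1)) * u i x)
        \<le> (\<Sum>i\<in>I. (maxi c x * sparse_op f x powr (p - 1)) * u i x)"
    proof (intro sum_mono)
      fix i assume i: "i \<in> I"
      show "(c i * S i powr (p - 1)) * u i x \<le> (maxi c x * sparse_op f x powr (p - 1)) * u i x"
      proof (cases "x \<in> Q i")
        case True
        have "c i * S i powr (p - 1) \<le> maxi c x * sparse_op f x powr (p - 1)"
          using maxi_ge[OF i True, of c] S_le[OF i True] S_nonneg[of i] c[of i] p maxi_nonneg[of c x]
          by (intro mult_mono powr_mono2) auto
        moreover have "u i x \<ge> 0" using depth_weight_ge_1[OF i True] by (simp add: u_def)
        ultimately show ?thesis by (intro mult_right_mono)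
      qed (auto simp: u_def)
    qed
    also have "\<dots> = (maxi c x * sparse_op f x powr (p - 1)) * ((\<Sum>i\<in>I. indicator (Q i) x / depth_weight i x) * s x powr (2 - p))"
      by (simp add: u_def sum_distrib_left sum_distrib_right)
    also have "\<dots> \<le> (maxi c x * sparse_op f x powr (p - 1)) * (2 * s x powr (2 - p))"
      using sum_inverse_depth_weight[of x] maxi_nonneg[of c x]
      by (intro mult_left_mono mult_right_mono) auto
    finally show "(\<Sum>i\<in>I. (c i * S i powr (p - 1)) * u i x)
        \<le> (2 * maxi c x * sparse_op f x powr (p - 1)) * s x powr (2 - p)"
      by (simp add: mult_ac)
  qed (use p W_nonneg C_nonneg in auto)
  also have "\<dots> = (\<integral>x. K * maxi c x * sparse_op f x powr (p - 1) * s x powr (2 - p) \<partial>M)"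
    by (simp add: K_def mult_ac flip: Bochner_Integration.integral_mult_right_zero)
  also have "\<dots> \<le> (\<integral>x. K powr p / p * (maxi c x powr p * s x) + (1 - 1 / p) * (sparse_op f x powr p * w x) \<partial>M)"
  proof (intro integral_mono)
    have "integrable M (\<lambda>x. maxi c x powr 1 * (sparse_op f x powr (p - 1) * s x powr (2 - p)))"
      using integrable_s_powr[OF assms(1)] f c p
      by (intro integrable_maxi_powr_mult integrable_sparse_powr_mult) auto
    then have "integrable M (\<lambda>x. K * (maxi c x * (sparse_op f x powr (p - 1) * s x powr (2 - p))))"
      using maxi_nonneg by (intro integrable_mult_right) simp
    then show "integrable M (\<lambda>x. K * maxi c x * sparse_op f x powr (p - 1) * s x powr (2 - p))"
      by (simp add: mult_ac)
    have "integrable M (\<lambda>x. maxi c x powr p * s x)"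
      using int_s c p by (intro integrable_maxi_powr_mult) auto
    then show "integrable M (\<lambda>x. K powr p / p * (maxi c x powr p * s x) + (1 - 1 / p) * (sparse_op f x powr p * w x))"
      using int_X by (intro Bochner_Integration.integrable_add integrable_mult_right) auto
    fix x assume x: "x \<in> space M"
    define t where "t = s x"
    have t: "t > 0" "w x = t powr (1 - p)" using s_pos[OF x] w_eq[OF x] by (auto simp: t_def)
    \<comment> \<open>Since \<open>s x powr (2 - p) = w x * s x\<close>, Young's inequality can be
      applied under \<open>w\<close>. The factor \<open>s x\<close> goes with the maximal function,
      whose weight \<open>w x * s x powr p = s x\<close> is then that of Doob's inequality.\<close>
    have "K * maxi c x * sparse_op f x powr (p - 1) * s x powr (2 - p)
      = w x * ((K * maxi c x * t) * sparse_op f x powr (p - 1))"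
      using t powr_mult_base[of t "1 - p"] by (simp add: t_def[symmetric] mult.commute[of _ t])
    also have "\<dots> \<le> w x * ((K * maxi c x * t) powr p / p + (1 - 1 / p) * sparse_op f x powr p)"
      using t p K maxi_nonneg[of c x] sparse_op_nonneg[of f x] f by (intro mult_left_mono young_powr) auto
    also have "(K * maxi c x * t) powr p = K powr p * maxi c x powr p * t powr p"
      using t K maxi_nonneg[of c x] by (simp add: powr_mult)
    also have "w x * (K powr p * maxi c x powr p * t powr p / p + (1 - 1 / p) * sparse_op f x powr p)
      = K powr p / p * (maxi c x powr p * (w x * t powr p)) + (1 - 1 / p) * (sparse_op f x powr p * w x)"
      by (simp add: field_simps)
    also have "w x * t powr p = s x" using t by (simp add: powr_add[symmetric] t_def[symmetric])
    finally show "K * maxi c x * sparse_op f x powr (p - 1) * s x powr (2 - p)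
      \<le> K powr p / p * (maxi c x powr p * s x) + (1 - 1 / p) * (sparse_op f x powr p * w x)" .
  qed
  also have "\<dots> = K powr p / p * (\<integral>x. maxi c x powr p * s x \<partial>M) + (1 - 1 / p) * ?X"
    using int_X integrable_maxi_powr_mult[OF c int_s, of p] p by simp
  finally have "?X / p \<le> K powr p / p * (\<integral>x. maxi c x powr p * s x \<partial>M)"
    by (simp add: algebra_simps)
  then have "?X \<le> K powr p * (\<integral>x. maxi c x powr p * s x \<partial>M)"
    using p by (simp add: field_simps)
  also have "\<dots> \<le> K powr p * ((p / (p - 1)) powr p * (\<integral>x. (f x / s x) powr p * s x \<partial>M))"
    unfolding c_def using p int_s s_pos f int_fs by (intro mult_left_mono doob_maximal) auto
  also have "(\<integral>x. (f x / s x) powr p * s x \<partial>M) = (\<integral>x. f x powr p * w x \<partial>M)"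
    by (intro Bochner_Integration.integral_cong) (auto simp: fs)
  also have "K powr p * ((p / (p - 1)) powr p * (\<integral>x. f x powr p * w x \<partial>M))
      = (K * (p / (p - 1))) powr p * (\<integral>x. f x powr p * w x \<partial>M)"
    using K p by (subst powr_mult) (auto simp: mult.assoc)
  also have "\<dots> \<le> (K * 2) powr p * (\<integral>x. f x powr p * w x \<partial>M)"
  proof (intro mult_right_mono powr_mono2 mult_left_mono Bochner_Integration.integral_nonneg)
    show "p / (p - 1) \<le> 2" using assms(1) by (simp add: field_simps)
    show "0 \<le> f x powr p * w x" if "x \<in> space M" for x using w_pos[OF that] by simp
  qed (use K p in auto)
  finally show ?thesis by (simp add: K_def mult_ac)
qed

text \<open>The operator is self-adjoint, so the bound for the conjugate exponent
  \<open>q \<ge> 2\<close> with exchanged weights is applied to the extremal test function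
  \<open>g\<close>. The integral of \<open>g powr q * s\<close> is again the quantity to be
  estimated, and absorption finishes the proof.\<close>

lemma sparse_bound_less_2:
  assumes "p < 2" and f: "integrable M f" "\<And>x. x \<in> space M \<Longrightarrow> f x \<ge> 0"
    and fw: "integrable M (\<lambda>x. f x powr p * w x)"
  shows "(\<integral>x. sparse_op f x powr p * w x \<partial>M)
    \<le> (4 * C * (p / (p - 1)) * W powr (1 / (p - 1))) powr p * (\<integral>x. f x powr p * w x \<partial>M)"
proof -
  define q where "q = p / (p - 1)"
  have q: "q \<ge> 2" "1 / p + 1 / q = 1" "(p - 1) * q = p" "q - 1 = 1 / (p - 1)" "(1 - p) * (1 - q) = 1" "q > 1"
    using p assms(1) by (auto simp: q_def field_simps)
  interpret dual: laminar_Ap M I Q lev C q "W powr (q - 1)" s w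
  proof
    show "s x = w x powr (1 - q)" if "x \<in> space M" for x
      using s_pos[OF that] w_eq[OF that] q by (simp add: powr_powr)
    fix i assume i: "i \<in> I"
    have pos: "mass w i > 0" "mass s i > 0" "measure M (Q i) > 0"
      using i int_s int_w s_pos w_pos measure_Q_pos by (auto intro!: mass_pos)
    have "(mass w i * mass s i powr (p - 1)) powr (q - 1) \<le> (W * measure M (Q i) powr p) powr (q - 1)"
      using Ap[OF i] q(6) pos by (intro powr_mono2) auto
    also have "(mass w i * mass s i powr (p - 1)) powr (q - 1) = mass s i * mass w i powr (q - 1)"
      using pos p by (simp add: powr_mult powr_powr q(4))
    also have "(W * measure M (Q i) powr p) powr (q - 1) = W powr (q - 1) * measure M (Q i) powr q"
      using pos p W_nonneg by (simp add: powr_mult powr_powr q_def field_simps)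
    finally show "mass s i * mass w i powr (q - 1) \<le> W powr (q - 1) * measure M (Q i) powr q" .
  qed (use int_w int_s w_pos q C_nonneg in auto)
  define K where "K = 4 * C * q * W powr (q - 1)"
  have K: "K \<ge> 0" using q C_nonneg by (simp add: K_def)
  define g where "g = (\<lambda>x. sparse_op f x powr (p - 1) * w x)"
  have g: "integrable M g" "\<And>x. x \<in> space M \<Longrightarrow> g x \<ge> 0"
    using f int_w p w_pos by (auto simp: g_def less_imp_le intro!: integrable_sparse_powr_mult)
  let ?X = "\<integral>x. sparse_op f x powr p * w x \<partial>M" and ?Y = "\<integral>x. f x powr p * w x \<partial>M"
  have int_X: "integrable M (\<lambda>x. sparse_op f x powr p * w x)"
    using f int_w p by (intro integrable_sparse_powr_mult) auto
  have gq: "g x powr q * s x = sparse_op f x powr p * w x" if "x \<in> space M" for x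
  proof -
    have "g x powr q = sparse_op f x powr p * w x powr q"
      using w_pos[OF that] by (simp add: g_def powr_mult powr_powr q)
    also have "w x powr q * s x = w x powr (q + (1 - q))"
      by (simp only: dual.w_eq[OF that] powr_add)
    then have "sparse_op f x powr p * w x powr q * s x = sparse_op f x powr p * w x"
      using w_pos[OF that] by (simp add: mult.assoc)
    finally show ?thesis .
  qed
  have int_gq: "integrable M (\<lambda>x. g x powr q * s x)"
    using int_X Bochner_Integration.integrable_cong[OF refl gq, of M] by simp
  have int_Z: "integrable M (\<lambda>x. sparse_op g x powr q * s x)"
    using g int_s q by (intro integrable_sparse_powr_mult) auto
  have Z: "(\<integral>x. sparse_op g x powr q * s x \<partial>M) \<le> K powr q * ?X"
  proof -
    have "(\<integral>x. sparse_op g x powr q * s x \<partial>M) \<le> K powr q * (\<integral>x. g x powr q * s x \<partial>M)"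
      unfolding K_def using q g int_gq by (intro dual.sparse_bound_ge_2) auto
    also have "(\<integral>x. g x powr q * s x \<partial>M) = ?X" 
      by (intro Bochner_Integration.integral_cong) (auto simp: gq)
    finally show ?thesis .
  qed
  have X_eq: "?X = (\<integral>x. sparse_op g x * f x \<partial>M)"
  proof -
    have "?X = (\<integral>x. sparse_op f x * g x \<partial>M)"
      using f p sparse_op_nonneg[of f]
      by (intro Bochner_Integration.integral_cong) (auto simp: g_def powr_mult_base mult.assoc[symmetric])
    then show ?thesis using sparse_op_duality[OF f(1) g(1)] by simp
  qed
  show ?thesis
  \<comment> \<open>Young's inequality is scaled by \<open>K\<close> below, so \<open>K\<close> has
    to be positive. If \<open>K = 0\<close>, the dual bound makes \<open>sparse_op g\<close> vanish
    almost everywhere, and with it the left side.\<close>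
  proof (cases "K = 0")
    case True
    then have "(\<integral>x. sparse_op g x powr q * s x \<partial>M) \<le> 0" using Z by simp
    moreover have "(\<integral>x. sparse_op g x powr q * s x \<partial>M) \<ge> 0"
      using s_pos by (intro Bochner_Integration.integral_nonneg) (auto simp: less_imp_le)
    ultimately have "(\<integral>x. sparse_op g x powr q * s x \<partial>M) = 0" by simp
    then have "AE x in M. sparse_op g x powr q * s x = 0"
      using int_Z s_pos by (subst (asm) integral_nonneg_eq_0_iff_AE) (auto simp: less_imp_le)
    then have "AE x in M. sparse_op g x * f x = 0"
      by (rule AE_mp) (use s_pos in \<open>fastforce intro!: AE_I2\<close>)
    then have "?X = 0" unfolding X_eq by (rule integral_eq_zero_AE)
    moreover have "?Y \<ge> 0"
      using w_pos by (intro Bochner_Integration.integral_nonneg) (simp add: less_imp_le)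
    ultimately show ?thesis by simp
  next
    case False
    then have K: "K > 0" using K by simp
    have "?X \<le> (\<integral>x. (1 / K) powr q / q * (sparse_op g x powr q * s x) + K powr p / p * (f x powr p * w x) \<partial>M)"
      unfolding X_eq
    proof (intro integral_mono)
      have "integrable M (\<lambda>x. sparse_op g x powr 1 * f x)"
        using f g by (intro integrable_sparse_powr_mult) auto
      then show "integrable M (\<lambda>x. sparse_op g x * f x)"
        using g by (simp add: sparse_op_nonneg)
      show "integrable M (\<lambda>x. (1 / K) powr q / q * (sparse_op g x powr q * s x) + K powr p / p * (f x powr p * w x))"
        using int_Z fw by (intro Bochner_Integration.integrable_add integrable_mult_right)
      fix x assume x: "x \<in> space M"
      have sx: "s x > 0" using s_pos x by auto
      have fx: "f x \<ge> 0" using f x by auto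
      have gx: "sparse_op g x \<ge> 0" using g by (intro sparse_op_nonneg)
      have "sparse_op g x * f x = s x * ((sparse_op g x * (1 / K)) * (K * (f x / s x)))"
        using K sx by (simp add: field_simps)
      also have "\<dots> \<le> s x * ((sparse_op g x * (1 / K)) powr q / q + (K * (f x / s x)) powr p / p)"
        using K sx fx gx q p by (intro mult_left_mono Youngs_inequality) auto
      also have "(sparse_op g x * (1 / K)) powr q = sparse_op g x powr q * (1 / K) powr q"
        using K gx by (subst powr_mult) auto
      also have "(K * (f x / s x)) powr p = K powr p * (f x powr p * s x powr (- p))"
        using K fx sx by (subst powr_mult) (auto simp: powr_divide powr_minus field_simps)
      finally have "sparse_op g x * f x \<le> (1 / K) powr q / q * (sparse_op g x powr q * s x)
           + K powr p / p * (f x powr p * (s x * s x powr (- p)))"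
        by (simp add: algebra_simps)
      also have "s x * s x powr (- p) = w x" using sx w_eq[OF x] powr_mult_base[of "s x" "- p"] by simp
      finally show "sparse_op g x * f x \<le> (1 / K) powr q / q * (sparse_op g x powr q * s x)
           + K powr p / p * (f x powr p * w x)" .
    qed
    also have "\<dots> = (1 / K) powr q / q * (\<integral>x. sparse_op g x powr q * s x \<partial>M) + K powr p / p * ?Y"
      using int_Z fw by simp
    also have "\<dots> \<le> (1 / K) powr q / q * (K powr q * ?X) + K powr p / p * ?Y"
      using Z q p by (intro add_mono mult_left_mono) auto
    also have "\<dots> = (1 / q) * ?X + K powr p / p * ?Y"
      using K q by (simp add: powr_divide)
    also have "1 / q = 1 - 1 / p" using q(2) by linarith
    finally have "?X / p \<le> K powr p / p * ?Y" by (simp add: algebra_simps)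
    then have "?X \<le> K powr p * ?Y" using p by (simp add: field_simps)
    then show ?thesis unfolding K_def q_def[symmetric] q(4)[symmetric] .
  qed
qed

lemma sparse_bound:
  assumes "W \<ge> 1" and f: "integrable M f" "\<And>x. x \<in> space M \<Longrightarrow> f x \<ge> 0"
    and fw: "integrable M (\<lambda>x. f x powr p * w x)"
  shows "(\<integral>x. sparse_op f x powr p * w x \<partial>M)
    \<le> (8 * C * max p (1 / (p - 1)) * W powr (max 1 (1 / (p - 1)))) powr p * (\<integral>x. f x powr p * w x \<partial>M)"
proof -
  have nn: "(\<integral>x. f x powr p * w x \<partial>M) \<ge> 0"
    using w_pos by (intro Bochner_Integration.integral_nonneg) (auto simp: less_imp_le)
  show ?thesis
  proof (cases "p \<ge> 2")
    case True
    then have eq: "max p (1 / (p - 1)) = p" "max 1 (1 / (p - 1)) = 1"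
    proof -
      have "1 / (p - 1) \<le> 1" using True by simp
      then show "max p (1 / (p - 1)) = p" "max 1 (1 / (p - 1)) = 1"
        using True by (intro max_absorb1; linarith)+
    qed
    have "(4 * C * p * W) powr p \<le> (8 * C * p * W) powr p"
      using True C_nonneg W_nonneg by (intro powr_mono2 mult_right_mono) auto
    then show ?thesis
      using sparse_bound_ge_2[OF True f fw] nn W_nonneg mult_right_mono[OF _ nn] unfolding eq
      by (fastforce intro: order_trans)
  next
    case False
    then have p2: "p < 2" by simp
    then have "1 / (p - 1) > 1" using p by (simp add: field_simps)
    then have eq: "max 1 (1 / (p - 1)) = 1 / (p - 1)" by simp
    \<comment> \<open>This is where 4 becomes 8: for \<open>p < 2\<close> the conjugate exponent is
      at most twice \<open>1 / (p - 1)\<close>.\<close>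
    have "p / (p - 1) \<le> 2 * (1 / (p - 1))" using p p2 by (simp add: divide_right_mono)
    also have "\<dots> \<le> 2 * max p (1 / (p - 1))" by simp
    finally have "4 * C * (p / (p - 1)) * W powr (1 / (p - 1)) \<le> 4 * C * (2 * max p (1 / (p - 1))) * W powr (1 / (p - 1))"
      using C_nonneg by (intro mult_right_mono mult_left_mono) auto
    then have "(4 * C * (p / (p - 1)) * W powr (1 / (p - 1))) powr p
        \<le> (8 * C * max p (1 / (p - 1)) * W powr (1 / (p - 1))) powr p"
      using p C_nonneg by (intro powr_mono2) auto
    then show ?thesis
      using sparse_bound_less_2[OF p2 f fw] mult_right_mono[OF _ nn] unfolding eq
      by (fastforce intro: order_trans)
  qed
qed

end

section \<open>Two laminar families of tents in the disc\<close>

lemma space_area [simp]: "space area = UNIV" 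
  by (simp add: area_def)

lemma sets_area [simp]: "sets area = sets lebesgue"
  by (simp add: area_def)

lemma emeasure_area: "A \<in> sets lebesgue \<Longrightarrow> emeasure area A = ennreal (1 / pi) * emeasure lebesgue A"
  by (simp add: area_def emeasure_density nn_integral_cmult_indicator)

lemma emeasure_area_ball: "r \<ge> 0 \<Longrightarrow> emeasure area (ball c r) = ennreal (r\<^sup>2)"
  by (simp add: emeasure_area emeasure_ball ennreal_mult[symmetric] eval_unit_ball_vol field_simps)

lemma open_sets_lebesgue: "open S \<Longrightarrow> S \<in> sets lebesgue"
  by auto

lemma emeasure_area_on:
  "S \<in> sets lebesgue \<Longrightarrow> A \<subseteq> S \<Longrightarrow> emeasure (area_on S) A = emeasure area A"
  by (simp add: emeasure_restrict_space)

lemma space_area_on [simp]: "space (area_on S) = S"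
  by (simp add: space_restrict_space)

lemma sets_area_on: "S \<in> sets lebesgue \<Longrightarrow> sets (area_on S) = {A. A \<subseteq> S \<and> A \<in> sets lebesgue}"
  by (auto simp: sets_restrict_space_iff)

abbreviation unit_disc :: "complex set" where "unit_disc \<equiv> ball 0 1"

abbreviation disc_area :: "complex measure" where "disc_area \<equiv> area_on unit_disc"

lemma finite_disc_area: "finite_measure disc_area"
  by (rule finite_measureI) (simp add: emeasure_area_on emeasure_area_ball)

interpretation disc_area: finite_measure disc_area by (rule finite_disc_area)

definition tent :: "complex \<Rightarrow> real \<Rightarrow> complex set" where
  "tent z r = ball z r \<inter> unit_disc"

lemma tent_sets: "tent z r \<in> sets disc_area"
  by (auto simp: sets_area_on tent_def intro!: open_sets_lebesgue)

lemma tent_subset: "tent z r \<subseteq> unit_disc" by (auto simp: tent_def)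

lemma emeasure_tent: "emeasure disc_area (tent z r) = emeasure area (tent z r)"
  by (simp add: emeasure_area_on tent_def)

lemma measure_tent_le:
  assumes "r \<ge> 0" shows "measure disc_area (tent z r) \<le> r\<^sup>2"
proof -
  have "emeasure disc_area (tent z r) \<le> emeasure area (ball z r)"
    unfolding emeasure_tent by (intro emeasure_mono) (auto simp: tent_def)
  then show ?thesis using assms
    by (simp add: emeasure_area_ball disc_area.emeasure_eq_measure)
qed

text \<open>The disc of radius \<open>r / 2\<close> that touches the unit circle from inside at
  \<open>z\<close>; for \<open>r = 2\<close> it is the unit disc itself.\<close>

lemma ball_subset_tent:
  assumes "norm z = 1" "0 < r" "r \<le> 2"
  shows "ball ((1 - of_real (r / 2)) * z) (r / 2) \<subseteq> tent z r"
proof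
  fix w assume w: "w \<in> ball ((1 - of_real (r / 2)) * z) (r / 2)"
  let ?c = "(1 - of_real (r / 2)) * z"
  have "norm (1 - complex_of_real (r / 2)) = \<bar>1 - r / 2\<bar>"
    by (metis norm_of_real of_real_1 of_real_diff)
  then have 1: "norm ?c = 1 - r / 2" using assms by (simp add: norm_mult)
  have "norm w \<le> norm ?c + dist ?c w" by (metis dist_norm norm_minus_commute norm_triangle_sub)
  then have 2: "norm w < 1" using w 1 by simp
  have "norm (z - ?c) = r / 2"
  proof -
    have "z - ?c = of_real (r / 2) * z" by (simp add: algebra_simps)
    then show ?thesis using assms by (simp only: norm_mult norm_of_real)
  qed
  then have "dist z w < r" using w dist_triangle[of z w ?c] by (simp add: dist_norm)
  then show "w \<in> tent z r" using 2 by (simp add: tent_def)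
qed

lemma measure_tent_ge:
  assumes "norm z = 1" "0 < r" "r \<le> 2"
  shows "r\<^sup>2 / 4 \<le> measure disc_area (tent z r)"
proof -
  have "emeasure area (ball ((1 - of_real (r / 2)) * z) (r / 2)) \<le> emeasure disc_area (tent z r)"
    unfolding emeasure_tent using ball_subset_tent[OF assms]
    by (intro emeasure_mono) (auto simp: tent_def)
  then show ?thesis using assms
    by (simp add: emeasure_area_ball disc_area.emeasure_eq_measure power_divide)
qed

lemma tent_eq_disc: "norm z = 1 \<Longrightarrow> r \<ge> 2 \<Longrightarrow> tent z r = unit_disc"
proof -
  assume "norm z = 1" "r \<ge> 2"
  then have "dist z w < r" if "norm w < 1" for w
    using norm_triangle_ineq4[of z w] that by (simp add: dist_norm)
  then show ?thesis by (auto simp: tent_def)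
qed

lemma measure_unit_disc: "measure disc_area unit_disc = 1"
  by (simp add: measure_def emeasure_area_on emeasure_area_ball)

lemma tent_mono: "dist z z' + r' \<le> r \<Longrightarrow> tent z' r' \<subseteq> tent z r"
proof
  fix w assume "dist z z' + r' \<le> r" "w \<in> tent z' r'"
  then show "w \<in> tent z r" using dist_triangle[of z w z'] by (auto simp: tent_def)
qed

lemma tent_disjoint: "r + r' \<le> dist z z' \<Longrightarrow> tent z r \<inter> tent z' r' = {}"
proof -
  assume "r + r' \<le> dist z z'"
  then have False if "w \<in> tent z r" "w \<in> tent z' r'" for w
    using dist_triangle[of z z' w] that by (auto simp: tent_def dist_commute)
  then show ?thesis by auto
qed

section \<open>Chord lengths and the arcs cut out by the grids\<close>

lemma dist_cis: "dist (cis a) (cis b) = 2 * \<bar>sin ((a - b) / 2)\<bar>"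
proof -
  have "(dist (cis a) (cis b))\<^sup>2 = (cos a - cos b)\<^sup>2 + (sin a - sin b)\<^sup>2"
    by (simp add: dist_norm cmod_power2)
  also have "\<dots> = 2 - 2 * cos (a - b)"
    using sin_cos_squared_add[of a] sin_cos_squared_add[of b]
    unfolding power2_eq_square cos_diff by algebra
  also have "cos (a - b) = 1 - 2 * (sin ((a - b) / 2))\<^sup>2"
    using cos_double_sin[of "(a - b) / 2"] by (simp only: mult_2 field_sum_of_halves)
  finally have "(dist (cis a) (cis b))\<^sup>2 = (2 * \<bar>sin ((a - b) / 2)\<bar>)\<^sup>2"
    by (simp add: power_mult_distrib)
  then show ?thesis by (rule power2_eq_imp_eq) auto
qed

text \<open>Angles are counted in turns. The free integer \<open>n\<close> allows the difference to
  be reduced to the range from -1/2 to 1/2, where the chord grows with its absolute value.\<close>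

lemma dist_cis_turn:
  fixes s t :: real and n :: int
  shows "dist (cis (2 * pi * s)) (cis (2 * pi * t)) = 2 * \<bar>sin (pi * (s - t - of_int n))\<bar>"
proof -
  have "sin (pi * (s - t - of_int n)) = sin (pi * (s - t)) * cos (pi * of_int n)"
    by (simp add: right_diff_distrib sin_diff)
  moreover have "\<bar>cos (pi * of_int n)\<bar> = 1"
    by (cases "even n") (auto simp: mult.commute)
  ultimately have "\<bar>sin (pi * (s - t - of_int n))\<bar> = \<bar>sin (pi * (s - t))\<bar>"
    by (simp add: abs_mult)
  moreover have "(2 * pi * s - 2 * pi * t) / 2 = pi * (s - t)" by (simp add: field_simps)
  ultimately show ?thesis by (simp only: dist_cis)
qed

text \<open>The slope is at least \<open>cos (pi / 6)\<close>, hence at least 3/4. This is exactly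
  the proportion of an arc that a grid disc keeps, so the loss in passing from arcs to chords is
  paid for by the gaps.\<close>

lemma sin_diff_ge:
  assumes "0 \<le> x" "x \<le> y" "y \<le> pi / 6"
  shows "3 / 4 * (y - x) \<le> sin y - sin x"
proof (cases "x = y")
  case False
  then have "x < y" using assms by simp
  then obtain z where z: "x < z" "z < y" "sin y - sin x = (y - x) * cos z"
    using MVT2[of x y sin cos] by (auto intro: DERIV_sin)
  have "cos (pi / 6) \<le> cos z" using assms z pi_gt_zero by (intro cos_monotone_0_pi_le) auto
  moreover have "3 / 2 \<le> sqrt 3" by (rule real_le_rsqrt) (simp add: power2_eq_square)
  then have "3 / 4 \<le> cos (pi / 6)" by (simp add: cos_30)
  ultimately have "3 / 4 * (y - x) \<le> cos z * (y - x)" using z by (intro mult_right_mono) auto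
  then show ?thesis using z by (simp add: mult.commute)
qed auto

text \<open>For \<open>j \<ge> 1\<close> the disc with centre \<open>ctr b j k\<close> and radius \<open>rad j\<close> cuts out of the circle the middle
  three quarters of the \<open>k\<close>-th arc of length \<open>2 * pi / 8 ^ j\<close>. Without the gaps neighbouring discs
  would overlap, since circles centred on the unit circle do not meet it at right angles. The two
  values \<open>b = 0, 1\<close> give grids rotated by a third of a turn, so that near each boundary point and at
  each scale one of them has a disc that is not too eccentric. Level 0 is the whole disc.\<close>

definition ctr :: "nat \<Rightarrow> nat \<Rightarrow> nat \<Rightarrow> complex" where
  "ctr b j k = cis (2 * pi * ((real k + 1 / 2) / 8 ^ j + real b / 3))"

definition rad :: "nat \<Rightarrow> real" where
  "rad j = (if j = 0 then 2 else 2 * sin (pi * (3 / 8 / 8 ^ j)))"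

definition grid_tent :: "nat \<Rightarrow> nat \<times> nat \<Rightarrow> complex set" where
  "grid_tent b i = tent (ctr b (fst i) (snd i)) (rad (fst i))"

definition grid_index :: "nat \<Rightarrow> (nat \<times> nat) set" where
  "grid_index n = {(j, k). j \<le> n \<and> k < 8 ^ j}"

lemma norm_ctr [simp]: "norm (ctr b j k) = 1" by (simp add: ctr_def)

lemma pow8: "j \<ge> 1 \<Longrightarrow> (8::real) \<le> 8 ^ j"
  using power_increasing[of 1 j "8::real"] by simp

lemma frac8: "j \<ge> 1 \<Longrightarrow> 1 / 8 ^ j \<le> (1 / 8 :: real)"
  using pow8[of j] by (simp add: field_simps)

lemma rad_bounds:
  assumes "j \<ge> 1" shows "9 / 16 * pi / 8 ^ j \<le> rad j" "rad j \<le> 3 / 4 * pi / 8 ^ j"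
proof -
  let ?y = "pi * (3 / 8 / 8 ^ j)"
  have "(3 / 8 / 8 ^ j :: real) = 3 / 8 * (1 / 8 ^ j)" by simp
  also have "\<dots> \<le> 3 / 8 * (1 / 8)" using frac8[OF assms] by (intro mult_left_mono) auto
  finally have "(3 / 8 / 8 ^ j :: real) \<le> 1 / 6" by linarith
  then have "?y \<le> pi * (1 / 6)" by (intro mult_left_mono) auto
  then have "3 / 4 * (?y - 0) \<le> sin ?y - sin 0" by (intro sin_diff_ge) auto
  then show "9 / 16 * pi / 8 ^ j \<le> rad j" using assms by (simp add: rad_def field_simps)
  have "sin ?y \<le> ?y" by (intro sin_x_le_x) auto
  then show "rad j \<le> 3 / 4 * pi / 8 ^ j" using assms by (simp add: rad_def field_simps)
qed

lemma rad_pos: "rad j > 0"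
proof (cases "j = 0")
  case False
  have "0 < 9 / 16 * pi / 8 ^ j" by simp
  then show ?thesis using rad_bounds(1)[of j] False by linarith
qed (simp add: rad_def)

lemma rad_le_2: "rad j \<le> 2"
  by (simp add: rad_def)

text \<open>In turns, \<open>A\<close> is half the kept arc of the coarse disc and \<open>h\<close>
  half the whole arc of the fine one. The hypothesis leaves room for the fine arc including its
  gaps; the two chords differ by at least 3/4 of the arc between them, and the fine radius takes no
  more than that. The conclusion is the containment criterion of \<open>tent_mono\<close>.\<close>

lemma chord_small:
  fixes T :: real
  assumes "1 \<le> j" "j \<le> i" "\<bar>T\<bar> \<le> 3 / 8 / 8 ^ j - 1 / 2 / 8 ^ i"
  shows "2 * \<bar>sin (pi * T)\<bar> + rad i \<le> rad j"
proof -
  define A h :: real where "A = 3 / 8 / 8 ^ j" and "h = 1 / 2 / 8 ^ i"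
  have A: "A \<le> 3 / 64" using mult_left_mono[OF frac8[of j], of "3 / 8"] assms by (simp add: A_def)
  have h: "h > 0" by (simp add: h_def)
  have Ah: "\<bar>T\<bar> \<le> A - h" using assms by (simp add: A_def h_def)
  have "pi * A \<le> pi * (1 / 6)" using A by (intro mult_left_mono) auto
  have *: "\<bar>sin (pi * T)\<bar> = sin (pi * \<bar>T\<bar>)"
  proof -
    have "\<bar>T\<bar> \<le> 1" using Ah A h by linarith
    then have "sin (pi * \<bar>T\<bar>) \<ge> 0" by (intro sin_ge_zero) auto
    then show ?thesis by (cases "T \<ge> 0") auto
  qed
  have "3 / 4 * (pi * A - pi * \<bar>T\<bar>) \<le> sin (pi * A) - sin (pi * \<bar>T\<bar>)"
    using Ah h \<open>pi * A \<le> pi * (1 / 6)\<close> by (intro sin_diff_ge) auto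
  moreover have "3 / 4 * (pi * h) \<le> 3 / 4 * (pi * A - pi * \<bar>T\<bar>)"
    using Ah unfolding right_diff_distrib[symmetric] by (intro mult_left_mono) auto
  moreover have "rad i \<le> 2 * (3 / 4 * (pi * h))"
    using rad_bounds(2)[of i] assms by (simp add: h_def field_simps)
  moreover have "rad j = 2 * sin (pi * A)" using assms by (simp add: rad_def A_def)
  ultimately show ?thesis using * by linarith
qed

text \<open>The counterpart of \<open>chord_small\<close> for arcs that are apart, aimed at
  \<open>tent_disjoint\<close>. The bound by 1/2 keeps the sine increasing up to
  \<open>pi * \<bar>T\<bar>\<close>.\<close>

lemma chord_large:
  fixes T :: real
  assumes "1 \<le> j" "j \<le> i" "3 / 8 / 8 ^ j + 1 / 2 / 8 ^ i \<le> \<bar>T\<bar>" "\<bar>T\<bar> \<le> 1 / 2"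
  shows "rad j + rad i \<le> 2 * \<bar>sin (pi * T)\<bar>"
proof -
  define A h :: real where "A = 3 / 8 / 8 ^ j" and "h = 1 / 2 / 8 ^ i"
  have A: "A \<le> 3 / 64" "A > 0"
    using mult_left_mono[OF frac8[of j], of "3 / 8"] assms by (auto simp: A_def)
  have h: "h > 0" "h \<le> 1 / 16"
    using mult_left_mono[OF frac8[of i], of "1 / 2"] assms by (auto simp: h_def)
  have Ah: "A + h \<le> \<bar>T\<bar>" using assms by (simp add: A_def h_def)
  have "pi * (A + h) \<le> pi * (1 / 6)" using A h by (intro mult_left_mono) auto
  have *: "\<bar>sin (pi * T)\<bar> = sin (pi * \<bar>T\<bar>)"
  proof -
    have "sin (pi * \<bar>T\<bar>) \<ge> 0" using assms(4) by (intro sin_ge_zero) auto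
    then show ?thesis by (cases "T \<ge> 0") auto
  qed
  have "pi * \<bar>T\<bar> \<le> pi * (1 / 2)" using assms(4) by (intro mult_left_mono) auto
  then have "sin (pi * (A + h)) \<le> sin (pi * \<bar>T\<bar>)"
    using A h Ah by (intro sin_monotone_2pi_le) (auto intro: order_trans[of _ 0])
  moreover have "3 / 4 * (pi * (A + h) - pi * A) \<le> sin (pi * (A + h)) - sin (pi * A)"
    using A h \<open>pi * (A + h) \<le> pi * (1 / 6)\<close> by (intro sin_diff_ge) auto
  moreover have "rad i \<le> 2 * (3 / 4 * (pi * h))"
    using rad_bounds(2)[of i] assms by (simp add: h_def field_simps)
  moreover have "rad j = 2 * sin (pi * A)" using assms by (simp add: rad_def A_def)
  ultimately show ?thesis using * by (simp add: algebra_simps)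
qed

text \<open>The signed difference, in turns, of two disc centres. The rotation by
  \<open>b / 3\<close> cancels, so it is the same for both grids.\<close>

definition turn :: "nat \<Rightarrow> nat \<Rightarrow> nat \<Rightarrow> nat \<Rightarrow> real" where
  "turn j k i l = (real k + 1 / 2) / 8 ^ j - (real l + 1 / 2) / 8 ^ i"

lemma ctr_turn_dist:
  fixes n :: int and j k i l b :: nat
  defines "T \<equiv> turn j k i l - of_int n"
  shows "dist (ctr b j k) (ctr b i l) = 2 * \<bar>sin (pi * T)\<bar>"
  unfolding ctr_def T_def turn_def by (subst dist_cis_turn[of _ _ n]) simp

text \<open>The discs of two members of the family meet the circle in arcs whose midpoints differ by
  \<open>T\<close> turns. Since \<open>8 ^ i * T\<close> is a half-integer (or an integer, if \<open>i = j\<close>), the arcs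
  cannot cross.\<close>

lemma turn_dichotomy:
  fixes k l i j :: nat
  assumes "j \<le> i" "k < 8 ^ j" "l < 8 ^ i" "(j, k) \<noteq> (i, l)"
  obtains n :: int where
    "\<bar>n\<bar> \<le> 1" "\<bar>turn j k i l - of_int n\<bar> \<le> 1 / 2"
    "j < i \<and> \<bar>turn j k i l - of_int n\<bar> \<le> 3 / 8 / 8 ^ j - 1 / 2 / 8 ^ i \<or>
     3 / 8 / 8 ^ j + 1 / 2 / 8 ^ i \<le> \<bar>turn j k i l - of_int n\<bar>"
proof -
  define D where "D = turn j k i l"
  define n where "n = round D"
  define T where "T = D - of_int n"
  have unit: "0 < (real k + 1 / 2) / 8 ^ j" "(real k + 1 / 2) / 8 ^ j < 1"
    "0 < (real l + 1 / 2) / 8 ^ i" "(real l + 1 / 2) / 8 ^ i < 1"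
  proof -
    have "real k + 1 \<le> 8 ^ j" "real l + 1 \<le> 8 ^ i"
      using assms(2,3) by (metis Suc_leI of_nat_Suc of_nat_le_iff of_nat_numeral of_nat_power add.commute)+
    then show "0 < (real k + 1 / 2) / 8 ^ j" "(real k + 1 / 2) / 8 ^ j < 1"
    "0 < (real l + 1 / 2) / 8 ^ i" "(real l + 1 / 2) / 8 ^ i < 1" by auto
  qed
  then have D: "\<bar>D\<bar> < 1" unfolding D_def turn_def abs_less_iff by linarith
  have T: "\<bar>T\<bar> \<le> 1 / 2" unfolding T_def n_def using of_int_round_abs_le[of D] by (simp add: abs_minus_commute)
  then have "\<bar>real_of_int n\<bar> < 2" using D unfolding T_def by linarith
  then have n: "\<bar>n\<bar> \<le> 1" by linarith
  have "j < i \<and> \<bar>T\<bar> \<le> 3 / 8 / 8 ^ j - 1 / 2 / 8 ^ i \<or> 3 / 8 / 8 ^ j + 1 / 2 / 8 ^ i \<le> \<bar>T\<bar>"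
  proof (cases "j = i")
    case True
    have kl: "k \<noteq> l" using assms True by auto
    define N :: int where "N = int k - int l - 8 ^ i * n"
    have N: "8 ^ i * T = of_int N"
      by (simp add: T_def D_def turn_def N_def True field_simps)
    have "N \<noteq> 0"
    proof
      assume "N = 0"
      then have "int k - int l = 8 ^ i * n" by (simp add: N_def)
      moreover have "int k < 8 ^ i" "int l < 8 ^ i"
        using assms True by (metis of_nat_less_iff of_nat_numeral of_nat_power)+
      then have "\<bar>int k - int l\<bar> < 8 ^ i" by linarith
      ultimately have "\<bar>8 ^ i * n\<bar> < (8 ^ i :: int)" by simp
      then have "n = 0" by (simp add: abs_mult)
      then show False using \<open>int k - int l = 8 ^ i * n\<close> kl by simp
    qed
    then have "1 \<le> \<bar>of_int N :: real\<bar>" by linarith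
    moreover have "\<bar>8 ^ i * T\<bar> = 8 ^ i * \<bar>T\<bar>" by (simp add: abs_mult)
    ultimately have "1 \<le> 8 ^ i * \<bar>T\<bar>" unfolding N by simp
    then show ?thesis using True by (simp add: field_simps)
  next
    case False
    then have ji: "j < i" using assms by simp
    define d where "d = i - Suc j"
    have i: "i = Suc j + d" using ji by (simp add: d_def)
    define N :: int where "N = int ((2 * k + 1) * 4 * 8 ^ d) - int l - 8 ^ i * n - 1"
    have "8 ^ i * ((real k + 1 / 2) / 8 ^ j) = (2 * real k + 1) * 4 * 8 ^ d"
      by (simp add: i power_add field_simps)
    then have N: "8 ^ i * T = of_int N + 1 / 2"
      by (simp add: T_def D_def turn_def N_def right_diff_distrib)
    \<comment> \<open>In units of the fine arc, half the kept coarse arc is an integer because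
      \<open>j < i\<close> and the ratio of scales is 8. A half-integer distance misses it by at
      least 1/2, which is half a fine arc.\<close>
    have A: "8 ^ i * (3 / 8 / 8 ^ j) = (3 * 8 ^ d :: real)" by (simp add: i power_add)
    define m :: int where "m = 3 * 8 ^ d"
    have "\<bar>of_int N + 1 / 2\<bar> \<le> of_int m - (1 / 2 :: real) \<or> of_int m + (1 / 2 :: real) \<le> \<bar>of_int N + 1 / 2\<bar>"
    proof -
      consider "N \<ge> m" | "N \<le> - m - 1" | "- m \<le> N" "N \<le> m - 1" by linarith
      then show ?thesis
      proof cases
        case 1
        then have "of_int m \<le> (of_int N :: real)" by simp
        then have "of_int m + (1 / 2 :: real) \<le> \<bar>of_int N + 1 / 2\<bar>" by argo
        then show ?thesis ..
      next
        case 2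
        then have "of_int N \<le> (of_int (- m - 1) :: real)" by (simp only: of_int_le_iff)
        then have "of_int N \<le> - of_int m - (1 :: real)" by simp
        then have "of_int m + (1 / 2 :: real) \<le> \<bar>of_int N + 1 / 2\<bar>" by argo
        then show ?thesis ..
      next
        case 3
        then have "of_int (- m) \<le> (of_int N :: real)" "of_int N \<le> (of_int (m - 1) :: real)"
          by (simp_all only: of_int_le_iff)
        then have "- of_int m \<le> (of_int N :: real)" "of_int N \<le> of_int m - (1 :: real)" by simp_all
        then have "\<bar>of_int N + 1 / 2\<bar> \<le> of_int m - (1 / 2 :: real)" by argo
        then show ?thesis ..
      qed
    qed
    moreover have "\<bar>of_int N + 1 / 2\<bar> = 8 ^ i * \<bar>T\<bar>" unfolding N[symmetric] by (simp add: abs_mult)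
    moreover have "(of_int m :: real) = 8 ^ i * (3 / 8 / 8 ^ j)" unfolding A by (simp add: m_def)
    ultimately have "8 ^ i * \<bar>T\<bar> \<le> 8 ^ i * (3 / 8 / 8 ^ j) - 1 / 2 \<or> 8 ^ i * (3 / 8 / 8 ^ j) + 1 / 2 \<le> 8 ^ i * \<bar>T\<bar>"
      by simp
    then have "8 ^ i * \<bar>T\<bar> \<le> 8 ^ i * (3 / 8 / 8 ^ j - 1 / 2 / 8 ^ i) \<or>
        8 ^ i * (3 / 8 / 8 ^ j + 1 / 2 / 8 ^ i) \<le> 8 ^ i * \<bar>T\<bar>"
      by (simp add: right_diff_distrib distrib_left)
    then show ?thesis using ji by simp
  qed
  then show ?thesis using n T by (intro that[of n]) (auto simp: T_def D_def)
qed

lemma tent_turn_dichotomy: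
  assumes "1 \<le> j" "j \<le> i" "k < 8 ^ j" "l < 8 ^ i" "(j, k) \<noteq> (i, l)"
  shows "grid_tent b (j, k) \<inter> grid_tent b (i, l) = {} \<or> j < i \<and> grid_tent b (i, l) \<subseteq> grid_tent b (j, k)"
proof -
  obtain n :: int where n: "\<bar>n\<bar> \<le> 1"
    "\<bar>turn j k i l - of_int n\<bar> \<le> 1 / 2"
    "j < i \<and> \<bar>turn j k i l - of_int n\<bar> \<le> 3 / 8 / 8 ^ j - 1 / 2 / 8 ^ i \<or>
     3 / 8 / 8 ^ j + 1 / 2 / 8 ^ i \<le> \<bar>turn j k i l - of_int n\<bar>"
    by (rule turn_dichotomy[OF assms(2-5)])
  from n(3) show ?thesis
  proof
    assume *: "j < i \<and> \<bar>turn j k i l - of_int n\<bar> \<le> 3 / 8 / 8 ^ j - 1 / 2 / 8 ^ i"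
    have "dist (ctr b j k) (ctr b i l) + rad i \<le> rad j"
      unfolding ctr_turn_dist[of b j k i l n] using assms * by (intro chord_small) auto
    then show ?thesis using * by (auto simp: grid_tent_def dest: tent_mono)
  next
    assume *: "3 / 8 / 8 ^ j + 1 / 2 / 8 ^ i \<le> \<bar>turn j k i l - of_int n\<bar>"
    have "rad j + rad i \<le> dist (ctr b j k) (ctr b i l)"
      unfolding ctr_turn_dist[of b j k i l n] using assms * n(2) by (intro chord_large) auto
    then show ?thesis by (auto simp: grid_tent_def dest: tent_disjoint)
  qed
qed

section \<open>Areas of the grid tents and the packing constant\<close>

lemma grid_tent_root: "grid_tent b (0, k) = unit_disc"
  unfolding grid_tent_def by (rule tent_eq_disc) (auto simp: rad_def)

lemma grid_tent_subset: "grid_tent b i \<subseteq> unit_disc"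
  by (simp add: grid_tent_def tent_subset)

lemma measure_grid_tent_le: "measure disc_area (grid_tent b (j, k)) \<le> 9 / 64 ^ j"
proof (cases "j = 0")
  case False
  have "measure disc_area (grid_tent b (j, k)) \<le> (rad j)\<^sup>2"
    unfolding grid_tent_def using rad_pos[of j] by (auto intro!: measure_tent_le)
  also have "\<dots> \<le> (3 / 4 * pi / 8 ^ j)\<^sup>2"
    using rad_bounds(2)[of j] False rad_pos[of j] by (intro power_mono) auto
  also have "\<dots> \<le> (3 / 8 ^ j)\<^sup>2"
    using pi_less_4 by (intro power_mono divide_right_mono) auto
  also have "\<dots> = 9 / 64 ^ j"
    by (simp add: power_divide power2_eq_square flip: power_mult_distrib)
  finally show ?thesis .
qed (simp add: grid_tent_root measure_unit_disc)

lemma measure_grid_tent_ge: "1 / 2 / 64 ^ j \<le> measure disc_area (grid_tent b (j, k))"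
proof (cases "j = 0")
  case False
  have "(3 / 2 / 8 ^ j)\<^sup>2 \<le> (9 / 16 * pi / 8 ^ j)\<^sup>2"
    using pi_gt3 by (intro power_mono divide_right_mono) auto
  also have "\<dots> \<le> (rad j)\<^sup>2"
    using rad_bounds(1)[of j] False by (intro power_mono) auto
  finally have "(3 / 2 / 8 ^ j)\<^sup>2 / 4 \<le> (rad j)\<^sup>2 / 4" by simp
  also have "\<dots> \<le> measure disc_area (grid_tent b (j, k))"
    unfolding grid_tent_def using measure_tent_ge[of "ctr b j k" "rad j"] rad_pos[of j] rad_le_2[of j] by simp
  also have "(3 / 2 / 8 ^ j)\<^sup>2 / 4 = 9 / 16 / (64 ^ j :: real)"
    by (simp add: power_divide power2_eq_square flip: power_mult_distrib)
  finally show ?thesis by (simp add: field_simps)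
qed (simp add: grid_tent_root measure_unit_disc)

lemma measure_grid_tent_pos: "measure disc_area (grid_tent b i) > 0"
proof -
  have "0 < 1 / 2 / (64 ^ fst i :: real)" by simp
  also have "\<dots> \<le> measure disc_area (grid_tent b i)" using measure_grid_tent_ge[of "fst i" b "snd i"] by simp
  finally show ?thesis .
qed

lemma card_nat_interval:
  fixes y R :: real
  assumes "R \<ge> 0"
  shows "finite {l :: nat. \<bar>real l - y\<bar> \<le> R}" "real (card {l :: nat. \<bar>real l - y\<bar> \<le> R}) \<le> 2 * R + 1"
proof -
  let ?S = "{l :: nat. \<bar>real l - y\<bar> \<le> R}"
  have sub: "?S \<subseteq> {..nat \<lceil>y + R\<rceil>}"
    by auto linarith
  show fin: "finite ?S" using finite_subset[OF sub] by simp
  show "real (card ?S) \<le> 2 * R + 1"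
  proof (cases "?S = {}")
    case False
    define m where "m = Min ?S"
    have m: "m \<in> ?S" unfolding m_def using fin False by (rule Min_in)
    have "?S \<subseteq> {m..m + nat \<lfloor>2 * R\<rfloor>}"
    proof
      fix l assume l: "l \<in> ?S"
      then have "m \<le> l" unfolding m_def using fin by simp
      moreover have "real l - real m \<le> 2 * R" using l m by auto
      then have "int l - int m \<le> \<lfloor>2 * R\<rfloor>" by linarith
      ultimately show "l \<in> {m..m + nat \<lfloor>2 * R\<rfloor>}" by auto
    qed
    then have "card ?S \<le> card {m..m + nat \<lfloor>2 * R\<rfloor>}" by (intro card_mono) auto
    then show ?thesis using assms by simp linarith
  qed (use assms in simp)
qed

text \<open>Below level 0, the midpoint of a proper descendant lies within half the coarse arc of
  the coarse midpoint, modulo whole turns. Only the shifts -1, 0, 1 occur, so the indices lie in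
  three intervals of length \<open>2 * R\<close>. The factor 6 generously covers the three intervals
  and the rounding.\<close>

lemma card_descendants:
  assumes "j \<le> i" "k < 8 ^ j"
  shows "real (card {l. l < 8 ^ i \<and> grid_tent b (i, l) \<subseteq> grid_tent b (j, k)}) \<le> 6 * 8 ^ (i - j)"
proof (cases "j = 0 \<or> i = j")
  case True
  then show ?thesis
  proof
    assume "j = 0"
    have "card {l. l < 8 ^ i \<and> grid_tent b (i, l) \<subseteq> grid_tent b (j, k)} \<le> card {..<8 ^ i :: nat}"
      by (intro card_mono) auto
    then have "real (card {l. l < 8 ^ i \<and> grid_tent b (i, l) \<subseteq> grid_tent b (j, k)}) \<le> real (8 ^ i)"
      by (simp only: card_lessThan of_nat_le_iff)
    also have "\<dots> \<le> 6 * 8 ^ (i - j)" using \<open>j = 0\<close> by simp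
    finally show ?thesis .
  next
    assume "i = j"
    have ne: "grid_tent b (i, l) \<noteq> {}" for l using measure_grid_tent_pos[of b "(i, l)"] by auto
    have "{l. l < 8 ^ i \<and> grid_tent b (i, l) \<subseteq> grid_tent b (j, k)} \<subseteq> {k} \<or> j = 0"
      using tent_turn_dichotomy[of j i k _ b] assms ne \<open>i = j\<close> by fastforce
    then consider "j = 0" | "{l. l < 8 ^ i \<and> grid_tent b (i, l) \<subseteq> grid_tent b (j, k)} \<subseteq> {k}" by auto
    then have "card {l. l < 8 ^ i \<and> grid_tent b (i, l) \<subseteq> grid_tent b (j, k)} \<le> 1"
    proof cases
      case 1
      have "card {l. l < 8 ^ i \<and> grid_tent b (i, l) \<subseteq> grid_tent b (j, k)} \<le> card {..<1 :: nat}"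
        using 1 \<open>i = j\<close> by (intro card_mono) auto
      then show ?thesis by simp
    next
      case 2
      then have "card {l. l < 8 ^ i \<and> grid_tent b (i, l) \<subseteq> grid_tent b (j, k)} \<le> card {k}" by (intro card_mono) auto
      then show ?thesis by simp
    qed
    then show ?thesis using \<open>i = j\<close> by simp
  qed
next
  case False
  then have j: "1 \<le> j" "j < i" using assms by auto
  define R where "R = 8 ^ i * (3 / 8 / 8 ^ j :: real)"
  define y where "y = (\<lambda>n :: int. 8 ^ i * ((real k + 1 / 2) / 8 ^ j - of_int n) - 1 / 2)"
  have i: "(8::real) ^ i = 8 ^ j * 8 ^ (i - j)" using j by (simp flip: power_add)
  have R: "R = 3 / 8 * 8 ^ (i - j)" "R \<ge> 0" by (auto simp: R_def i)
  have ne: "grid_tent b (i, l) \<noteq> {}" for l using measure_grid_tent_pos[of b "(i, l)"] by auto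
  have "{l. l < 8 ^ i \<and> grid_tent b (i, l) \<subseteq> grid_tent b (j, k)} \<subseteq> (\<Union>n\<in>{-1, 0, 1}. {l :: nat. \<bar>real l - y n\<bar> \<le> R})"
  proof safe
    fix l :: nat assume l: "l < 8 ^ i" "grid_tent b (i, l) \<subseteq> grid_tent b (j, k)"
    have "(j, k) \<noteq> (i, l)" using j by auto
    obtain n :: int where n: "\<bar>n\<bar> \<le> 1"
      "\<bar>turn j k i l - of_int n\<bar> \<le> 1 / 2"
      "j < i \<and> \<bar>turn j k i l - of_int n\<bar> \<le> 3 / 8 / 8 ^ j - 1 / 2 / 8 ^ i \<or>
       3 / 8 / 8 ^ j + 1 / 2 / 8 ^ i \<le> \<bar>turn j k i l - of_int n\<bar>"
      by (rule turn_dichotomy[OF assms l(1) \<open>(j, k) \<noteq> (i, l)\<close>])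
    have "\<not> 3 / 8 / 8 ^ j + 1 / 2 / 8 ^ i \<le> \<bar>turn j k i l - of_int n\<bar>"
    proof
      assume *: "3 / 8 / 8 ^ j + 1 / 2 / 8 ^ i \<le> \<bar>turn j k i l - of_int n\<bar>"
      have "rad j + rad i \<le> dist (ctr b j k) (ctr b i l)"
        unfolding ctr_turn_dist[of b j k i l n] using j * n(2) by (intro chord_large) auto
      then have "grid_tent b (j, k) \<inter> grid_tent b (i, l) = {}" by (auto simp: grid_tent_def dest: tent_disjoint)
      then show False using l(2) ne[of l] by auto
    qed
    then have "\<bar>turn j k i l - of_int n\<bar> \<le> 3 / 8 / 8 ^ j - 1 / 2 / 8 ^ i"
      using n(3) by simp
    also have "\<dots> \<le> 3 / 8 / 8 ^ j" by simp
    finally have "8 ^ i * \<bar>turn j k i l - of_int n\<bar> \<le> R"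
      unfolding R_def by (intro mult_left_mono) auto
    also have "8 ^ i * \<bar>turn j k i l - of_int n\<bar>
        = \<bar>8 ^ i * (turn j k i l - of_int n)\<bar>"
      by (simp add: abs_mult)
    also have "8 ^ i * (turn j k i l - of_int n) = y n - real l"
      by (simp add: y_def turn_def right_diff_distrib)
    finally have "\<bar>real l - y n\<bar> \<le> R" by (simp add: abs_minus_commute)
    moreover have "n \<in> {-1, 0, 1}" using n(1) by auto
    ultimately show "l \<in> (\<Union>n\<in>{-1, 0, 1}. {l :: nat. \<bar>real l - y n\<bar> \<le> R})" by blast
  qed
  then have "card {l. l < 8 ^ i \<and> grid_tent b (i, l) \<subseteq> grid_tent b (j, k)} \<le> card (\<Union>n\<in>{-1, 0, 1}. {l :: nat. \<bar>real l - y n\<bar> \<le> R})"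
    using card_nat_interval(1)[OF R(2)] by (intro card_mono) auto
  also have "\<dots> \<le> (\<Sum>n\<in>{-1, 0, 1 :: int}. card {l :: nat. \<bar>real l - y n\<bar> \<le> R})"
    by (intro card_UN_le) auto
  finally have "real (card {l. l < 8 ^ i \<and> grid_tent b (i, l) \<subseteq> grid_tent b (j, k)})
    \<le> real (\<Sum>n\<in>{-1, 0, 1 :: int}. card {l :: nat. \<bar>real l - y n\<bar> \<le> R})"
    by (simp only: of_nat_le_iff)
  also have "\<dots> = (\<Sum>n\<in>{-1, 0, 1 :: int}. real (card {l :: nat. \<bar>real l - y n\<bar> \<le> R}))"
    by (rule of_nat_sum)
  also have "\<dots> \<le> (\<Sum>n\<in>{-1, 0, 1 :: int}. 2 * R + 1)"
    using card_nat_interval(2)[OF R(2)] by (intro sum_mono) auto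
  also have "\<dots> = 9 / 4 * 8 ^ (i - j) + 3" by (simp add: R(1))
  also have "\<dots> \<le> 6 * 8 ^ (i - j)"
  proof -
    have "(8::real) \<le> 8 ^ (i - j)" using j by (intro pow8) simp
    then show ?thesis by linarith
  qed
  finally show ?thesis .
qed

text \<open>From one generation to the next the number of tents grows by 8, the area shrinks by 64
  and the packing weight doubles, so the generations are dominated by a geometric series of ratio
  1/4, with sum at most 4/3. With 6 from the count and 9 and 1/2 from the areas,
  \<open>6 * 9 * (4 / 3) / (1 / 2) = 144\<close>.\<close>

lemma laminar_grid: "laminar_family disc_area (grid_index n) (grid_tent b) fst 144"
proof -
  have fin: "finite (grid_index n)"
  proof (rule finite_subset)
    show "grid_index n \<subseteq> {..n} \<times> {..<8 ^ n}"
      by (auto simp: grid_index_def intro: less_le_trans[OF _ power_increasing])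
  qed auto
  show ?thesis
  proof
    show "finite (grid_index n)" by (rule fin)
    show "grid_tent b i \<in> sets disc_area" for i by (simp add: grid_tent_def tent_sets)
    show "measure disc_area (grid_tent b i) > 0" for i
      by (rule measure_grid_tent_pos)
    show "grid_tent b i \<inter> grid_tent b i' = {} \<or> fst i < fst i' \<and> grid_tent b i' \<subseteq> grid_tent b i"
      if "i \<in> grid_index n" "i' \<in> grid_index n" "i \<noteq> i'" "fst i \<le> fst i'" for i i'
    proof (cases "fst i = 0")
      case True
      then have "fst i' \<noteq> 0" using that by (auto simp: grid_index_def)
      then show ?thesis using True grid_tent_root[of b "snd i"] grid_tent_subset[of b i'] by (cases i) auto
    next
      case False
      then show ?thesis using that tent_turn_dichotomy[of "fst i" "fst i'" "snd i" "snd i'" b]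
        by (auto simp: grid_index_def)
    qed
    show "(\<Sum>i'\<in>{i' \<in> grid_index n. fst i \<le> fst i' \<and> grid_tent b i' \<subseteq> grid_tent b i}. 2 ^ (fst i' - fst i) * measure disc_area (grid_tent b i'))
        \<le> 144 * measure disc_area (grid_tent b i)" if "i \<in> grid_index n" for i
    proof -
      obtain j k where i: "i = (j, k)" by (cases i)
      have jk: "j \<le> n" "k < 8 ^ j" using that by (auto simp: i grid_index_def)
      let ?L = "\<lambda>m. {l. l < 8 ^ m \<and> grid_tent b (m, l) \<subseteq> grid_tent b (j, k)}"
      have "(\<Sum>i'\<in>{i' \<in> grid_index n. fst i \<le> fst i' \<and> grid_tent b i' \<subseteq> grid_tent b i}. 2 ^ (fst i' - fst i) * measure disc_area (grid_tent b i'))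
        = (\<Sum>(m, l)\<in>(SIGMA m:{j..n}. ?L m). 2 ^ (m - j) * measure disc_area (grid_tent b (m, l)))"
        by (intro sum.cong) (auto simp: i grid_index_def)
      also have "\<dots> = (\<Sum>m\<in>{j..n}. \<Sum>l\<in>?L m. 2 ^ (m - j) * measure disc_area (grid_tent b (m, l)))"
        by (subst sum.Sigma) auto
      also have "\<dots> \<le> (\<Sum>m\<in>{j..n}. 54 / 64 ^ j * (1 / 4) ^ (m - j))"
      proof (intro sum_mono)
        fix m assume m: "m \<in> {j..n}"
        have "(\<Sum>l\<in>?L m. 2 ^ (m - j) * measure disc_area (grid_tent b (m, l))) \<le> (\<Sum>l\<in>?L m. 2 ^ (m - j) * (9 / 64 ^ m))"
          using measure_grid_tent_le by (intro sum_mono mult_left_mono) auto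
        also have "\<dots> = real (card (?L m)) * (2 ^ (m - j) * (9 / 64 ^ m))" by simp
        also have "\<dots> \<le> (6 * 8 ^ (m - j)) * (2 ^ (m - j) * (9 / 64 ^ m))"
          using card_descendants[of j m k b] m jk by (intro mult_right_mono) auto
        also have "\<dots> = 54 * (16 ^ (m - j) / 64 ^ m)" by (simp flip: power_mult_distrib)
        also have "(64::real) ^ m = 64 ^ j * (4 ^ (m - j) * 16 ^ (m - j))"
          using m by (simp flip: power_add power_mult_distrib)
        also have "54 * (16 ^ (m - j) / (64 ^ j * (4 ^ (m - j) * 16 ^ (m - j)))) = 54 / 64 ^ j * (1 / 4 :: real) ^ (m - j)"
          by (simp add: power_one_over)
        finally show "(\<Sum>l\<in>?L m. 2 ^ (m - j) * measure disc_area (grid_tent b (m, l))) \<le> 54 / 64 ^ j * (1 / 4) ^ (m - j)" .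
      qed
      also have "\<dots> = 54 / 64 ^ j * (\<Sum>m\<in>{j..n}. (1 / 4) ^ (m - j))" by (simp add: sum_distrib_left)
      also have "(\<Sum>m\<in>{j..n}. (1 / 4) ^ (m - j)) = (\<Sum>m\<le>n - j. (1 / 4 :: real) ^ m)"
        using jk by (intro sum.reindex_bij_witness[where i = "\<lambda>m. m + j" and j = "\<lambda>m. m - j"]) auto
      also have "\<dots> = 4 / 3 - 1 / 3 * (1 / 4) ^ (n - j)"
      proof -
        have "(\<Sum>m\<le>N. (1 / 4 :: real) ^ m) = 4 / 3 - 1 / 3 * (1 / 4) ^ N" for N
          by (induction N) auto
        then show ?thesis .
      qed
      also have "54 / 64 ^ j * \<dots> \<le> 54 / 64 ^ j * (4 / 3)" by (intro mult_left_mono) auto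
      also have "\<dots> = 144 * (1 / 2 / 64 ^ j)" by simp
      also have "\<dots> \<le> 144 * measure disc_area (grid_tent b i)"
        using measure_grid_tent_ge[of j b k] by (simp add: i)
      finally show ?thesis .
    qed
  qed
qed

section \<open>The positive Bergman operator\<close>

text \<open>As \<open>8 ^ j\<close> is not divisible by 3, a third of a turn moves the grid of level
  \<open>j\<close> by one or two thirds of a step, modulo whole steps. A point within 1/6 of a step
  of a division point of one grid is therefore at least 1/6 away from those of the other, that is,
  within 1/3 of a midpoint.\<close>

lemma third_shift:
  fixes s :: real
  shows "\<exists>b\<in>{0, 1 :: nat}. \<exists>m :: int. \<bar>8 ^ j * (s - real b / 3) - (of_int m + 1 / 2)\<bar> \<le> 1 / 3"
proof -
  define t f where "t = 8 ^ j * s" and "f = frac t"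
  have f: "0 \<le> f" "f < 1" "t = of_int \<lfloor>t\<rfloor> + f" by (auto simp: f_def frac_lt_1) (simp add: frac_def)
  show ?thesis
  proof (cases "1 / 6 \<le> f \<and> f \<le> 5 / 6")
    case True
    moreover have "8 ^ j * (s - real 0 / 3) = t" by (simp add: t_def)
    ultimately have "\<bar>8 ^ j * (s - real 0 / 3) - (of_int \<lfloor>t\<rfloor> + 1 / 2)\<bar> \<le> 1 / 3"
      using f(3) by argo
    then show ?thesis by blast
  next
    case False
    have "(8 :: nat) ^ j mod 3 = 1 \<or> (8 :: nat) ^ j mod 3 = 2"
      by (induction j) (auto, presburger+)
    moreover have "8 ^ j = 3 * (8 ^ j div 3) + 8 ^ j mod (3 :: nat)" by simp
    ultimately obtain N e :: nat where e: "8 ^ j = 3 * N + e" "e = 1 \<or> e = 2" by metis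
    have "(8 :: real) ^ j = 3 * real N + real e"
      using arg_cong[OF e(1), of real] by simp
    moreover have "8 ^ j * (s - real 1 / 3) = t - 8 ^ j / 3"
      by (simp add: t_def right_diff_distrib)
    moreover have "(of_int (\<lfloor>t\<rfloor> - int N) :: real) = of_int \<lfloor>t\<rfloor> - real N" by simp
    ultimately have eq: "8 ^ j * (s - real 1 / 3) = of_int (\<lfloor>t\<rfloor> - int N) + (f - real e / 3)"
      using f(3) by argo
    have "\<bar>f - real e / 3 - 1 / 2\<bar> \<le> 1 / 3 \<or> \<bar>f - real e / 3 + 1 / 2\<bar> \<le> 1 / 3"
      using e(2)
    proof
      assume "e = 1"
      then show ?thesis using False f(1,2) by simp argo
    next
      assume "e = 2"
      then show ?thesis using False f(1,2) by simp argo
    qed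
    then have "\<bar>8 ^ j * (s - real 1 / 3) - (of_int (\<lfloor>t\<rfloor> - int N) + 1 / 2)\<bar> \<le> 1 / 3 \<or>
        \<bar>8 ^ j * (s - real 1 / 3) - (of_int (\<lfloor>t\<rfloor> - int N - 1) + 1 / 2)\<bar> \<le> 1 / 3"
      unfolding eq by (auto simp: algebra_simps)
    then show ?thesis by blast
  qed
qed

text \<open>The first bound rests on
  \<open>|1 - x * cnj y|^2 = |x - y|^2 + (1 - |x|^2) * (1 - |y|^2)\<close>. The first two bounds
  together say that a tent of size comparable to \<open>norm (1 - x * cnj y)\<close> can hold both
  points.\<close>

lemma kernel_bounds:
  fixes x y :: complex
  assumes "norm x < 1" "norm y < 1"
  shows "norm (x - y) \<le> norm (1 - x * cnj y)" "1 - norm x \<le> norm (1 - x * cnj y)" "norm (1 - x * cnj y) > 0"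
proof -
  have "(norm (1 - x * cnj y))\<^sup>2 = (norm (x - y))\<^sup>2 + (1 - (norm x)\<^sup>2) * (1 - (norm y)\<^sup>2)"
    by (simp only: cmod_power2) (simp add: power2_eq_square algebra_simps)
  moreover have "(norm x)\<^sup>2 \<le> 1" "(norm y)\<^sup>2 \<le> 1" using assms by (auto simp: power_le_one)
  ultimately have "(norm (x - y))\<^sup>2 \<le> (norm (1 - x * cnj y))\<^sup>2" by simp
  then show "norm (x - y) \<le> norm (1 - x * cnj y)" by (rule power2_le_imp_le) simp
  have "norm x * norm y \<le> norm x * 1" using assms by (intro mult_left_mono) auto
  moreover have "1 - norm x * norm y \<le> norm (1 - x * cnj y)"
    using norm_triangle_ineq2[of 1 "x * cnj y"] by (simp add: norm_mult)
  ultimately show "1 - norm x \<le> norm (1 - x * cnj y)" by simp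
  then show "norm (1 - x * cnj y) > 0" using assms by linarith
qed

text \<open>With \<open>\<tau> = norm (1 - x * cnj y)\<close>, both points lie within
  \<open>2 * \<tau>\<close> of the boundary point in the direction of \<open>x\<close>, and a grid
  tent of comparable size covers them. The last conclusion bounds the level in terms of
  \<open>x\<close> alone, so that finitely many levels serve all \<open>y\<close> at once. The
  constant is \<open>9 * 88\<^sup>2\<close>: the area is at most \<open>9 / 64 ^ j\<close>, and
  \<open>1 / 8 ^ j \<le> 88 * \<tau>\<close>.\<close>

lemma kernel_cover:
  fixes x y :: complex
  assumes xy: "norm x < 1" "norm y < 1"
  obtains b j k where "b \<in> {0, 1 :: nat}" "k < 8 ^ j" "x \<in> grid_tent b (j, k)" "y \<in> grid_tent b (j, k)"
    "1 / (norm (1 - x * cnj y))\<^sup>2 \<le> 69696 / measure disc_area (grid_tent b (j, k))"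
    "j = 0 \<or> 11 * (1 - norm x) < 1 / 8 ^ j"
proof -
  define \<tau> where "\<tau> = norm (1 - x * cnj y)"
  have \<tau>: "norm (x - y) \<le> \<tau>" "1 - norm x \<le> \<tau>" "\<tau> > 0" using kernel_bounds[OF xy] by (auto simp: \<tau>_def)
  show ?thesis
  proof (cases "\<tau> \<ge> 1 / 88")
    case True
    have "(1 / 88)\<^sup>2 \<le> \<tau>\<^sup>2" using True by (intro power_mono) auto
    then have "1 / \<tau>\<^sup>2 \<le> 1 / (1 / 88)\<^sup>2" using \<tau> by (intro divide_left_mono) auto
    then have "1 / \<tau>\<^sup>2 \<le> 69696 / measure disc_area (grid_tent 0 (0, 0))"
      by (simp add: grid_tent_root measure_unit_disc power2_eq_square)
    then show ?thesis using xy that[of 0 0 0] by (auto simp: grid_tent_root \<tau>_def)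
  next
    case False
    \<comment> \<open>The level used is \<open>j = n - 1\<close>, the last one with
      \<open>11 * \<tau> < 1 / 8 ^ j\<close>; one level further the inequality fails, which gives
      the factor 88. The case assumption \<open>\<tau> < 1 / 88\<close> ensures
      \<open>j \<ge> 1\<close>.\<close>
    define n where "n = (LEAST n. (1 / 8) ^ n \<le> 11 * \<tau>)"
    have ex: "\<exists>n. (1 / 8 :: real) ^ n \<le> 11 * \<tau>"
      using real_arch_pow_inv[of "11 * \<tau>" "1 / 8"] \<tau> by (auto intro: less_imp_le)
    have n: "(1 / 8) ^ n \<le> 11 * \<tau>" unfolding n_def using ex by (rule LeastI_ex)
    have n_least: "\<not> (1 / 8) ^ m \<le> 11 * \<tau>" if "m < n" for m
      using that not_less_Least unfolding n_def by blast
    have "n \<ge> 2"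
    proof (rule ccontr)
      assume "\<not> n \<ge> 2"
      then have "(1 / 8 :: real) ^ 1 \<le> (1 / 8) ^ n" by (intro power_decreasing) auto
      then show False using n False by simp
    qed
    define j where "j = n - 1"
    have j: "j \<ge> 1" "n = Suc j" using \<open>n \<ge> 2\<close> by (auto simp: j_def)
    have j1: "11 * \<tau> < 1 / 8 ^ j" using n_least[of j] j by (simp add: power_one_over)
    have j2: "1 / 8 ^ j \<le> 88 * \<tau>" using n by (simp add: j power_one_over)
    have "1 / 8 ^ j \<le> (1 / 8 :: real)" using frac8 j by auto
    then have "norm x > 0" using j1 \<tau> by linarith
    define s where "s = Arg x / (2 * pi)"
    obtain b and m :: int where b: "b \<in> {0, 1 :: nat}" and m: "\<bar>8 ^ j * (s - real b / 3) - (of_int m + 1 / 2)\<bar> \<le> 1 / 3"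
      using third_shift[of j s] by blast
    define k where "k = nat (m mod 8 ^ j)"
    have k: "k < 8 ^ j" unfolding k_def
      by (metis nat_less_iff nat_numeral nat_power_eq pos_mod_sign pos_mod_bound zero_less_numeral zero_less_power zero_le_numeral of_nat_less_iff of_nat_numeral of_nat_power)
    define N :: int where "N = m div 8 ^ j"
    have mk: "real_of_int m = real k + 8 ^ j * of_int N"
    proof -
      have "int k = m mod 8 ^ j" by (simp add: k_def)
      then have "m = int k + 8 ^ j * N" by (simp add: N_def)
      then show ?thesis by simp
    qed
    define T where "T = s - ((real k + 1 / 2) / 8 ^ j + real b / 3) - of_int N"
    have "8 ^ j * T = 8 ^ j * (s - real b / 3) - (of_int m + 1 / 2)"
      by (simp add: T_def mk field_simps)
    then have "8 ^ j * \<bar>T\<bar> \<le> 1 / 3" using m by (metis abs_mult abs_numeral power_abs)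
    then have T: "\<bar>T\<bar> \<le> 1 / 3 / 8 ^ j" by (simp add: field_simps)
    have pos: "0 < 1 / (8 ^ j :: real)" by simp
    define v :: real where "v = 1 / 8 ^ j"
    have v: "v > 0" "v \<le> 1 / 8" using \<open>1 / 8 ^ j \<le> (1 / 8 :: real)\<close> by (auto simp: v_def)
    have T': "\<bar>T\<bar> \<le> 1 / 3 * v" using T by (simp add: v_def)
    define \<zeta> where "\<zeta> = cis (2 * pi * s)"
    have x_eq: "x = of_real (norm x) * \<zeta>"
      using rcis_cmod_Arg[of x] by (simp add: \<zeta>_def s_def rcis_def)
    have "dist \<zeta> x = 1 - norm x"
    proof -
      have "\<zeta> - x = of_real (1 - norm x) * \<zeta>" by (subst x_eq) (simp add: algebra_simps)
      then show ?thesis using xy by (simp only: dist_norm norm_mult norm_of_real) (simp add: \<zeta>_def)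
    qed
    then have d1: "dist \<zeta> x \<le> \<tau>" using \<tau> by simp
    have d2: "dist \<zeta> y \<le> 2 * \<tau>"
      using dist_triangle[of \<zeta> y x] d1 \<tau>(1) by (simp add: dist_norm)
    have d3: "dist (ctr b j k) \<zeta> = 2 * \<bar>sin (pi * T)\<bar>"
      unfolding ctr_def \<zeta>_def T_def by (subst dist_commute, subst dist_cis_turn[of _ _ N]) simp
    have abs_sin: "\<bar>sin (pi * T)\<bar> = sin (pi * \<bar>T\<bar>)"
    proof -
      have "sin (pi * \<bar>T\<bar>) \<ge> 0" using T' v by (intro sin_ge_zero) auto
      then show ?thesis by (cases "T \<ge> 0") auto
    qed
    \<comment> \<open>Half a kept arc is 3/8 of a step and the midpoint is at most 1/3 of a step
      away. With slope 3/4 and \<open>pi > 3\<close>, the remaining 1/24 leaves a margin of more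
      than \<open>2 * (3 / 4) * 3 / 24 = 3 / 16\<close> steps in the radius. This covers
      \<open>2 * \<tau>\<close>, as \<open>2 / 11 < 3 / 16\<close>, which explains the 11.\<close>
    have "pi * (3 / 8 * v) \<le> pi * (1 / 6)" using v by (intro mult_left_mono) auto
    then have "3 / 4 * (pi * (3 / 8 * v) - pi * \<bar>T\<bar>) \<le> sin (pi * (3 / 8 * v)) - sin (pi * \<bar>T\<bar>)"
      using T' v by (intro sin_diff_ge mult_left_mono) auto
    moreover have "3 / 4 * (pi * (1 / 24 * v)) \<le> 3 / 4 * (pi * (3 / 8 * v) - pi * \<bar>T\<bar>)"
      unfolding right_diff_distrib[symmetric] using T' by (intro mult_left_mono) auto
    moreover have "3 * (1 / 24 * v) \<le> pi * (1 / 24 * v)" using pi_gt3 v by (intro mult_right_mono) auto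
    moreover have "rad j = 2 * sin (pi * (3 / 8 * v))" using j by (simp add: rad_def v_def)
    moreover have "11 * \<tau> < v" using j1 by (simp add: v_def)
    moreover have "2 * B1 + 2 * \<tau> < 2 * A1"
      if "3 / 4 * X \<le> A1 - B1" "3 / 4 * Y \<le> 3 / 4 * X" "3 * (1 / 24 * v) \<le> Y" "11 * \<tau> < v"
      for A1 B1 X Y :: real
      using that v(1) by linarith
    ultimately have "dist (ctr b j k) \<zeta> + 2 * \<tau> < rad j"
      unfolding d3 abs_sin by presburger
    then have "x \<in> grid_tent b (j, k)" "y \<in> grid_tent b (j, k)"
      using d1 d2 \<tau> xy dist_triangle[of "ctr b j k" x \<zeta>] dist_triangle[of "ctr b j k" y \<zeta>]
      by (auto simp: grid_tent_def tent_def)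
    moreover have "1 / \<tau>\<^sup>2 \<le> 69696 / measure disc_area (grid_tent b (j, k))"
    proof -
      have m: "measure disc_area (grid_tent b (j, k)) > 0"
        using measure_grid_tent_ge[of j b k] less_le_trans[of 0 "1 / 2 / 64 ^ j :: real"] by auto
      have "measure disc_area (grid_tent b (j, k)) \<le> 9 / 64 ^ j" by (rule measure_grid_tent_le)
      also have "9 / 64 ^ j = 9 * (1 / 8 ^ j :: real)\<^sup>2"
        by (simp add: power_divide power2_eq_square flip: power_mult_distrib)
      also have "\<dots> \<le> 9 * (88 * \<tau>)\<^sup>2" using j2 by (intro mult_left_mono power_mono) auto
      also have "\<dots> = 69696 * \<tau>\<^sup>2" by (simp add: power_mult_distrib)
      finally show ?thesis using m \<tau> by (simp add: field_simps)
    qed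
    moreover have "11 * (1 - norm x) \<le> 11 * \<tau>" using \<tau>(2) by simp
    then have "11 * (1 - norm x) < 1 / 8 ^ j" using j1 by (rule le_less_trans)
    ultimately show ?thesis using b k by (intro that[of b k j]) (auto simp: \<tau>_def)
  qed
qed

section \<open>Domination of the positive operator by averages\<close>

definition pos_bergman :: "(complex \<Rightarrow> real) \<Rightarrow> complex \<Rightarrow> real" where
  "pos_bergman f x = (\<integral>y. f y / (norm (1 - x * cnj y))\<^sup>2 \<partial>disc_area)"

abbreviation sparse :: "nat \<Rightarrow> nat \<Rightarrow> (complex \<Rightarrow> real) \<Rightarrow> complex \<Rightarrow> real" where
  "sparse b n \<equiv> laminar_family.sparse_op disc_area (grid_index n) (grid_tent b)"

lemma borel_measurable_area_on: "f \<in> borel_measurable borel \<Longrightarrow> f \<in> borel_measurable (area_on S)"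
proof (rule measurable_restrict_space1)
  assume "f \<in> borel_measurable borel"
  then have "f \<in> borel_measurable lebesgue" by (intro measurable_completion) simp
  then show "f \<in> borel_measurable area" by (simp add: area_def)
qed

lemma borel_measurable_cnj [measurable]: "cnj \<in> borel_measurable borel"
  by (intro borel_measurable_continuous_onI continuous_intros)

lemma kernel_measurable:
  "(\<lambda>y. 1 / (norm (1 - x * cnj y))\<^sup>2) \<in> borel_measurable disc_area"
  by (rule borel_measurable_area_on) measurable

lemma kernel_le:
  assumes "norm x < 1" "norm y < 1"
  shows "1 / (norm (1 - x * cnj y))\<^sup>2 \<le> 1 / (1 - norm x)\<^sup>2"
  using kernel_bounds[OF assms] assms by (intro divide_left_mono power_mono) auto

lemma integrable_kernel:
  fixes f :: "complex \<Rightarrow> real"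
  assumes "integrable disc_area f" "norm x < 1"
  shows "integrable disc_area (\<lambda>y. f y / (norm (1 - x * cnj y))\<^sup>2)"
proof -
  have "integrable disc_area (\<lambda>y. 1 / (norm (1 - x * cnj y))\<^sup>2 * f y)"
    using assms kernel_le[OF assms(2)]
    by (intro integrable_bounded_mult[where B = "1 / (1 - norm x)\<^sup>2"] kernel_measurable) auto
  then show ?thesis by simp
qed

text \<open>\<open>N\<close> depends on the distance of \<open>x\<close> from the circle and is not
  uniform in \<open>x\<close>. The estimate is therefore a pointwise one, valid from some
  \<open>n\<close> on, which is the form that Fatou's lemma accepts.\<close>

lemma pos_bergman_le_sparse:
  assumes f: "integrable disc_area f" "\<And>y. y \<in> unit_disc \<Longrightarrow> f y \<ge> 0" and x: "norm x < 1"
  shows "\<exists>N. \<forall>n\<ge>N. pos_bergman f x \<le> 69696 * (sparse 0 n f x + sparse 1 n f x)"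
proof -
  obtain N where N: "(1 / 8 :: real) ^ N < 11 * (1 - norm x)"
    using real_arch_pow_inv[of "11 * (1 - norm x)" "1 / 8"] x by auto
  have "pos_bergman f x \<le> 69696 * (sparse 0 n f x + sparse 1 n f x)" if n: "n \<ge> N" for n
  proof -
    interpret L: laminar_family disc_area "grid_index n" "grid_tent b" fst 144 for b by (rule laminar_grid)
    define c where "c = (\<lambda>b i. indicator (grid_tent b i) x / measure disc_area (grid_tent b i))"
    have c: "c b i \<ge> 0" for b i by (simp add: c_def)
    define S where "S = (\<lambda>b y. \<Sum>i\<in>grid_index n. c b i * indicator (grid_tent b i) y)"
    have S_nonneg: "S b y \<ge> 0" for b y unfolding S_def using c by (intro sum_nonneg) auto
    have S_int: "(\<integral>y. S b y * f y \<partial>disc_area) = sparse b n f x" "integrable disc_area (\<lambda>y. S b y * f y)" for b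
    proof -
      show "integrable disc_area (\<lambda>y. S b y * f y)"
        unfolding S_def using L.integral_sum_mass(1)[OF f(1)] by simp
      show "(\<integral>y. S b y * f y \<partial>disc_area) = sparse b n f x"
        unfolding S_def L.integral_sum_mass(2)[OF f(1)] L.sparse_op_def
        by (intro sum.cong) (auto simp: L.avg_def c_def)
    qed
    have "pos_bergman f x \<le> (\<integral>y. 69696 * (S 0 y * f y + S 1 y * f y) \<partial>disc_area)"
      unfolding pos_bergman_def
    proof (intro integral_mono)
      show "integrable disc_area (\<lambda>y. f y / (norm (1 - x * cnj y))\<^sup>2)"
        using f x by (intro integrable_kernel)
      show "integrable disc_area (\<lambda>y. 69696 * (S 0 y * f y + S 1 y * f y))"
        using S_int by (intro integrable_mult_right Bochner_Integration.integrable_add)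
      fix y assume "y \<in> space disc_area"
      then have y: "norm y < 1" by simp
      obtain b j k where bjk: "b \<in> {0, 1 :: nat}" "k < 8 ^ j" "x \<in> grid_tent b (j, k)" "y \<in> grid_tent b (j, k)"
        "1 / (norm (1 - x * cnj y))\<^sup>2 \<le> 69696 / measure disc_area (grid_tent b (j, k))"
        "j = 0 \<or> 11 * (1 - norm x) < 1 / 8 ^ j"
        using kernel_cover[OF x y] by metis
      have "j \<le> n"
      proof (rule ccontr)
        assume "\<not> j \<le> n"
        then have "(1 / 8 :: real) ^ j \<le> (1 / 8) ^ N" using n by (intro power_decreasing) auto
        then show False using bjk(6) N \<open>\<not> j \<le> n\<close> by (auto simp: power_one_over)
      qed
      then have "c b (j, k) * indicator (grid_tent b (j, k)) y \<le> S b y"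
        unfolding S_def using bjk c L.finite_I
        by (intro member_le_sum[where f = "\<lambda>i. c b i * indicator (grid_tent b i) y"]) (auto simp: grid_index_def)
      then have "1 / measure disc_area (grid_tent b (j, k)) \<le> S b y" using bjk by (simp add: c_def)
      also have "\<dots> \<le> S 0 y + S 1 y" using bjk(1) S_nonneg[of 0 y] S_nonneg[of 1 y] by auto
      finally have "1 / (norm (1 - x * cnj y))\<^sup>2 \<le> 69696 * (S 0 y + S 1 y)" using bjk(5) by simp
      then have "1 / (norm (1 - x * cnj y))\<^sup>2 * f y \<le> 69696 * (S 0 y + S 1 y) * f y"
        using f(2)[of y] y by (intro mult_right_mono) auto
      then show "f y / (norm (1 - x * cnj y))\<^sup>2 \<le> 69696 * (S 0 y * f y + S 1 y * f y)"
        by (simp add: algebra_simps)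
    qed
    also have "\<dots> = 69696 * (sparse 0 n f x + sparse 1 n f x)" using S_int by simp
    finally show ?thesis .
  qed
  then show ?thesis by blast
qed

lemma powr_add_le:
  fixes a b :: real
  assumes "a \<ge> 0" "b \<ge> 0" "p > 0"
  shows "(a + b) powr p \<le> 2 powr p * (a powr p + b powr p)"
proof -
  have "(a + b) powr p \<le> (2 * max a b) powr p" using assms by (intro powr_mono2) auto
  also have "\<dots> = 2 powr p * max a b powr p" using assms by (subst powr_mult) auto
  also have "\<dots> \<le> 2 powr p * (a powr p + b powr p)" by (intro mult_left_mono) (auto simp: max_def)
  finally show ?thesis .
qed

text \<open>The constant is \<open>69696 * 4 * 1152\<close>: the comparison of the kernel with the two families, the sum
  of their two \<open>p\<close>-th powers, and \<open>8 * 144\<close> from the packing constant 144.\<close>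

theorem pos_bergman_weighted:
  fixes w s f :: "complex \<Rightarrow> real"
  assumes p: "p > 1" and W: "W \<ge> 1"
    and int_w: "integrable disc_area w" and int_s: "integrable disc_area s"
    and s_pos: "\<And>x. x \<in> unit_disc \<Longrightarrow> s x > 0"
    and w_eq: "\<And>x. x \<in> unit_disc \<Longrightarrow> w x = s x powr (1 - p)"
    and Ap: "\<And>z r. norm z = 1 \<Longrightarrow> r > 0 \<Longrightarrow>
      (\<integral>x. indicator (tent z r) x * w x \<partial>disc_area) * (\<integral>x. indicator (tent z r) x * s x \<partial>disc_area) powr (p - 1)
        \<le> W * measure disc_area (tent z r) powr p"
    and f: "f \<in> borel_measurable disc_area" "\<And>x. x \<in> unit_disc \<Longrightarrow> f x \<ge> 0"
    and fw: "integrable disc_area (\<lambda>x. f x powr p * w x)"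
  shows "integrable disc_area f"
    and "(\<integral>\<^sup>+x. ennreal (pos_bergman f x powr p * w x) \<partial>disc_area)
      \<le> ennreal ((321159168 * (max p (1 / (p - 1)) * W powr max 1 (1 / (p - 1)))) powr p
          * (\<integral>x. f x powr p * w x \<partial>disc_area))"
proof -
  have w_pos: "w x > 0" if "x \<in> unit_disc" for x using w_eq[OF that] s_pos[OF that] by simp
  show int_f: "integrable disc_area f"
  \<comment> \<open>With \<open>t = f / s\<close> the domination is
    \<open>t \<le> 1 + t powr p\<close> multiplied by \<open>s\<close>, because
    \<open>s * t powr p = f powr p * w\<close>.\<close>
  proof (rule Bochner_Integration.integrable_bound)
    show "integrable disc_area (\<lambda>x. s x + f x powr p * w x)" using int_s fw by auto
    show "AE x in disc_area. norm (f x) \<le> norm (s x + f x powr p * w x)"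
    proof (intro AE_I2)
      fix x assume "x \<in> space disc_area"
      then have x: "x \<in> unit_disc" by simp
      define t where "t = f x / s x"
      have t: "t \<ge> 0" using s_pos[OF x] f(2)[OF x] by (simp add: t_def)
      have "t \<le> 1 + t powr p"
      proof (cases "t \<le> 1")
        case False
        then have "t powr 1 \<le> t powr p" using p by (intro powr_mono) auto
        then show ?thesis using t False by simp
      qed (use powr_ge_zero[of t p] in linarith)
      then have "s x * t \<le> s x * (1 + t powr p)" using s_pos[OF x] by (intro mult_left_mono) auto
      also have "\<dots> = s x + f x powr p * w x"
        using s_pos[OF x] f(2)[OF x] w_eq[OF x]
        by (simp add: t_def powr_divide powr_diff field_simps)
      finally show "norm (f x) \<le> norm (s x + f x powr p * w x)"
        using s_pos[OF x] f(2)[OF x] w_pos[OF x] by (simp add: t_def)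
    qed
  qed (use f in auto)
  interpret L: laminar_Ap disc_area "grid_index n" "grid_tent b" fst 144 p W w s for b n
  proof -
    interpret L0: laminar_family disc_area "grid_index n" "grid_tent b" fst 144 by (rule laminar_grid)
    show "laminar_Ap disc_area (grid_index n) (grid_tent b) fst 144 p W w s"
    proof
      fix i assume "i \<in> grid_index n"
      show "L0.mass w i * L0.mass s i powr (p - 1) \<le> W * measure disc_area (grid_tent b i) powr p"
        unfolding L0.mass_def grid_tent_def using rad_pos by (intro Ap) auto
    qed (use p W int_w int_s s_pos w_eq in auto)
  qed
  define Y where "Y = (\<integral>x. f x powr p * w x \<partial>disc_area)"
  have Y: "Y \<ge> 0" unfolding Y_def using w_pos by (intro Bochner_Integration.integral_nonneg) (simp add: less_imp_le)
  define B where "B = max p (1 / (p - 1)) * W powr max 1 (1 / (p - 1))"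
  have B: "B \<ge> 0" using p by (simp add: B_def)
  have sp: "(\<integral>x. sparse b n f x powr p * w x \<partial>disc_area) \<le> (1152 * B) powr p * Y" for b n
    unfolding B_def Y_def using L.sparse_bound[OF W int_f _ fw, of n b] f by (simp add: mult.assoc)
  define K where "K = 69696 powr p * 2 powr p"
  define h where "h = (\<lambda>n x. K * (sparse 0 n f x powr p * w x) + K * (sparse 1 n f x powr p * w x))"
  have int_sp: "integrable disc_area (\<lambda>x. sparse b n f x powr p * w x)" for b n
    using f int_w p by (intro L.integrable_sparse_powr_mult) auto
  have int_h: "integrable disc_area (h n)" for n
    unfolding h_def using int_sp by (intro Bochner_Integration.integrable_add integrable_mult_right)
  have sp_nonneg: "sparse b n f x \<ge> 0" for b n x using f by (intro L.sparse_op_nonneg) auto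
  have h_nonneg: "h n x \<ge> 0" if "x \<in> unit_disc" for n x
    using w_pos[OF that] by (simp add: h_def K_def)
  have "(\<integral>\<^sup>+x. ennreal (pos_bergman f x powr p * w x) \<partial>disc_area)
      \<le> (\<integral>\<^sup>+x. liminf (\<lambda>n. ennreal (h n x)) \<partial>disc_area)"
  proof (intro nn_integral_mono Liminf_bounded)
    fix x assume "x \<in> space disc_area"
    then have x: "x \<in> unit_disc" by simp
    obtain N where N: "pos_bergman f x \<le> 69696 * (sparse 0 n f x + sparse 1 n f x)" if "n \<ge> N" for n
      using pos_bergman_le_sparse[OF int_f f(2), of x] x by auto
    have nn: "pos_bergman f x \<ge> 0" unfolding pos_bergman_def
      using f by (intro Bochner_Integration.integral_nonneg) auto
    show "\<forall>\<^sub>F n in sequentially. ennreal (pos_bergman f x powr p * w x) \<le> ennreal (h n x)"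
    proof (rule eventually_sequentiallyI[of N], rule ennreal_leI)
      fix n assume "N \<le> n"
      have "pos_bergman f x powr p \<le> (69696 * (sparse 0 n f x + sparse 1 n f x)) powr p"
        using N[OF \<open>N \<le> n\<close>] nn p by (intro powr_mono2) auto
      also have "\<dots> = 69696 powr p * (sparse 0 n f x + sparse 1 n f x) powr p"
        using sp_nonneg by (subst powr_mult) auto
      also have "\<dots> \<le> 69696 powr p * (2 powr p * (sparse 0 n f x powr p + sparse 1 n f x powr p))"
        using sp_nonneg p by (intro mult_left_mono powr_add_le) auto
      finally have "pos_bergman f x powr p * w x \<le> 69696 powr p * (2 powr p * (sparse 0 n f x powr p + sparse 1 n f x powr p)) * w x"
        using w_pos[OF x] by (intro mult_right_mono) auto
      then show "pos_bergman f x powr p * w x \<le> h n x" by (simp add: h_def K_def algebra_simps)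
    qed
  qed
  also have "\<dots> \<le> liminf (\<lambda>n. \<integral>\<^sup>+x. ennreal (h n x) \<partial>disc_area)"
    using int_h by (intro nn_integral_liminf) (auto intro!: borel_measurable_integrable measurable_compose[OF _ measurable_ennreal])
  also have "\<dots> \<le> liminf (\<lambda>n :: nat. ennreal ((321159168 * B) powr p * Y))"
  proof (intro Liminf_mono always_eventually allI)
    fix n
    have "(\<integral>\<^sup>+x. ennreal (h n x) \<partial>disc_area) = ennreal (\<integral>x. h n x \<partial>disc_area)"
      using int_h h_nonneg by (intro nn_integral_eq_integral) auto
    also have "(\<integral>x. h n x \<partial>disc_area) = K * (\<integral>x. sparse 0 n f x powr p * w x \<partial>disc_area) + K * (\<integral>x. sparse 1 n f x powr p * w x \<partial>disc_area)"
      unfolding h_def using int_sp by simp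
    also have "\<dots> \<le> K * ((1152 * B) powr p * Y) + K * ((1152 * B) powr p * Y)"
      using sp by (intro add_mono mult_left_mono) (auto simp: K_def)
    also have "\<dots> = 2 * (K * ((1152 * B) powr p * Y))" by simp
    also have "\<dots> \<le> 2 powr p * (K * ((1152 * B) powr p * Y))"
    proof (rule mult_right_mono)
      have "(2::real) powr 1 \<le> 2 powr p" using p by (intro powr_mono) auto
      then show "2 \<le> (2::real) powr p" by simp
    qed (use Y in \<open>auto simp: K_def\<close>)
    also have "\<dots> = (321159168 * B) powr p * Y"
    proof -
      have "(a * (b * (a * c))) powr p = a powr p * (b powr p * (a powr p * c powr p))"
        if "a \<ge> 0" "b \<ge> 0" "c \<ge> 0" for a b c :: real
        using that by (simp add: powr_mult)
      from this[of 2 69696 "1152 * B"] show ?thesis using B by (simp add: K_def mult.assoc)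
    qed
    finally show "(\<integral>\<^sup>+x. ennreal (h n x) \<partial>disc_area) \<le> ennreal ((321159168 * B) powr p * Y)"
      by (simp add: ennreal_leI)
  qed
  also have "\<dots> = ennreal ((321159168 * B) powr p * Y)" by (simp add: Liminf_const)
  finally show "(\<integral>\<^sup>+x. ennreal (pos_bergman f x powr p * w x) \<partial>disc_area)
      \<le> ennreal ((321159168 * (max p (1 / (p - 1)) * W powr max 1 (1 / (p - 1)))) powr p
          * (\<integral>x. f x powr p * w x \<partial>disc_area))"
    by (simp add: B_def Y_def)
qed

section \<open>Conformal change of variables\<close>

text \<open>Change of variables is used in the form for maps of \<open>real ^ 2\<close>, where the
  Jacobian is the determinant of a matrix. This map and \<open>to_vec2\<close> carry measure and
  derivatives between that space and the complex plane.\<close>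

definition of_vec2 :: "real ^ 2 \<Rightarrow> complex" where
  "of_vec2 v = Complex (v $ 1) (v $ 2)"

definition to_vec2 :: "complex \<Rightarrow> real ^ 2" where
  "to_vec2 z = (\<chi> i. if i = 1 then Re z else Im z)"

lemma of_to_vec2 [simp]: "of_vec2 (to_vec2 z) = z"
  by (simp add: of_vec2_def to_vec2_def)

lemma to_of_vec2 [simp]: "to_vec2 (of_vec2 v) = v"
  by (simp add: of_vec2_def to_vec2_def vec_eq_iff forall_2)

lemma to_vec2_image: "to_vec2 ` X = of_vec2 -` X"
proof safe
  fix v assume "of_vec2 v \<in> X"
  then show "v \<in> to_vec2 ` X" by (intro image_eqI[of _ _ "of_vec2 v"]) auto
qed auto

lemma bounded_linear_of_vec2: "bounded_linear of_vec2"
proof -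
  have "linear of_vec2"
    by (rule linearI) (auto simp: of_vec2_def complex_eq_iff)
  then show ?thesis by (rule linear_conv_bounded_linear[THEN iffD1])
qed

lemma bounded_linear_to_vec2: "bounded_linear to_vec2"
proof -
  have "linear to_vec2"
    by (rule linearI) (auto simp: to_vec2_def vec_eq_iff)
  then show ?thesis by (rule linear_conv_bounded_linear[THEN iffD1])
qed

lemma measurable_of_vec2 [measurable]: "of_vec2 \<in> borel_measurable borel"
  by (intro borel_measurable_continuous_onI linear_continuous_on bounded_linear_of_vec2)

lemma measurable_to_vec2 [measurable]: "to_vec2 \<in> borel_measurable borel"
  by (intro borel_measurable_continuous_onI linear_continuous_on bounded_linear_to_vec2)

lemma inner_to_vec2: "to_vec2 z \<bullet> axis 1 1 = Re z" "to_vec2 z \<bullet> axis 2 1 = Im z"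
  by (auto simp: inner_axis to_vec2_def)

lemma lborel_complex_eq: "(lborel :: complex measure) = distr lborel borel of_vec2"
proof (rule lborel_eqI)
  fix l u :: complex
  assume le: "\<And>b. b \<in> Basis \<Longrightarrow> l \<bullet> b \<le> u \<bullet> b"
  have Basis2: "(Basis :: (real ^ 2) set) = {axis 1 1, axis 2 1}"
    by (auto simp: Basis_vec_def UNIV_2)
  have ne: "axis 1 1 \<noteq> (axis 2 1 :: real ^ 2)" by (simp add: axis_eq_axis)
  have "of_vec2 -` box l u = box (to_vec2 l) (to_vec2 u)"
    by (auto simp: box_def Basis2 Basis_complex_def inner_to_vec2 of_vec2_def to_vec2_def inner_axis)
  then have "emeasure (distr lborel borel of_vec2) (box l u) = emeasure lborel (box (to_vec2 l) (to_vec2 u))"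
    by (subst emeasure_distr) auto
  also have "\<dots> = (\<Prod>b\<in>Basis. (to_vec2 u - to_vec2 l) \<bullet> b)"
    using le[of 1] le[of \<i>] by (intro emeasure_lborel_box) (auto simp: Basis2 inner_to_vec2 Basis_complex_def)
  also have "\<dots> = (\<Prod>b\<in>Basis. (u - l) \<bullet> b)"
    using ne by (simp add: Basis2 inner_diff_left inner_to_vec2 Basis_complex_def)
  finally show "emeasure (distr lborel borel of_vec2) (box l u) = (\<Prod>b\<in>Basis. (u - l) \<bullet> b)" .
qed simp

lemma emeasure_lborel_vec2:
  assumes "S \<in> sets borel"
  shows "emeasure lborel S = emeasure lborel (of_vec2 ` S)"
proof -
  have "of_vec2 ` S = to_vec2 -` S" by (force simp: image_iff)
  moreover have "to_vec2 -` S \<in> sets borel" using measurable_sets[OF measurable_to_vec2 assms] by simp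
  moreover have "of_vec2 -` (to_vec2 -` S) = S" by auto
  moreover have "emeasure lborel (of_vec2 ` S) = emeasure (distr lborel borel of_vec2) (of_vec2 ` S)"
    by (simp flip: lborel_complex_eq)
  ultimately show ?thesis by (simp add: emeasure_distr)
qed

lemma det_complex_mult:
  "det (matrix (\<lambda>v. to_vec2 (c * of_vec2 v))) = (cmod c)\<^sup>2"
proof -
  have "matrix (\<lambda>v. to_vec2 (c * of_vec2 v)) $ i $ j
      = (if i = 1 then if j = 1 then Re c else - Im c else if j = 1 then Im c else Re c)" for i j :: 2
    using exhaust_2[of i] exhaust_2[of j]
    by (auto simp: matrix_def to_vec2_def of_vec2_def axis_def)
  then show ?thesis unfolding cmod_power2 by (simp add: det_2 power2_eq_square)
qed

text \<open>The real derivative of a holomorphic map is multiplication by \<open>deriv f z\<close>,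
  and its determinant is the squared modulus. With \<open>S\<close> and its image both Borel, all
  measures can be taken with respect to \<open>lborel\<close> and transported by
  \<open>of_vec2\<close>.\<close>

lemma emeasure_holomorphic_image_borel:
  assumes hol: "f holomorphic_on U" and U: "open U" and inj: "inj_on f U"
    and S: "S \<in> sets borel" "S \<subseteq> U" and fS: "f ` S \<in> sets borel"
  shows "emeasure lborel (f ` S) = (\<integral>\<^sup>+z. indicator S z * ennreal ((cmod (deriv f z))\<^sup>2) \<partial>lborel)"
proof -
  define S' where "S' = to_vec2 ` S"
  define g where "g = (\<lambda>v. to_vec2 (f (of_vec2 v)))"
  define D where "D = (\<lambda>v. (cmod (deriv f (of_vec2 v)))\<^sup>2)"
  have S'_eq: "S' = of_vec2 -` S" unfolding S'_def by (rule to_vec2_image)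
  have S': "S' \<in> sets borel" unfolding S'_eq using measurable_sets[OF measurable_of_vec2 S(1)] by simp
  have gS': "g ` S' = to_vec2 ` f ` S" by (auto simp: g_def S'_def image_iff)
  have gS'_eq: "g ` S' = of_vec2 -` (f ` S)" unfolding gS' by (rule to_vec2_image)
  have gS'_borel: "g ` S' \<in> sets borel" unfolding gS'_eq using measurable_sets[OF measurable_of_vec2 fS] by simp
  have der: "(g has_derivative (\<lambda>v. to_vec2 (deriv f (of_vec2 x) * of_vec2 v))) (at x within S')" if "x \<in> S'" for x
  proof -
    have "of_vec2 x \<in> U" using that S by (auto simp: S'_eq)
    then have "(f has_field_derivative deriv f (of_vec2 x)) (at (of_vec2 x))"
      using hol U holomorphic_derivI by blast
    then have "(f has_derivative (*) (deriv f (of_vec2 x))) (at (of_vec2 x))"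
      by (rule has_field_derivative_imp_has_derivative)
    then have "((\<lambda>v. f (of_vec2 v)) has_derivative (\<lambda>v. deriv f (of_vec2 x) * of_vec2 v)) (at x)"
      by (rule has_derivative_compose[OF bounded_linear_imp_has_derivative[OF bounded_linear_of_vec2]])
    then have "(g has_derivative (\<lambda>v. to_vec2 (deriv f (of_vec2 x) * of_vec2 v))) (at x)"
      unfolding g_def by (rule bounded_linear.has_derivative[OF bounded_linear_to_vec2])
    then show ?thesis by (rule has_derivative_at_withinI)
  qed
  have inj': "inj_on g S'"
  proof (rule inj_onI)
    fix a b assume ab: "a \<in> S'" "b \<in> S'" "g a = g b"
    then have "f (of_vec2 a) = f (of_vec2 b)" unfolding g_def by (metis of_to_vec2)
    moreover have "of_vec2 a \<in> U" "of_vec2 b \<in> U" using ab S by (auto simp: S'_eq)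
    ultimately have "of_vec2 a = of_vec2 b" by (rule inj_onD[OF inj])
    then show "a = b" by (metis to_of_vec2)
  qed
  have key: "g ` S' \<in> lmeasurable \<and> measure lebesgue (g ` S') = m \<longleftrightarrow> (D has_integral m) S'" for m
    using has_measure_differentiable_image[OF _ der inj', of m] S'
    by (simp add: det_complex_mult D_def)
  have D_meas: "(\<lambda>v. indicator S' v * D v) \<in> borel_measurable borel"
  proof -
    have "continuous_on U (deriv f)" using hol U by (intro holomorphic_on_imp_continuous_on holomorphic_deriv)
    then have "(\<lambda>z. indicator U z *\<^sub>R deriv f z) \<in> borel_measurable borel"
      using U by (intro borel_measurable_continuous_on_indicator) auto
    then have meas: "(\<lambda>v. indicator S' v * (cmod (indicator U (of_vec2 v) *\<^sub>R deriv f (of_vec2 v)))\<^sup>2) \<in> borel_measurable borel"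
      using S' by measurable
    have eq: "indicator S' v * (cmod (indicator U (of_vec2 v) *\<^sub>R deriv f (of_vec2 v)))\<^sup>2 = indicator S' v * D v" for v
      using S by (auto simp: S'_eq D_def indicator_def)
    from meas show ?thesis unfolding eq .
  qed
  have key2: "(D has_integral m) S' \<longleftrightarrow> (\<integral>\<^sup>+v. ennreal (indicator S' v * D v) \<partial>lborel) = ennreal m \<and> 0 \<le> m" for m
  proof -
    have "(D has_integral m) S' \<longleftrightarrow> ((\<lambda>v. indicator S' v * D v) has_integral m) UNIV"
      by (subst has_integral_restrict_UNIV[symmetric], rule has_integral_cong) (auto simp: indicator_def)
    also have "\<dots> \<longleftrightarrow> ((\<lambda>v. indicator S' v * D v) \<in> borel_measurable lebesgue \<and>
        (\<integral>\<^sup>+v. ennreal (indicator S' v * D v) \<partial>lebesgue) = ennreal m \<and> 0 \<le> m)"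
      by (rule has_integral_iff_nn_integral_lebesgue) (simp add: D_def)
    also have "(\<integral>\<^sup>+v. ennreal (indicator S' v * D v) \<partial>lebesgue) = (\<integral>\<^sup>+v. ennreal (indicator S' v * D v) \<partial>lborel)"
      by (rule nn_integral_completion)
    finally show ?thesis using D_meas by (auto intro: measurable_completion)
  qed
  \<comment> \<open>\<open>key\<close> and \<open>key2\<close> speak of real values \<open>m\<close>
    only. Both are equivalences, so finiteness of either side implies that of the other, and
    infinite values agree as well.\<close>
  have "emeasure lborel (g ` S') = (\<integral>\<^sup>+v. ennreal (indicator S' v * D v) \<partial>lborel)"
  proof (cases "emeasure lborel (g ` S') = \<infinity>")
    case True
    show ?thesis
    proof (cases "\<integral>\<^sup>+v. ennreal (indicator S' v * D v) \<partial>lborel")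
      case (real r)
      then have "g ` S' \<in> lmeasurable" using key[of r] key2[of r] by auto
      then show ?thesis using True gS'_borel by (auto simp: fmeasurable_def)
    qed (use True in simp)
  next
    case False
    then have fin: "g ` S' \<in> lmeasurable" using gS'_borel by (auto simp: fmeasurable_def less_top)
    then have "(\<integral>\<^sup>+v. ennreal (indicator S' v * D v) \<partial>lborel) = ennreal (measure lebesgue (g ` S'))"
      using key key2 by blast
    also have "\<dots> = emeasure lborel (g ` S')"
      unfolding emeasure_eq_measure2[OF fin, symmetric] using gS'_borel by simp
    finally show ?thesis by simp
  qed
  moreover have "emeasure lborel (g ` S') = emeasure lborel (f ` S)"
    using emeasure_lborel_vec2[OF gS'_borel] by (simp add: gS' image_image)
  moreover have "(\<integral>\<^sup>+v. ennreal (indicator S' v * D v) \<partial>lborel) = (\<integral>\<^sup>+z. indicator S z * ennreal ((cmod (deriv f z))\<^sup>2) \<partial>lborel)"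
  proof -
    have "(\<lambda>z. indicator S z * ennreal ((cmod (deriv f z))\<^sup>2)) = (\<lambda>z. ennreal (indicator S' (to_vec2 z) * D (to_vec2 z)))"
      by (auto simp: fun_eq_iff S'_eq D_def indicator_def)
    moreover have "(\<lambda>z. ennreal (indicator S' (to_vec2 z) * D (to_vec2 z))) \<in> borel_measurable borel"
      using measurable_compose[OF measurable_to_vec2 D_meas] by simp
    ultimately show ?thesis
      by (subst lborel_complex_eq) (simp add: nn_integral_distr)
  qed
  ultimately show ?thesis by simp
qed


section \<open>Integrals under a conformal mapping\<close>

lemma continuous_on_borel_measurable_area:
  fixes f :: "complex \<Rightarrow> 'b :: real_normed_vector"
  assumes "open U" "continuous_on U f"
  shows "f \<in> borel_measurable (area_on U)"
proof -
  have "(\<lambda>z. indicator U z *\<^sub>R f z) \<in> borel_measurable borel"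
    using assms by (intro borel_measurable_continuous_on_indicator) auto
  then have "(\<lambda>z. indicator U z *\<^sub>R f z) \<in> borel_measurable lebesgue"
    by (intro measurable_completion) simp
  then have "(\<lambda>z. indicator U z *\<^sub>R f z) \<in> borel_measurable area" by (simp add: area_def)
  then show ?thesis using assms(1)
    by (subst borel_measurable_restrict_space_iff) auto
qed

lemma nn_integral_area_on:
  assumes "U \<in> sets lebesgue" "f \<in> borel_measurable (area_on U)"
  shows "(\<integral>\<^sup>+z. f z \<partial>area_on U) = ennreal (1 / pi) * (\<integral>\<^sup>+z. indicator U z * f z \<partial>lebesgue)"
proof -
  have "(\<lambda>z. f z * indicator U z) \<in> borel_measurable area"
    using assms by (simp add: borel_measurable_restrict_space_iff_ennreal)
  then have meas: "(\<lambda>z. f z * indicator U z) \<in> borel_measurable lebesgue" by (simp add: area_def)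
  have "(\<integral>\<^sup>+z. f z \<partial>area_on U) = (\<integral>\<^sup>+z. f z * indicator U z \<partial>area)"
    using assms by (intro nn_integral_restrict_space) simp
  also have "\<dots> = (\<integral>\<^sup>+z. ennreal (1 / pi) * (f z * indicator U z) \<partial>lebesgue)"
    unfolding area_def using meas by (subst nn_integral_density) auto
  also have "\<dots> = ennreal (1 / pi) * (\<integral>\<^sup>+z. f z * indicator U z \<partial>lebesgue)"
    using meas by (intro nn_integral_cmult)
  finally show ?thesis by (simp add: mult.commute)
qed

text \<open>Both sets are kept general so that the inverse mapping is an instance again;
  measurability statements in one direction come from applying the results to
  \<open>\<psi>\<close>.\<close>

locale conformal =
  fixes \<phi> :: "complex \<Rightarrow> complex" and U V :: "complex set"
  assumes open_U: "open U" and conf: "conformal_mapping \<phi> U V"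
begin

abbreviation \<psi> :: "complex \<Rightarrow> complex" where "\<psi> \<equiv> inv_into U \<phi>"

lemma hol: "\<phi> holomorphic_on U" "\<psi> holomorphic_on V" and bij: "bij_betw \<phi> U V"
  using conf by (auto simp: conformal_mapping_def)

lemma inj: "inj_on \<phi> U" and image: "\<phi> ` U = V"
  using bij by (auto simp: bij_betw_def)

lemma open_V: "open V"
  using open_mapping_thm3[OF hol(1) open_U inj] image by simp

lemma sets_UV: "U \<in> sets lebesgue" "V \<in> sets lebesgue"
  using open_U open_V by auto

lemma \<psi>_\<phi> [simp]: "z \<in> U \<Longrightarrow> \<psi> (\<phi> z) = z"
  using inj by simp

lemma \<phi>_\<psi> [simp]: "w \<in> V \<Longrightarrow> \<phi> (\<psi> w) = w"
  using image by (simp add: f_inv_into_f)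

lemma \<phi>_in: "z \<in> U \<Longrightarrow> \<phi> z \<in> V" and \<psi>_in: "w \<in> V \<Longrightarrow> \<psi> w \<in> U"
  using image by (auto intro: inv_into_into)

lemma conformal_inverse: "conformal \<psi> V U"
proof
  show "open V" by (rule open_V)
  have "inv_into V \<psi> z = \<phi> z" if "z \<in> U" for z
    using that inv_into_f_eq[of \<psi> V "\<phi> z" z] \<phi>_in bij_betw_imp_inj_on[OF bij_betw_inv_into[OF bij]] by auto
  then have "inv_into V \<psi> holomorphic_on U" using hol(1) by (simp cong: holomorphic_cong)
  then show "conformal_mapping \<psi> V U"
    using hol(2) bij_betw_inv_into[OF bij] by (simp add: conformal_mapping_def)
qed

lemma image_eq_vimage: "S \<subseteq> U \<Longrightarrow> \<phi> ` S = \<psi> -` S \<inter> V"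
  using image by (auto simp: image_iff)

lemma deriv_nonzero: "z \<in> U \<Longrightarrow> deriv \<phi> z \<noteq> 0"
  using holomorphic_injective_imp_regular[OF hol(1) open_U inj] .

lemma image_lebesgue: "S \<in> sets lebesgue \<Longrightarrow> S \<subseteq> U \<Longrightarrow> \<phi> ` S \<in> sets lebesgue"
  using holomorphic_on_imp_differentiable_on[OF hol(1)] differentiable_on_subset
  by (intro differentiable_image_in_sets_lebesgue) auto

lemma image_borel:
  assumes S: "S \<in> sets borel" "S \<subseteq> U" shows "\<phi> ` S \<in> sets borel"
proof -
  have "continuous_on V \<psi>" using hol(2) by (rule holomorphic_on_imp_continuous_on)
  then have "\<psi> \<in> borel_measurable (restrict_space borel V)" by (rule borel_measurable_continuous_on_restrict)
  then have "\<psi> -` S \<inter> V \<in> sets (restrict_space borel V)"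
    using S measurable_sets[of \<psi> "restrict_space borel V" borel S] by (simp add: space_restrict_space)
  then show ?thesis using open_V S by (subst image_eq_vimage) (auto simp: sets_restrict_space_iff)
qed

text \<open>A Lebesgue set is a Borel set up to a null set, and \<open>\<phi>\<close>, being
  differentiable, maps null sets to null sets.\<close>

lemma emeasure_image:
  assumes S: "S \<in> sets lebesgue" "S \<subseteq> U"
  shows "emeasure lebesgue (\<phi> ` S) = (\<integral>\<^sup>+z. indicator S z * ennreal ((cmod (deriv \<phi> z))\<^sup>2) \<partial>lebesgue)"
proof -
  obtain B N where BN: "B \<in> sets borel" "negligible N" "B \<union> N = S"
    using sets_lebesgue_almost_borel[OF S(1)] by blast
  have N: "N \<subseteq> U" "B \<subseteq> U" using BN S by auto
  have negl: "negligible (\<phi> ` N)"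
    using BN N holomorphic_on_imp_differentiable_on[OF hol(1)] differentiable_on_subset
    by (intro negligible_differentiable_image_negligible) auto
  have "emeasure lebesgue (\<phi> ` S) = emeasure lebesgue (\<phi> ` B \<union> \<phi> ` N)"
    using BN(3) by (simp add: image_Un[symmetric])
  also have "\<dots> = emeasure lebesgue (\<phi> ` B)"
    using negl image_borel[OF BN(1) N(2)] by (intro emeasure_Un_null_set) (auto simp: negligible_iff_null_sets)
  also have "\<dots> = emeasure lborel (\<phi> ` B)" using image_borel[OF BN(1) N(2)] by simp
  also have "\<dots> = (\<integral>\<^sup>+z. indicator B z * ennreal ((cmod (deriv \<phi> z))\<^sup>2) \<partial>lborel)"
    using hol open_U inj BN N image_borel[OF BN(1) N(2)] by (intro emeasure_holomorphic_image_borel)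
  also have "\<dots> = (\<integral>\<^sup>+z. indicator B z * ennreal ((cmod (deriv \<phi> z))\<^sup>2) \<partial>lebesgue)"
    by (rule nn_integral_completion[symmetric])
  also have "\<dots> = (\<integral>\<^sup>+z. indicator S z * ennreal ((cmod (deriv \<phi> z))\<^sup>2) \<partial>lebesgue)"
  proof (rule nn_integral_cong_AE)
    have "AE z in lebesgue. z \<notin> N" using BN(2) by (simp add: negligible_iff_null_sets AE_not_in)
    then show "AE z in lebesgue. indicator B z * ennreal ((cmod (deriv \<phi> z))\<^sup>2) = indicator S z * ennreal ((cmod (deriv \<phi> z))\<^sup>2)"
      by (rule AE_mp) (use BN(3) in \<open>auto simp: indicator_def intro!: AE_I2\<close>)
  qed
  finally show ?thesis .
qed

lemma measurable_deriv: "deriv \<phi> \<in> borel_measurable (area_on U)"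
  using hol open_U by (intro continuous_on_borel_measurable_area holomorphic_on_imp_continuous_on holomorphic_deriv)

text \<open>Continuity alone would give measurability for Borel sets. The preimage of a Lebesgue set
  is its image under the differentiable inverse, and such images are Lebesgue sets.\<close>

lemma measurable_\<phi>: "\<phi> \<in> measurable (area_on U) (area_on V)"
proof (rule measurableI)
  fix S assume "S \<in> sets (area_on V)"
  then have S: "S \<subseteq> V" "S \<in> sets lebesgue" using sets_UV by (auto simp: sets_area_on)
  interpret inv: conformal \<psi> V U by (rule conformal_inverse)
  have "\<phi> -` S \<inter> U = \<psi> ` S"
    using S \<phi>_\<psi> \<psi>_\<phi> \<psi>_in by (auto simp: image_iff) (metis \<psi>_\<phi>)
  then show "\<phi> -` S \<inter> space (area_on U) \<in> sets (area_on U)"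
    using inv.image_lebesgue[OF S(2,1)] sets_UV S \<psi>_in by (auto simp: sets_area_on)
qed (auto simp: \<phi>_in)

text \<open>Change of variables as an equality of measures, so that nonnegative and complex
  integrals both transform by this one fact.\<close>

lemma area_distr:
  "distr (density (area_on U) (\<lambda>z. ennreal ((cmod (deriv \<phi> z))\<^sup>2))) (area_on V) \<phi> = area_on V"
proof (rule measure_eqI)
  fix S assume "S \<in> sets (distr (density (area_on U) (\<lambda>z. ennreal ((cmod (deriv \<phi> z))\<^sup>2))) (area_on V) \<phi>)"
  then have SV: "S \<in> sets (area_on V)" by simp
  then have S: "S \<subseteq> V" "S \<in> sets lebesgue" using sets_UV by (auto simp: sets_area_on)
  define R where "R = \<phi> -` S \<inter> U"
  have R: "R \<in> sets (area_on U)" using measurable_sets[OF measurable_\<phi> SV] by (simp add: R_def)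
  then have R': "R \<in> sets lebesgue" "R \<subseteq> U" using sets_UV by (auto simp: sets_area_on)
  have im: "\<phi> ` R = S" using S image by (auto simp: R_def)
  have d: "(\<lambda>z. ennreal ((cmod (deriv \<phi> z))\<^sup>2)) \<in> borel_measurable (area_on U)"
    using measurable_deriv by measurable
  have "emeasure (distr (density (area_on U) (\<lambda>z. ennreal ((cmod (deriv \<phi> z))\<^sup>2))) (area_on V) \<phi>) S
      = emeasure (density (area_on U) (\<lambda>z. ennreal ((cmod (deriv \<phi> z))\<^sup>2))) R"
    using measurable_\<phi> SV by (subst emeasure_distr) (auto simp: R_def)
  also have "\<dots> = (\<integral>\<^sup>+z. ennreal ((cmod (deriv \<phi> z))\<^sup>2) * indicator R z \<partial>area_on U)"
    using d R by (rule emeasure_density)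
  also have "\<dots> = ennreal (1 / pi) * (\<integral>\<^sup>+z. indicator U z * (ennreal ((cmod (deriv \<phi> z))\<^sup>2) * indicator R z) \<partial>lebesgue)"
    using d R sets_UV by (intro nn_integral_area_on) auto
  also have "(\<integral>\<^sup>+z. indicator U z * (ennreal ((cmod (deriv \<phi> z))\<^sup>2) * indicator R z) \<partial>lebesgue)
      = (\<integral>\<^sup>+z. indicator R z * ennreal ((cmod (deriv \<phi> z))\<^sup>2) \<partial>lebesgue)"
    using R' by (intro nn_integral_cong) (auto simp: indicator_def)
  also have "\<dots> = emeasure lebesgue S" using emeasure_image[OF R'] im by simp
  also have "ennreal (1 / pi) * emeasure lebesgue S = emeasure (area_on V) S"
    using S sets_UV by (simp add: emeasure_area_on emeasure_area)
  finally show "emeasure (distr (density (area_on U) (\<lambda>z. ennreal ((cmod (deriv \<phi> z))\<^sup>2))) (area_on V) \<phi>) S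
      = emeasure (area_on V) S" .
qed simp

lemma nn_integral_cov:
  assumes "g \<in> borel_measurable (area_on V)"
  shows "(\<integral>\<^sup>+w. g w \<partial>area_on V) = (\<integral>\<^sup>+z. ennreal ((cmod (deriv \<phi> z))\<^sup>2) * g (\<phi> z) \<partial>area_on U)"
proof -
  have d: "(\<lambda>z. ennreal ((cmod (deriv \<phi> z))\<^sup>2)) \<in> borel_measurable (area_on U)"
    using measurable_deriv by measurable
  have "(\<integral>\<^sup>+w. g w \<partial>area_on V) = (\<integral>\<^sup>+z. g (\<phi> z) \<partial>density (area_on U) (\<lambda>z. ennreal ((cmod (deriv \<phi> z))\<^sup>2)))"
    by (subst area_distr[symmetric], subst nn_integral_distr) (use assms measurable_\<phi> in auto)
  also have "\<dots> = (\<integral>\<^sup>+z. ennreal ((cmod (deriv \<phi> z))\<^sup>2) * g (\<phi> z) \<partial>area_on U)"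
    using d measurable_compose[OF measurable_\<phi> assms] by (rule nn_integral_density)
  finally show ?thesis .
qed

lemma integral_cov:
  fixes g :: "complex \<Rightarrow> complex"
  assumes "g \<in> borel_measurable (area_on V)"
  shows "(\<integral>w. g w \<partial>area_on V) = (\<integral>z. (cmod (deriv \<phi> z))\<^sup>2 *\<^sub>R g (\<phi> z) \<partial>area_on U)"
    and "integrable (area_on V) g \<longleftrightarrow> integrable (area_on U) (\<lambda>z. (cmod (deriv \<phi> z))\<^sup>2 *\<^sub>R g (\<phi> z))"
proof -
  have d: "(\<lambda>z. (cmod (deriv \<phi> z))\<^sup>2) \<in> borel_measurable (area_on U)"
    using measurable_deriv by measurable
  have gm: "(\<lambda>z. g (\<phi> z)) \<in> borel_measurable (area_on U)" by (rule measurable_compose[OF measurable_\<phi> assms])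
  have m: "\<phi> \<in> measurable (density (area_on U) (\<lambda>z. ennreal ((cmod (deriv \<phi> z))\<^sup>2))) (area_on V)"
    using measurable_\<phi> by simp
  have "(\<integral>w. g w \<partial>area_on V) = (\<integral>z. g (\<phi> z) \<partial>density (area_on U) (\<lambda>z. ennreal ((cmod (deriv \<phi> z))\<^sup>2)))"
    by (subst area_distr[symmetric], rule integral_distr[OF m assms])
  also have "\<dots> = (\<integral>z. (cmod (deriv \<phi> z))\<^sup>2 *\<^sub>R g (\<phi> z) \<partial>area_on U)"
    using d gm by (intro integral_density) auto
  finally show "(\<integral>w. g w \<partial>area_on V) = (\<integral>z. (cmod (deriv \<phi> z))\<^sup>2 *\<^sub>R g (\<phi> z) \<partial>area_on U)" .
  have "integrable (area_on V) g \<longleftrightarrow> integrable (density (area_on U) (\<lambda>z. ennreal ((cmod (deriv \<phi> z))\<^sup>2))) (\<lambda>z. g (\<phi> z))"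
    by (subst area_distr[symmetric], rule integrable_distr_eq[OF m assms])
  also have "\<dots> \<longleftrightarrow> integrable (area_on U) (\<lambda>z. (cmod (deriv \<phi> z))\<^sup>2 *\<^sub>R g (\<phi> z))"
    using d gm by (intro integrable_density) auto
  finally show "integrable (area_on V) g \<longleftrightarrow> integrable (area_on U) (\<lambda>z. (cmod (deriv \<phi> z))\<^sup>2 *\<^sub>R g (\<phi> z))" .
qed

end

section \<open>The Bergman projection of the disc\<close>

lemma ennpowr_top [simp]: "ennpowr \<infinity> a = \<infinity>" "ennpowr top a = \<infinity>"
  by (auto simp: ennpowr_def)

lemma ennpowr_ennreal: "x \<ge> 0 \<Longrightarrow> ennpowr (ennreal x) a = ennreal (x powr a)"
  by (simp add: ennpowr_def)

lemma ennpowr_less_top_iff: "ennpowr x a < \<infinity> \<longleftrightarrow> x < \<infinity>"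
  by (auto simp: ennpowr_def less_top)

lemma Lp_space_iff:
  "f \<in> Lp_space p \<Omega> \<longleftrightarrow> f \<in> borel_measurable (area_on \<Omega>) \<and>
     integrable (area_on \<Omega>) (\<lambda>z. cmod (f z) powr p)"
  unfolding Lp_space_def Lp_norm_def ennpowr_less_top_iff
  by (auto simp: integrable_iff_bounded)

lemma Lp_norm_eq:
  assumes "f \<in> Lp_space p \<Omega>"
  shows "Lp_norm p \<Omega> f = ennreal ((\<integral>z. cmod (f z) powr p \<partial>area_on \<Omega>) powr (1 / p))"
  unfolding Lp_norm_def using assms
  by (subst nn_integral_eq_integral) (auto simp: Lp_space_iff ennpowr_ennreal)

lemma L2_space_iff:
  "f \<in> Lp_space 2 \<Omega> \<longleftrightarrow> f \<in> borel_measurable (area_on \<Omega>) \<and>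
     integrable (area_on \<Omega>) (\<lambda>z. (cmod (f z))\<^sup>2)"
  by (simp add: Lp_space_iff)

lemma integrable_L2_mult:
  fixes f g :: "complex \<Rightarrow> complex"
  assumes "f \<in> Lp_space 2 \<Omega>" "g \<in> Lp_space 2 \<Omega>"
  shows "integrable (area_on \<Omega>) (\<lambda>z. f z * cnj (g z))"
proof (rule Bochner_Integration.integrable_bound)
  show "integrable (area_on \<Omega>) (\<lambda>z. (cmod (f z))\<^sup>2 + (cmod (g z))\<^sup>2)"
    using assms by (auto simp: L2_space_iff)
  have [measurable]: "f \<in> borel_measurable (area_on \<Omega>)" "g \<in> borel_measurable (area_on \<Omega>)"
    using assms by (auto simp: L2_space_iff)
  have "(\<lambda>z. cnj (g z)) \<in> borel_measurable (area_on \<Omega>)"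
    by (rule measurable_compose[OF _ borel_measurable_cnj]) simp
  then show "(\<lambda>z. f z * cnj (g z)) \<in> borel_measurable (area_on \<Omega>)" by simp
  have "a * b \<le> a\<^sup>2 + b\<^sup>2" for a b :: real
  proof -
    have "2 * (a * b) \<le> a\<^sup>2 + b\<^sup>2"
      using zero_le_power2[of "a - b"] by (simp add: power2_eq_square algebra_simps)
    moreover have "0 \<le> a\<^sup>2 + b\<^sup>2" by simp
    ultimately show ?thesis by linarith
  qed
  then show "AE z in area_on \<Omega>. norm (f z * cnj (g z)) \<le> norm ((cmod (f z))\<^sup>2 + (cmod (g z))\<^sup>2)"
    by (simp add: norm_mult)
qed

lemma L2_diff:
  assumes "f \<in> Lp_space 2 \<Omega>" "g \<in> Lp_space 2 \<Omega>"
  shows "(\<lambda>z. f z - g z) \<in> Lp_space 2 \<Omega>"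
  unfolding L2_space_iff
proof
  have [measurable]: "f \<in> borel_measurable (area_on \<Omega>)" "g \<in> borel_measurable (area_on \<Omega>)"
    using assms by (auto simp: L2_space_iff)
  show m: "(\<lambda>z. f z - g z) \<in> borel_measurable (area_on \<Omega>)" by simp
  show "integrable (area_on \<Omega>) (\<lambda>z. (cmod (f z - g z))\<^sup>2)"
  proof (rule Bochner_Integration.integrable_bound)
    show "integrable (area_on \<Omega>) (\<lambda>z. 2 * (cmod (f z))\<^sup>2 + 2 * (cmod (g z))\<^sup>2)"
      using assms by (auto simp: L2_space_iff)
    show "(\<lambda>z. (cmod (f z - g z))\<^sup>2) \<in> borel_measurable (area_on \<Omega>)" by simp
    have "(cmod (a - b))\<^sup>2 \<le> 2 * (cmod a)\<^sup>2 + 2 * (cmod b)\<^sup>2" for a b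
    proof -
      have "(cmod (a - b))\<^sup>2 \<le> (cmod a + cmod b)\<^sup>2" by (intro power_mono norm_triangle_ineq4) auto
      also have "\<dots> \<le> 2 * (cmod a)\<^sup>2 + 2 * (cmod b)\<^sup>2"
        using zero_le_power2[of "cmod a - cmod b"] by (simp add: power2_eq_square algebra_simps)
      finally show ?thesis .
    qed
    then show "AE z in area_on \<Omega>. norm ((cmod (f z - g z))\<^sup>2) \<le> norm (2 * (cmod (f z))\<^sup>2 + 2 * (cmod (g z))\<^sup>2)"
      by simp
  qed
qed

lemma conformal_mappingI:
  assumes "f holomorphic_on U" "g holomorphic_on V"
    and "\<And>z. z \<in> U \<Longrightarrow> f z \<in> V" "\<And>w. w \<in> V \<Longrightarrow> g w \<in> U"
    and gf: "\<And>z. z \<in> U \<Longrightarrow> g (f z) = z" and fg: "\<And>w. w \<in> V \<Longrightarrow> f (g w) = w"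
  shows "conformal_mapping f U V"
proof -
  have bij: "bij_betw f U V" by (rule bij_betw_byWitness[where f' = g]) (use assms in auto)
  have "inv_into U f w = g w" if "w \<in> V" for w
    using that assms bij by (intro inv_into_f_eq) (auto simp: bij_betw_def)
  then have "inv_into U f holomorphic_on V" using assms(2) by (simp cong: holomorphic_cong)
  then show ?thesis using assms(1) bij by (simp add: conformal_mapping_def)
qed

lemma L2_imp_integrable:
  assumes "f \<in> Lp_space 2 unit_disc"
  shows "integrable disc_area f" "integrable disc_area (\<lambda>z. cmod (f z))"
proof -
  show "integrable disc_area f"
  proof (rule Bochner_Integration.integrable_bound)
    show "integrable disc_area (\<lambda>z. 1 + (cmod (f z))\<^sup>2)"
      using assms disc_area.integrable_const[of "1 :: real"] by (auto simp: L2_space_iff simp del: disc_area.integrable_const)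
    have "a \<le> 1 + a\<^sup>2" for a :: real
    proof -
      have "2 * a \<le> 1 + a\<^sup>2"
        using zero_le_power2[of "a - 1"] by (simp add: power2_eq_square algebra_simps)
      moreover have "0 \<le> 1 + a\<^sup>2" by simp
      ultimately show ?thesis by linarith
    qed
    then show "AE z in disc_area. norm (f z) \<le> norm (1 + (cmod (f z))\<^sup>2)" by simp
  qed (use assms in \<open>auto simp: L2_space_iff\<close>)
  then show "integrable disc_area (\<lambda>z. cmod (f z))" by (rule integrable_norm)
qed

section \<open>The kernel operator of the disc\<close>

lemma integrable_bergman_kernel:
  fixes f :: "complex \<Rightarrow> complex"
  assumes f: "integrable disc_area f" and x: "norm x < 1"
  shows "integrable disc_area (\<lambda>y. f y / (1 - x * cnj y)\<^sup>2)"
proof (rule Bochner_Integration.integrable_bound)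
  show "integrable disc_area (\<lambda>y. norm (f y) / (norm (1 - x * cnj y))\<^sup>2)"
    using f x by (intro integrable_kernel integrable_norm)
  have "(\<lambda>y. 1 / (1 - x * cnj y)\<^sup>2) \<in> borel_measurable disc_area"
    by (rule borel_measurable_area_on) measurable
  then have "(\<lambda>y. f y * (1 / (1 - x * cnj y)\<^sup>2)) \<in> borel_measurable disc_area"
    using f by (intro borel_measurable_times) auto
  then show "(\<lambda>y. f y / (1 - x * cnj y)\<^sup>2) \<in> borel_measurable disc_area" by simp
qed (simp add: norm_divide norm_power)

text \<open>As \<open>area\<close> carries the factor \<open>1 / pi\<close>, no constant stands
  before the Bergman kernel.\<close>

definition bergman_disc :: "(complex \<Rightarrow> complex) \<Rightarrow> complex \<Rightarrow> complex" where
  "bergman_disc f x = (\<integral>y. f y / (1 - x * cnj y)\<^sup>2 \<partial>disc_area)"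

lemma norm_bergman_disc_le: "norm (bergman_disc f x) \<le> pos_bergman (\<lambda>y. norm (f y)) x"
proof -
  have "norm (bergman_disc f x) \<le> (\<integral>y. norm (f y / (1 - x * cnj y)\<^sup>2) \<partial>disc_area)"
    unfolding bergman_disc_def by (rule integral_norm_bound)
  also have "\<dots> = pos_bergman (\<lambda>y. norm (f y)) x"
    by (simp add: pos_bergman_def norm_divide norm_power)
  finally show ?thesis .
qed

text \<open>The kernel is the sum of \<open>(n + 1) * (x * cnj y) ^ n\<close>, dominated uniformly
  in \<open>y\<close> by a convergent series, so it may be integrated term by term. Holomorphy of
  the image follows from the resulting power series.\<close>

lemma bergman_disc_power_series:
  assumes f: "integrable disc_area f" and x: "norm x < 1"
  shows "(\<lambda>n. (of_nat (Suc n) * (\<integral>y. f y * cnj y ^ n \<partial>disc_area)) * x ^ n) sums bergman_disc f x"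
proof -
  have fm: "f \<in> borel_measurable disc_area" using f by auto
  have cm: "(\<lambda>y. cnj y ^ n) \<in> borel_measurable disc_area" for n
    by (rule borel_measurable_area_on) measurable
  have int_n: "integrable disc_area (\<lambda>y. f y * cnj y ^ n)" for n
  proof (rule Bochner_Integration.integrable_bound[OF f])
    show "AE y in disc_area. norm (f y * cnj y ^ n) \<le> norm (f y)"
    proof (intro AE_I2)
      fix y assume "y \<in> space disc_area"
      then have "norm y ^ n \<le> 1" by (intro power_le_one) auto
      then show "norm (f y * cnj y ^ n) \<le> norm (f y)"
        by (simp add: norm_mult norm_power mult_left_le)
    qed
  qed (use fm cm in auto)
  define g where "g = (\<lambda>n y. of_nat (Suc n) * (x * cnj y) ^ n * f y)"
  have g_eq: "g n y = (of_nat (Suc n) * x ^ n) * (f y * cnj y ^ n)" for n y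
    by (simp add: g_def power_mult_distrib)
  have int_g: "integrable disc_area (g n)" for n
    unfolding g_eq using int_n by (intro integrable_mult_right)
  have g_norm: "norm (g n y) \<le> (real (Suc n) * norm x ^ n) * norm (f y)" if "norm y < 1" for n y
  proof -
    have "norm y ^ n \<le> 1" using that by (intro power_le_one) auto
    then have "norm x ^ n * norm y ^ n \<le> norm x ^ n * 1" by (intro mult_left_mono) auto
    then have "real (Suc n) * (norm x ^ n * norm y ^ n) * norm (f y) \<le> real (Suc n) * norm x ^ n * norm (f y)"
      by (intro mult_right_mono mult_left_mono) auto
    then show ?thesis by (simp add: g_def norm_mult norm_power power_mult_distrib del: of_nat_Suc)
  qed
  have summ: "summable (\<lambda>n. real (Suc n) * norm x ^ n)"
    using geometric_deriv_sums[of "norm x"] x by (simp add: sums_iff)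
  have "(\<lambda>n. integral\<^sup>L disc_area (g n)) sums (\<integral>y. (\<Sum>n. g n y) \<partial>disc_area)"
  proof (rule sums_integral[OF int_g])
    show "AE y in disc_area. summable (\<lambda>n. norm (g n y))"
    proof (intro AE_I2)
      fix y assume "y \<in> space disc_area"
      then have y: "norm y < 1" by simp
      show "summable (\<lambda>n. norm (g n y))"
        by (rule summable_comparison_test'[OF summable_mult2[OF summ, of "norm (f y)"], of 0])
           (use g_norm[OF y] in simp)
    qed
    show "summable (\<lambda>n. \<integral>y. norm (g n y) \<partial>disc_area)"
    proof (rule summable_comparison_test'[OF summable_mult2[OF summ, of "\<integral>y. norm (f y) \<partial>disc_area"], of 0])
      fix n
      have "(\<integral>y. norm (g n y) \<partial>disc_area) \<le> (\<integral>y. (real (Suc n) * norm x ^ n) * norm (f y) \<partial>disc_area)"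
        using g_norm int_g f by (intro integral_mono integrable_norm integrable_mult_right) auto
      also have "\<dots> = real (Suc n) * norm x ^ n * (\<integral>y. norm (f y) \<partial>disc_area)" by simp
      finally show "norm (\<integral>y. norm (g n y) \<partial>disc_area) \<le> real (Suc n) * norm x ^ n * (\<integral>y. norm (f y) \<partial>disc_area)"
        by simp
    qed
  qed
  also have "(\<integral>y. (\<Sum>n. g n y) \<partial>disc_area) = bergman_disc f x"
    unfolding bergman_disc_def
  proof (intro Bochner_Integration.integral_cong refl)
    fix y assume "y \<in> space disc_area"
    then have y: "norm y < 1" by simp
    have "norm x * norm y < 1"
      using mult_left_le[of "norm y" "norm x"] x y by simp
    then have "norm (x * cnj y) < 1" by (simp add: norm_mult)
    then have "(\<lambda>n. of_nat (Suc n) * (x * cnj y) ^ n * f y) sums (1 / (1 - x * cnj y)\<^sup>2 * f y)"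
      by (intro sums_mult2 geometric_deriv_sums)
    then show "(\<Sum>n. g n y) = f y / (1 - x * cnj y)\<^sup>2" by (simp add: g_def sums_iff)
  qed
  also have "(\<lambda>n. integral\<^sup>L disc_area (g n)) = (\<lambda>n. (of_nat (Suc n) * (\<integral>y. f y * cnj y ^ n \<partial>disc_area)) * x ^ n)"
    unfolding g_eq by (simp only: integral_mult_right_zero) (simp only: mult_ac)
  finally show ?thesis .
qed

lemma holomorphic_bergman_disc:
  assumes "integrable disc_area f"
  shows "bergman_disc f holomorphic_on unit_disc"
  using bergman_disc_power_series[OF assms]
  by (intro power_series_holomorphic[where a = "\<lambda>n. of_nat (Suc n) * (\<integral>y. f y * cnj y ^ n \<partial>disc_area)"]) auto

lemma holomorphic_measurable:
  "open U \<Longrightarrow> f holomorphic_on U \<Longrightarrow> f \<in> borel_measurable (area_on U)"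
  by (intro continuous_on_borel_measurable_area holomorphic_on_imp_continuous_on)

section \<open>The area mean value property\<close>

lemma conformal_rotation:
  assumes "norm c = 1" shows "conformal ((*) c) unit_disc unit_disc"
proof
  have "c \<noteq> 0" using assms by auto
  then show "conformal_mapping ((*) c) unit_disc unit_disc"
    using assms by (intro conformal_mappingI[where g = "\<lambda>z. z / c"] holomorphic_intros)
      (auto simp: norm_mult norm_divide)
qed auto

lemma ball_power_measurable:
  "(\<lambda>z. indicator (ball 0 r) z *\<^sub>R z ^ n :: complex) \<in> borel_measurable disc_area"
  by (intro borel_measurable_area_on borel_measurable_scaleR borel_measurable_indicator
      borel_measurable_continuous_onI continuous_intros) auto

text \<open>The rotation by the angle \<open>pi / n\<close> preserves area and the disc and changes
  the sign of \<open>z ^ n\<close>.\<close>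

lemma integral_ball_power:
  assumes "n > 0"
  shows "(\<integral>z. indicator (ball 0 r) z *\<^sub>R z ^ n \<partial>disc_area) = (0 :: complex)"
proof -
  define c where "c = cis (pi / real n)"
  have "c ^ n = cis (real n * (pi / real n))" by (simp only: c_def Complex.DeMoivre)
  also have "\<dots> = -1" using assms by simp
  finally have c: "norm c = 1" "c ^ n = -1" by (simp_all add: c_def)
  interpret conformal "(*) c" unit_disc unit_disc using c by (intro conformal_rotation)
  have d: "deriv ((*) c) z = c" for z by (rule DERIV_imp_deriv) (auto intro!: derivative_eq_intros)
  have "(\<integral>z. indicator (ball 0 r) z *\<^sub>R z ^ n \<partial>disc_area)
    = (\<integral>z. (cmod (deriv ((*) c) z))\<^sup>2 *\<^sub>R (indicator (ball 0 r) (c * z) *\<^sub>R (c * z) ^ n) \<partial>disc_area)"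
    by (intro integral_cov ball_power_measurable)
  also have "\<dots> = (\<integral>z. - (indicator (ball 0 r) z *\<^sub>R z ^ n) \<partial>disc_area)"
    using c by (intro Bochner_Integration.integral_cong) (auto simp: d power_mult_distrib norm_mult indicator_def)
  also have "\<dots> = - (\<integral>z. indicator (ball 0 r) z *\<^sub>R z ^ n \<partial>disc_area)" by simp
  finally show ?thesis by simp
qed

text \<open>On a disc of radius \<open>r < 1\<close> the Taylor series converges uniformly, which
  allows termwise integration whatever the growth of \<open>h\<close> at the circle; only the
  constant term survives.\<close>

lemma integral_ball_holomorphic:
  assumes h: "h holomorphic_on unit_disc" and r: "0 < r" "r < 1"
  shows "(\<integral>z. indicator (ball 0 r) z *\<^sub>R h z \<partial>disc_area) = of_real (r\<^sup>2) * h 0"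
proof -
  define a where "a = (\<lambda>n. (deriv ^^ n) h 0 / fact n)"
  have a: "(\<lambda>n. a n * z ^ n) sums h z" if "norm z < 1" for z
    using holomorphic_power_series[OF h, of z] that by (simp add: a_def)
  define g where "g = (\<lambda>n z. a n * (indicator (ball 0 r) z *\<^sub>R z ^ n))"
  have bound: "norm (g n z) \<le> norm (a n * of_real r ^ n)" for n z
  proof (cases "norm z < r")
    case True
    then have "norm z ^ n \<le> r ^ n" by (intro power_mono) auto
    then show ?thesis using r by (auto simp: g_def norm_mult norm_power indicator_def intro!: mult_left_mono)
  qed (auto simp: g_def)
  have int1: "integrable disc_area (\<lambda>z. indicator (ball 0 r) z *\<^sub>R z ^ n :: complex)" for n
  proof (rule disc_area.integrable_const_bound[where B = 1])
    show "AE z in disc_area. norm (indicator (ball 0 r) z *\<^sub>R z ^ n :: complex) \<le> 1"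
      by (intro AE_I2) (auto simp: indicator_def norm_power intro!: power_le_one)
    show "(\<lambda>z. indicator (ball 0 r) z *\<^sub>R z ^ n :: complex) \<in> borel_measurable disc_area"
      by (rule ball_power_measurable)
  qed
  then have int_g: "integrable disc_area (g n)" for n unfolding g_def by (intro integrable_mult_right)
  have summ: "summable (\<lambda>n. norm (a n * of_real r ^ n))"
  proof (rule powser_insidea)
    show "summable (\<lambda>n. a n * of_real ((1 + r) / 2) ^ n)"
      using a[of "of_real ((1 + r) / 2)"] r by (auto simp: sums_iff simp del: of_real_divide of_real_add)
    show "norm (of_real r :: complex) < norm (of_real ((1 + r) / 2) :: complex)"
      using r by (simp del: of_real_divide of_real_add)
  qed
  have "(\<lambda>n. integral\<^sup>L disc_area (g n)) sums (\<integral>z. (\<Sum>n. g n z) \<partial>disc_area)"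
  proof (rule sums_integral[OF int_g])
    show "AE z in disc_area. summable (\<lambda>n. norm (g n z))"
      by (intro AE_I2 summable_comparison_test'[OF summ, of 0]) (use bound in simp)
    show "summable (\<lambda>n. \<integral>z. norm (g n z) \<partial>disc_area)"
    proof (rule summable_comparison_test'[OF summ, of 0])
      fix n
      have "(\<integral>z. norm (g n z) \<partial>disc_area) \<le> (\<integral>z. norm (a n * of_real r ^ n) \<partial>disc_area)"
        using bound int_g by (intro integral_mono integrable_norm disc_area.integrable_const)
      also have "\<dots> = norm (a n * of_real r ^ n)" by (simp add: measure_unit_disc)
      finally show "norm (\<integral>z. norm (g n z) \<partial>disc_area) \<le> norm (a n * of_real r ^ n)" by simp
    qed
  qed
  moreover have "(\<integral>z. (\<Sum>n. g n z) \<partial>disc_area) = (\<integral>z. indicator (ball 0 r) z *\<^sub>R h z \<partial>disc_area)"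
  proof (intro Bochner_Integration.integral_cong refl)
    fix z assume "z \<in> space disc_area"
    then show "(\<Sum>n. g n z) = indicator (ball 0 r) z *\<^sub>R h z"
      using a[of z] by (cases "z \<in> ball 0 r") (auto simp: g_def sums_iff)
  qed
  moreover have "integral\<^sup>L disc_area (g n) = (if n = 0 then of_real (r\<^sup>2) * h 0 else 0)" for n
  proof (cases "n = 0")
    case True
    have "a 0 = h 0" by (simp add: a_def)
    have "measure disc_area (ball 0 r \<inter> unit_disc) = r\<^sup>2"
    proof -
      have "ball 0 r \<inter> unit_disc = ball (0::complex) r" using r by auto
      then show ?thesis using r
        by (simp add: measure_def emeasure_area_on emeasure_area_ball ball_subset_ball_iff)
    qed
    then have "(\<integral>z. indicator (ball 0 r) z *\<^sub>R (1 :: complex) \<partial>disc_area) = of_real (r\<^sup>2)"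
      using r by (subst integral_scaleR_left)
        (auto simp: disc_area.emeasure_eq_measure scaleR_conv_of_real sets_area_on
          intro!: integrable_real_indicator)
    moreover have "integral\<^sup>L disc_area (g n) = (\<integral>z. (indicator (ball 0 r) z *\<^sub>R (1 :: complex)) * h 0 \<partial>disc_area)"
      using True \<open>a 0 = h 0\<close> by (simp add: g_def)
    ultimately show ?thesis using True by (simp only: integral_mult_left_zero if_True refl)
  next
    case False
    then have "n > 0" by simp
    show ?thesis unfolding g_def integral_mult_right_zero integral_ball_power[OF \<open>n > 0\<close>]
      using False by simp
  qed
  ultimately have "(\<lambda>n. if n = 0 then of_real (r\<^sup>2) * h 0 else 0) sums (\<integral>z. indicator (ball 0 r) z *\<^sub>R h z \<partial>disc_area)"
    by simp
  moreover have "(\<lambda>n. if n = 0 then of_real (r\<^sup>2) * h 0 else 0) sums (of_real (r\<^sup>2) * h 0)"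
    using sums_single[of 0 "\<lambda>_. of_real (r\<^sup>2) * h 0"] by simp
  ultimately show ?thesis by (rule sums_unique2)
qed

definition radius_seq :: "nat \<Rightarrow> real" where "radius_seq n = 1 - 1 / real (n + 2)"

lemma radius_seq_bounds: "0 < radius_seq n" "radius_seq n < 1"
  by (auto simp: radius_seq_def field_simps)

lemma radius_seq_tendsto: "radius_seq \<longlonglongrightarrow> 1"
proof -
  have "(\<lambda>n. 1 - 1 / real (n + 2)) \<longlonglongrightarrow> 1 - 0"
    by (intro tendsto_diff tendsto_const LIMSEQ_ignore_initial_segment lim_1_over_n)
  then show ?thesis unfolding radius_seq_def[abs_def] by simp
qed

lemma radius_seq_mono: "i \<le> j \<Longrightarrow> radius_seq i \<le> radius_seq j"
  unfolding radius_seq_def by (intro diff_left_mono divide_left_mono) auto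

lemma area_mean_value:
  assumes h: "h holomorphic_on unit_disc" "integrable disc_area h"
  shows "(\<integral>z. h z \<partial>disc_area) = h 0"
proof -
  have "(\<lambda>n. \<integral>z. indicator (ball 0 (radius_seq n)) z *\<^sub>R h z \<partial>disc_area) \<longlonglongrightarrow> (\<integral>z. h z \<partial>disc_area)"
  proof (rule integral_dominated_convergence[where w = "\<lambda>z. norm (h z)"])
    show "(\<lambda>z. indicator (ball 0 (radius_seq n)) z *\<^sub>R h z) \<in> borel_measurable disc_area" for n
    proof (intro borel_measurable_scaleR)
      show "indicator (ball 0 (radius_seq n)) \<in> borel_measurable disc_area"
        by (intro borel_measurable_area_on borel_measurable_indicator) auto
    qed (use h in auto)
    show "AE z in disc_area. (\<lambda>n. indicator (ball 0 (radius_seq n)) z *\<^sub>R h z) \<longlonglongrightarrow> h z"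
    proof (intro AE_I2)
      fix z assume "z \<in> space disc_area"
      then have "norm z < 1" by simp
      then have "\<forall>\<^sub>F n in sequentially. norm z < radius_seq n" by (rule order_tendstoD(1)[OF radius_seq_tendsto])
      then have "\<forall>\<^sub>F n in sequentially. indicator (ball 0 (radius_seq n)) z *\<^sub>R h z = h z"
        by eventually_elim simp
      then show "(\<lambda>n. indicator (ball 0 (radius_seq n)) z *\<^sub>R h z) \<longlonglongrightarrow> h z" by (rule tendsto_eventually)
    qed
    show "AE z in disc_area. norm (indicator (ball 0 (radius_seq n)) z *\<^sub>R h z) \<le> norm (h z)" for n
      by (intro AE_I2) (auto simp: indicator_def)
  qed (use h in auto)
  moreover have "(\<lambda>n. \<integral>z. indicator (ball 0 (radius_seq n)) z *\<^sub>R h z \<partial>disc_area) \<longlonglongrightarrow> of_real (1\<^sup>2) * h 0"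
    unfolding integral_ball_holomorphic[OF h(1) radius_seq_bounds] using radius_seq_tendsto by (intro tendsto_intros)
  ultimately have "(\<integral>z. h z \<partial>disc_area) = of_real (1\<^sup>2) * h 0" by (rule LIMSEQ_unique)
  then show ?thesis by simp
qed

lemma mult_cnj_ne_1:
  assumes "norm x < 1" "norm y < 1" shows "1 - x * cnj y \<noteq> 0"
  using kernel_bounds(3)[OF assms] by auto

text \<open>The automorphism that interchanges \<open>x\<close> and 0, used to move the mean value
  property from 0 to \<open>x\<close>. It is its own inverse, which settles bijectivity and
  holomorphy of the inverse together.\<close>

lemma conformal_involution:
  assumes x: "norm x < 1"
  shows "conformal (\<lambda>u. (x - u) / (1 - cnj x * u)) unit_disc unit_disc"
proof
  have ne: "1 - cnj x * u \<noteq> 0" if "u \<in> unit_disc" for u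
    using mult_cnj_ne_1[of u x] that x by (auto simp: mult.commute)
  have in_disc: "(x - u) / (1 - cnj x * u) \<in> unit_disc" if "u \<in> unit_disc" for u
  proof -
    have u: "norm u < 1" using that by simp
    have "(norm (1 - cnj x * u))\<^sup>2 = (norm (x - u))\<^sup>2 + (1 - (norm x)\<^sup>2) * (1 - (norm u)\<^sup>2)"
      by (simp only: cmod_power2) (simp add: power2_eq_square algebra_simps)
    moreover have "(1 - (norm x)\<^sup>2) * (1 - (norm u)\<^sup>2) > 0"
      using x u by (intro mult_pos_pos) (auto simp: power_less_one_iff abs_square_less_1)
    ultimately have "(norm (x - u))\<^sup>2 < (norm (1 - cnj x * u))\<^sup>2" by simp
    then have "norm (x - u) < norm (1 - cnj x * u)" by (rule power2_less_imp_less) simp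
    then show ?thesis using ne[OF that] by (simp add: norm_divide)
  qed
  have invol: "(x - (x - u) / (1 - cnj x * u)) / (1 - cnj x * ((x - u) / (1 - cnj x * u))) = u"
    if "u \<in> unit_disc" for u
  proof -
    have nx: "1 - cnj x * x \<noteq> 0" using ne[of x] x by simp
    have n: "1 - cnj x * u \<noteq> 0" using ne[OF that] .
    have "x - (x - u) / (1 - cnj x * u) = u * (1 - cnj x * x) / (1 - cnj x * u)"
      using n by (simp add: field_simps)
    moreover have "1 - cnj x * ((x - u) / (1 - cnj x * u)) = (1 - cnj x * x) / (1 - cnj x * u)"
      using n by (simp add: field_simps)
    ultimately show ?thesis using n nx by simp
  qed
  show "conformal_mapping (\<lambda>u. (x - u) / (1 - cnj x * u)) unit_disc unit_disc"
    using ne in_disc invol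
    by (intro conformal_mappingI[where g = "\<lambda>u. (x - u) / (1 - cnj x * u)"] holomorphic_intros) auto
qed auto

text \<open>After substitution of the involution \<open>m\<close>, the antiholomorphic factors of
  the Jacobian and of the kernel cancel. What remains,
  \<open>h (m u) / (1 - cnj x * u)\<^sup>2\<close>, is holomorphic with value \<open>h x\<close> at
  0, and the mean value property applies.\<close>

lemma reproducing:
  assumes h: "h \<in> bergman_space unit_disc" and x: "norm x < 1"
  shows "bergman_disc h x = h x"
proof -
  have hol_h: "h holomorphic_on unit_disc" and L2: "h \<in> Lp_space 2 unit_disc"
    using h by (auto simp: bergman_space_def)
  define m where "m = (\<lambda>u. (x - u) / (1 - cnj x * u))"
  interpret conformal m unit_disc unit_disc
    unfolding m_def by (rule conformal_involution[OF x])
  define g where "g = (\<lambda>y. h y / (1 - x * cnj y)\<^sup>2)"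
  have gi: "integrable disc_area g"
    unfolding g_def using L2 x by (intro integrable_bergman_kernel L2_imp_integrable)
  then have gm: "g \<in> borel_measurable disc_area" by auto
  have ne: "1 - cnj x * u \<noteq> 0" if "u \<in> unit_disc" for u
    using mult_cnj_ne_1[of u x] that x by (auto simp: mult.commute)
  define H where "H = (\<lambda>u. h (m u) / (1 - cnj x * u)\<^sup>2)"
  have eq: "(cmod (deriv m u))\<^sup>2 *\<^sub>R g (m u) = H u" if u: "u \<in> unit_disc" for u
  proof -
    define A where "A = 1 - cnj x * u"
    define B where "B = 1 - x * cnj u"
    define R where "R = 1 - x * cnj x"
    have nz: "A \<noteq> 0" "B \<noteq> 0" "R \<noteq> 0"
      using ne[OF u] mult_cnj_ne_1[of x u] mult_cnj_ne_1[of x x] x u by (auto simp: A_def B_def R_def)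
    have "(m has_field_derivative - R / A\<^sup>2) (at u)"
    proof -
      have "(m has_field_derivative (- 1 * (1 - cnj x * u) - (x - u) * (- cnj x)) / ((1 - cnj x * u) * (1 - cnj x * u))) (at u)"
        unfolding m_def using ne[OF u] by (auto intro!: derivative_eq_intros)
      moreover have "(- 1 * (1 - cnj x * u) - (x - u) * (- cnj x)) / ((1 - cnj x * u) * (1 - cnj x * u)) = - R / A\<^sup>2"
        by (simp add: A_def R_def power2_eq_square algebra_simps)
      ultimately show ?thesis by simp
    qed
    then have dm: "deriv m u = - R / A\<^sup>2" by (rule DERIV_imp_deriv)
    have cA: "cnj A = B" "cnj R = R" by (auto simp: A_def B_def R_def)
    have "complex_of_real ((cmod (deriv m u))\<^sup>2) = deriv m u * cnj (deriv m u)"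
      by (simp only: complex_norm_square)
    also have "\<dots> = R\<^sup>2 / (A\<^sup>2 * B\<^sup>2)" by (simp add: dm cA power2_eq_square)
    finally have 1: "complex_of_real ((cmod (deriv m u))\<^sup>2) = R\<^sup>2 / (A\<^sup>2 * B\<^sup>2)" .
    have "1 - x * cnj (m u) = R / B"
    proof -
      have "cnj (m u) = (cnj x - cnj u) / B" by (simp add: m_def B_def)
      then have "1 - x * cnj (m u) = (B - x * (cnj x - cnj u)) / B"
        using nz(2) by (simp add: diff_divide_distrib right_diff_distrib)
      also have "B - x * (cnj x - cnj u) = R" by (simp add: B_def R_def algebra_simps)
      finally show ?thesis .
    qed
    then have "g (m u) = h (m u) * B\<^sup>2 / R\<^sup>2" by (simp add: g_def power_divide)
    then show ?thesis using nz unfolding scaleR_conv_of_real 1 H_def A_def[symmetric] by simp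
  qed
  have "integrable disc_area (\<lambda>u. (cmod (deriv m u))\<^sup>2 *\<^sub>R g (m u))"
    using integral_cov(2)[OF gm] gi by simp
  then have Hi: "integrable disc_area H"
    by (subst Bochner_Integration.integrable_cong[OF refl, of _ H]) (use eq in auto)
  have mh: "m holomorphic_on unit_disc" by (rule hol(1))
  have "H holomorphic_on unit_disc"
    unfolding H_def using ne \<phi>_in
    by (intro holomorphic_intros holomorphic_on_compose_gen[OF mh hol_h, unfolded o_def]) auto
  then have "(\<integral>u. H u \<partial>disc_area) = H 0" using Hi by (rule area_mean_value)
  also have "H 0 = h x" by (simp add: H_def m_def)
  also have "(\<integral>u. H u \<partial>disc_area) = (\<integral>y. g y \<partial>disc_area)"
    unfolding integral_cov(1)[OF gm] by (intro Bochner_Integration.integral_cong) (use eq in auto)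
  finally show ?thesis by (simp add: bergman_disc_def g_def)
qed

text \<open>The weighted bound at \<open>p = 2\<close> with both weights equal to 1, for which the
  tent condition holds with \<open>W = 1\<close>. Having it for the modulus of the kernel is what
  makes Fubini's theorem applicable in the proof of orthogonality.\<close>

lemma pos_bergman_L2:
  assumes "f \<in> Lp_space 2 unit_disc"
  shows "(\<integral>\<^sup>+x. ennreal ((pos_bergman (\<lambda>y. norm (f y)) x)\<^sup>2) \<partial>disc_area) < \<infinity>"
proof -
  have "(\<integral>\<^sup>+x. ennreal (pos_bergman (\<lambda>y. norm (f y)) x powr 2 * 1) \<partial>disc_area)
    \<le> ennreal ((321159168 * (max 2 (1 / (2 - 1)) * 1 powr max 1 (1 / (2 - 1)))) powr 2
          * (\<integral>x. norm (f x) powr 2 * 1 \<partial>disc_area))"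
    using assms by (intro pos_bergman_weighted(2)[where s = "\<lambda>_. 1"])
      (auto simp: L2_space_iff powr_numeral power2_eq_square Int_absorb2[OF tent_subset]
        intro: measurable_compose[OF _ borel_measurable_norm])
  moreover have "pos_bergman (\<lambda>y. norm (f y)) x \<ge> 0" for x
    unfolding pos_bergman_def by (intro Bochner_Integration.integral_nonneg) auto
  ultimately show ?thesis by (simp add: powr_numeral) (meson ennreal_less_top le_less_trans)
qed

lemma pair_kernel_measurable:
  "(\<lambda>q. 1 - fst q * cnj (snd q)) \<in> borel_measurable (disc_area \<Otimes>\<^sub>M disc_area)"
proof -
  have "(\<lambda>q. fst q) \<in> borel_measurable (disc_area \<Otimes>\<^sub>M disc_area)"
    by (rule measurable_compose[OF measurable_fst]) (rule borel_measurable_area_on, simp)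
  moreover have "(\<lambda>q. cnj (snd q)) \<in> borel_measurable (disc_area \<Otimes>\<^sub>M disc_area)"
    by (rule measurable_compose[OF measurable_snd]) (rule borel_measurable_area_on, simp)
  ultimately show ?thesis
    by (intro borel_measurable_diff borel_measurable_times borel_measurable_const)
qed

lemma pos_bergman_measurable:
  assumes "f \<in> borel_measurable disc_area"
  shows "pos_bergman f \<in> borel_measurable disc_area"
proof -
  have "(\<lambda>q. f (snd q)) \<in> borel_measurable (disc_area \<Otimes>\<^sub>M disc_area)"
    by (rule measurable_compose[OF measurable_snd assms])
  then have "(\<lambda>(x, y). f y / (norm (1 - x * cnj y))\<^sup>2) \<in> borel_measurable (disc_area \<Otimes>\<^sub>M disc_area)"
    unfolding case_prod_beta
    by (intro borel_measurable_divide borel_measurable_power measurable_compose[OF pair_kernel_measurable borel_measurable_norm])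
  then show ?thesis unfolding pos_bergman_def[abs_def]
    by (intro disc_area.borel_measurable_lebesgue_integral)
qed

lemma bergman_disc_L2:
  assumes "f \<in> Lp_space 2 unit_disc"
  shows "bergman_disc f \<in> bergman_space unit_disc"
proof -
  have hol: "bergman_disc f holomorphic_on unit_disc"
    using assms by (intro holomorphic_bergman_disc L2_imp_integrable)
  have "(\<integral>\<^sup>+x. ennreal ((cmod (bergman_disc f x))\<^sup>2) \<partial>disc_area)
    \<le> (\<integral>\<^sup>+x. ennreal ((pos_bergman (\<lambda>y. norm (f y)) x)\<^sup>2) \<partial>disc_area)"
    by (intro nn_integral_mono ennreal_leI power_mono norm_bergman_disc_le) auto
  also have "\<dots> < \<infinity>" by (rule pos_bergman_L2[OF assms])
  finally have "(\<integral>\<^sup>+x. ennreal ((cmod (bergman_disc f x))\<^sup>2) \<partial>disc_area) < \<infinity>" .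
  then show ?thesis using hol holomorphic_measurable[OF _ hol]
    by (auto simp: bergman_space_def L2_space_iff integrable_iff_bounded)
qed

text \<open>The kernel is Hermitian, so exchanging the integrals turns the pairing of the image of
  \<open>f\<close> with \<open>h\<close> into that of \<open>f\<close> with the image of
  \<open>h\<close>, which is \<open>h\<close> itself. Absolute convergence is the \<open>L^2\<close>
  bound for the positive operator.\<close>

lemma bergman_disc_orthogonal:
  assumes f: "f \<in> Lp_space 2 unit_disc" and h: "h \<in> bergman_space unit_disc"
  shows "L2_inner unit_disc (\<lambda>z. f z - bergman_disc f z) h = 0"
proof -
  have h2: "h \<in> Lp_space 2 unit_disc" using h by (simp add: bergman_space_def)
  have fm: "f \<in> borel_measurable disc_area" and hm: "h \<in> borel_measurable disc_area"
    using f h2 by (auto simp: L2_space_iff)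
  have P2: "bergman_disc f \<in> Lp_space 2 unit_disc" using bergman_disc_L2[OF f] by (simp add: bergman_space_def)
  interpret pair_sigma_finite disc_area disc_area ..
  define K where "K = (\<lambda>x y. f y / (1 - x * cnj y)\<^sup>2 * cnj (h x))"
  have Km: "(\<lambda>(x, y). K x y) \<in> borel_measurable (disc_area \<Otimes>\<^sub>M disc_area)"
  proof -
    have 3: "(\<lambda>p. f (snd p)) \<in> borel_measurable (disc_area \<Otimes>\<^sub>M disc_area)"
      by (rule measurable_compose[OF measurable_snd fm])
    have 4: "(\<lambda>p. cnj (h (fst p))) \<in> borel_measurable (disc_area \<Otimes>\<^sub>M disc_area)"
      by (rule measurable_compose[OF measurable_compose[OF measurable_fst hm] borel_measurable_cnj])
    show ?thesis unfolding case_prod_beta K_def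
      using 3 4 by (intro borel_measurable_times borel_measurable_divide borel_measurable_power pair_kernel_measurable)
  qed
  have Ky: "integrable disc_area (\<lambda>y. K x y)" if "norm x < 1" for x
  proof -
    have "integrable disc_area (\<lambda>y. f y / (1 - x * cnj y)\<^sup>2)"
      using f that by (intro integrable_bergman_kernel L2_imp_integrable)
    then show ?thesis unfolding K_def by (rule integrable_mult_left)
  qed
  have norm_int: "(\<integral>y. norm (K x y) \<partial>disc_area) = pos_bergman (\<lambda>y. norm (f y)) x * norm (h x)" for x
    by (simp add: K_def norm_mult norm_divide norm_power pos_bergman_def flip: integral_mult_left_zero)
  have "integrable (disc_area \<Otimes>\<^sub>M disc_area) (\<lambda>(x, y). K x y)"
  proof (rule Fubini_integrable[OF Km])
    show "AE x in disc_area. integrable disc_area (\<lambda>y. case (x, y) of (x, y) \<Rightarrow> K x y)"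
      using Ky by (intro AE_I2) simp
    have pm: "pos_bergman (\<lambda>y. norm (f y)) \<in> borel_measurable disc_area"
      by (intro pos_bergman_measurable measurable_compose[OF fm borel_measurable_norm])
    have "(\<lambda>x. complex_of_real (pos_bergman (\<lambda>y. norm (f y)) x)) \<in> Lp_space 2 unit_disc"
      using pos_bergman_L2[OF f] pm by (simp add: L2_space_iff integrable_iff_bounded)
    then have "integrable disc_area (\<lambda>x. complex_of_real (pos_bergman (\<lambda>y. norm (f y)) x) * cnj (h x))"
      using h2 by (rule integrable_L2_mult)
    then have "integrable disc_area (\<lambda>x. norm (complex_of_real (pos_bergman (\<lambda>y. norm (f y)) x) * cnj (h x)))"
      by (rule integrable_norm)
    moreover have "pos_bergman (\<lambda>y. norm (f y)) x \<ge> 0" for x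
      unfolding pos_bergman_def by (intro Bochner_Integration.integral_nonneg) auto
    ultimately have "integrable disc_area (\<lambda>x. pos_bergman (\<lambda>y. norm (f y)) x * norm (h x))"
      by (simp add: norm_mult)
    then show "integrable disc_area (\<lambda>x. \<integral>y. norm (case (x, y) of (x, y) \<Rightarrow> K x y) \<partial>disc_area)"
      by (simp add: norm_int)
  qed
  then have fub: "(\<integral>y. (\<integral>x. K x y \<partial>disc_area) \<partial>disc_area) = (\<integral>x. (\<integral>y. K x y \<partial>disc_area) \<partial>disc_area)"
    by (rule Fubini_integral)
  have "(\<integral>x. bergman_disc f x * cnj (h x) \<partial>disc_area) = (\<integral>x. (\<integral>y. K x y \<partial>disc_area) \<partial>disc_area)"
  proof -
    have "(\<integral>y. K x y \<partial>disc_area) = bergman_disc f x * cnj (h x)" for x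
      unfolding K_def bergman_disc_def by (rule integral_mult_left_zero)
    then show ?thesis by simp
  qed
  also have "\<dots> = (\<integral>y. (\<integral>x. K x y \<partial>disc_area) \<partial>disc_area)" using fub by simp
  also have "\<dots> = (\<integral>y. f y * cnj (h y) \<partial>disc_area)"
  proof (intro Bochner_Integration.integral_cong refl)
    fix y assume "y \<in> space disc_area"
    then have y: "norm y < 1" by simp
    have "(\<integral>x. K x y \<partial>disc_area) = (\<integral>x. f y * cnj (h x / (1 - y * cnj x)\<^sup>2) \<partial>disc_area)"
      by (intro Bochner_Integration.integral_cong refl) (simp add: K_def mult.commute)
    also have "\<dots> = f y * cnj (bergman_disc h y)"
      by (simp add: bergman_disc_def del: complex_cnj_divide)
    also have "\<dots> = f y * cnj (h y)" using reproducing[OF h y] by simp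
    finally show "(\<integral>x. K x y \<partial>disc_area) = f y * cnj (h y)" .
  qed
  finally have "(\<integral>x. bergman_disc f x * cnj (h x) \<partial>disc_area) = (\<integral>y. f y * cnj (h y) \<partial>disc_area)" .
  then show ?thesis unfolding L2_inner_def
    using integrable_L2_mult[OF f h2] integrable_L2_mult[OF P2 h2] by (simp add: left_diff_distrib)
qed

section \<open>Conformal invariance of the Bergman projection\<close>

context conformal
begin

text \<open>The factor \<open>deriv \<phi>\<close> makes this an isometry for \<open>p = 2\<close>
  that respects holomorphy, which is what carries an orthogonal projection onto the Bergman space
  from one domain to the other.\<close>

definition pullback :: "(complex \<Rightarrow> complex) \<Rightarrow> complex \<Rightarrow> complex" where
  "pullback f z = f (\<phi> z) * deriv \<phi> z"

text \<open>The value 0 outside \<open>V\<close> follows the normalisation in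
  \<open>bergman_projection\<close>, so that the two can agree as functions on the whole
  plane.\<close>

definition pushforward :: "(complex \<Rightarrow> complex) \<Rightarrow> complex \<Rightarrow> complex" where
  "pushforward k w = (if w \<in> V then k (\<psi> w) * deriv \<psi> w else 0)"

lemma deriv_\<psi>:
  assumes z: "z \<in> U" shows "deriv \<psi> (\<phi> z) * deriv \<phi> z = 1"
proof -
  have 1: "(\<phi> has_field_derivative deriv \<phi> z) (at z)"
    using holomorphic_derivI[OF hol(1) open_U z] .
  have 2: "(\<psi> has_field_derivative deriv \<psi> (\<phi> z)) (at (\<phi> z))"
    using holomorphic_derivI[OF hol(2) open_V \<phi>_in[OF z]] .
  have "((\<lambda>x. \<psi> (\<phi> x)) has_field_derivative deriv \<psi> (\<phi> z) * deriv \<phi> z) (at z)"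
    by (rule DERIV_chain2[OF 2 1])
  moreover have "((\<lambda>x. \<psi> (\<phi> x)) has_field_derivative 1) (at z)"
    by (rule has_field_derivative_transform_within_open[OF DERIV_ident open_U z]) simp
  ultimately show ?thesis by (rule DERIV_unique)
qed

lemma pullback_pushforward: "z \<in> U \<Longrightarrow> pullback (pushforward k) z = k z"
  using \<phi>_in[of z] deriv_\<psi>[of z] by (simp add: pullback_def pushforward_def mult.assoc)

lemma pullback_measurable:
  "f \<in> borel_measurable (area_on V) \<Longrightarrow> pullback f \<in> borel_measurable (area_on U)"
  unfolding pullback_def[abs_def]
  using measurable_compose[OF measurable_\<phi>, of f borel] measurable_deriv by (intro borel_measurable_times) auto

lemma pushforward_measurable:
  assumes "k \<in> borel_measurable (area_on U)"
  shows "pushforward k \<in> borel_measurable (area_on V)"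
proof -
  interpret inv: conformal \<psi> V U by (rule conformal_inverse)
  have "inv.pullback k \<in> borel_measurable (area_on V)" using assms by (rule inv.pullback_measurable)
  then show ?thesis
    by (subst measurable_cong[where g = "inv.pullback k"]) (auto simp: pushforward_def inv.pullback_def)
qed

text \<open>The origin of the weight: the Jacobian contributes the power 2 of
  \<open>cmod (deriv \<phi> z)\<close>, and the factor inside \<open>pullback\<close> already
  accounts for the power \<open>p\<close>.\<close>

lemma nn_integral_pullback:
  assumes "f \<in> borel_measurable (area_on V)"
  shows "(\<integral>\<^sup>+w. ennreal (cmod (f w) powr p) \<partial>area_on V)
    = (\<integral>\<^sup>+z. ennreal (cmod (pullback f z) powr p * cmod (deriv \<phi> z) powr (2 - p)) \<partial>area_on U)"
proof -
  have [measurable]: "f \<in> borel_measurable (area_on V)" by fact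
  have "(\<integral>\<^sup>+w. ennreal (cmod (f w) powr p) \<partial>area_on V)
      = (\<integral>\<^sup>+z. ennreal ((cmod (deriv \<phi> z))\<^sup>2) * ennreal (cmod (f (\<phi> z)) powr p) \<partial>area_on U)"
    by (rule nn_integral_cov) measurable
  also have "\<dots> = (\<integral>\<^sup>+z. ennreal (cmod (pullback f z) powr p * cmod (deriv \<phi> z) powr (2 - p)) \<partial>area_on U)"
  proof (intro nn_integral_cong)
    fix z assume "z \<in> space (area_on U)"
    then have d: "cmod (deriv \<phi> z) > 0" using deriv_nonzero[of z] by simp
    have "cmod (deriv \<phi> z) powr p * cmod (deriv \<phi> z) powr (2 - p) = (cmod (deriv \<phi> z))\<^sup>2"
      using d by (simp add: powr_add[symmetric] powr_numeral)
    then show "ennreal ((cmod (deriv \<phi> z))\<^sup>2) * ennreal (cmod (f (\<phi> z)) powr p)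
        = ennreal (cmod (pullback f z) powr p * cmod (deriv \<phi> z) powr (2 - p))"
      using d by (simp add: pullback_def norm_mult powr_mult ennreal_mult[symmetric] mult_ac)
  qed
  finally show ?thesis .
qed

lemma nn_integral_pushforward:
  assumes "k \<in> borel_measurable (area_on U)"
  shows "(\<integral>\<^sup>+w. ennreal (cmod (pushforward k w) powr p) \<partial>area_on V)
    = (\<integral>\<^sup>+z. ennreal (cmod (k z) powr p * cmod (deriv \<phi> z) powr (2 - p)) \<partial>area_on U)"
  unfolding nn_integral_pullback[OF pushforward_measurable[OF assms]]
  by (intro nn_integral_cong) (simp add: pullback_pushforward)

lemma L2_pullback:
  assumes "f \<in> Lp_space 2 V" shows "pullback f \<in> Lp_space 2 U"
proof -
  have fm: "f \<in> borel_measurable (area_on V)" using assms by (simp add: L2_space_iff)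
  have "(\<integral>\<^sup>+z. ennreal (cmod (pullback f z) powr 2) \<partial>area_on U)
    = (\<integral>\<^sup>+z. ennreal (cmod (pullback f z) powr 2 * cmod (deriv \<phi> z) powr (2 - 2)) \<partial>area_on U)"
    by (intro nn_integral_cong) (simp add: deriv_nonzero)
  then show ?thesis
    using assms nn_integral_pullback[OF fm, of 2] pullback_measurable[OF fm]
    by (simp add: Lp_space_def Lp_norm_def ennpowr_less_top_iff)
qed

lemma L2_pushforward:
  assumes "k \<in> Lp_space 2 U" shows "pushforward k \<in> Lp_space 2 V"
proof -
  have km: "k \<in> borel_measurable (area_on U)" using assms by (simp add: L2_space_iff)
  have "(\<integral>\<^sup>+z. ennreal (cmod (k z) powr 2) \<partial>area_on U)
    = (\<integral>\<^sup>+z. ennreal (cmod (k z) powr 2 * cmod (deriv \<phi> z) powr (2 - 2)) \<partial>area_on U)"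
    by (intro nn_integral_cong) (simp add: deriv_nonzero)
  then show ?thesis
    using assms nn_integral_pushforward[OF km, of 2] pushforward_measurable[OF km]
    by (simp add: Lp_space_def Lp_norm_def ennpowr_less_top_iff)
qed

lemma bergman_pullback:
  assumes "f \<in> bergman_space V" shows "pullback f \<in> bergman_space U"
proof -
  have f: "f \<in> Lp_space 2 V" "f holomorphic_on V" using assms by (auto simp: bergman_space_def)
  have "(\<lambda>z. f (\<phi> z)) holomorphic_on U"
    using holomorphic_on_compose_gen[OF hol(1) f(2)] image by (auto simp: o_def)
  then have "pullback f holomorphic_on U"
    unfolding pullback_def[abs_def] using hol(1) open_U by (intro holomorphic_intros holomorphic_deriv)
  then show ?thesis using L2_pullback[OF f(1)] by (simp add: bergman_space_def)
qed

lemma bergman_pushforward: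
  assumes "k \<in> bergman_space U" shows "pushforward k \<in> bergman_space V"
proof -
  have k: "k \<in> Lp_space 2 U" "k holomorphic_on U" using assms by (auto simp: bergman_space_def)
  have "(\<lambda>w. k (\<psi> w)) holomorphic_on V"
    using holomorphic_on_compose_gen[OF hol(2) k(2)] \<psi>_in by (auto simp: o_def)
  then have "(\<lambda>w. k (\<psi> w) * deriv \<psi> w) holomorphic_on V"
    using hol(2) open_V by (intro holomorphic_intros holomorphic_deriv)
  then have "pushforward k holomorphic_on V"
    by (rule holomorphic_transform) (simp add: pushforward_def)
  then show ?thesis using L2_pushforward[OF k(1)] by (simp add: bergman_space_def)
qed

lemma L2_inner_pullback:
  assumes "f \<in> borel_measurable (area_on V)" "g \<in> borel_measurable (area_on V)"
  shows "L2_inner V f g = L2_inner U (pullback f) (pullback g)"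
proof -
  have "(\<lambda>w. cnj (g w)) \<in> borel_measurable (area_on V)"
    by (rule measurable_compose[OF assms(2) borel_measurable_cnj])
  then have m: "(\<lambda>w. f w * cnj (g w)) \<in> borel_measurable (area_on V)"
    using assms by (intro borel_measurable_times)
  have "(cmod d)\<^sup>2 *\<^sub>R (a * cnj b) = a * d * cnj (b * d)" for a b d :: complex
    by (simp only: scaleR_conv_of_real complex_norm_square) simp
  then show ?thesis unfolding L2_inner_def integral_cov(1)[OF m] pullback_def by simp
qed

text \<open>Zero norm means vanishing almost everywhere; the set where \<open>g\<close> does not
  vanish is open, and a nonempty open set is not null.\<close>

lemma bergman_space_eq_0:
  assumes g: "g \<in> bergman_space V" and 0: "L2_inner V g g = 0" and w: "w \<in> V"
  shows "g w = 0"
proof (rule ccontr)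
  assume "g w \<noteq> 0"
  have gi: "integrable (area_on V) (\<lambda>z. (cmod (g z))\<^sup>2)"
    using g by (simp add: bergman_space_def L2_space_iff)
  have "complex_of_real (\<integral>z. (cmod (g z))\<^sup>2 \<partial>area_on V) = L2_inner V g g"
    unfolding L2_inner_def complex_norm_square[symmetric] by (rule integral_complex_of_real[symmetric])
  then have "(\<integral>z. (cmod (g z))\<^sup>2 \<partial>area_on V) = 0" using 0 by simp
  then have "AE z in area_on V. (cmod (g z))\<^sup>2 = 0"
    using gi by (subst (asm) integral_nonneg_eq_0_iff_AE) auto
  then have ae: "AE z in area_on V. g z = 0" by simp
  define N where "N = {z \<in> V. g z \<noteq> 0}"
  have "continuous_on V g" using g by (auto simp: bergman_space_def intro: holomorphic_on_imp_continuous_on)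
  then have "open (V \<inter> g -` (- {0}))" using open_V by (intro continuous_open_preimage) auto
  moreover have "V \<inter> g -` (- {0}) = N" by (auto simp: N_def)
  ultimately have N: "open N" by simp
  have "N \<in> sets (area_on V)" using N sets_UV by (auto simp: sets_area_on N_def)
  then have "emeasure (area_on V) N = 0"
    using ae by (subst (asm) AE_iff_measurable[where N = N]) (auto simp: N_def)
  moreover have "N \<subseteq> V" by (auto simp: N_def)
  then have "emeasure (area_on V) N = ennreal (1 / pi) * emeasure lebesgue N"
    using N sets_UV by (simp only: emeasure_area_on emeasure_area open_sets_lebesgue)
  moreover have "\<not> pi \<le> 0" using pi_gt_zero by linarith
  then have "ennreal (1 / pi) \<noteq> 0" by (simp add: ennreal_eq_0_iff)
  ultimately have "emeasure lebesgue N = 0" by (metis mult_eq_0_iff)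
  then have "negligible N" using N by (simp add: negligible_iff_emeasure0)
  moreover have "N \<noteq> {}" using \<open>g w \<noteq> 0\<close> w by (auto simp: N_def)
  ultimately show False using open_not_negligible[OF N] by simp
qed

end

lemma bergman_space_diff:
  "f \<in> bergman_space \<Omega> \<Longrightarrow> g \<in> bergman_space \<Omega> \<Longrightarrow> (\<lambda>z. f z - g z) \<in> bergman_space \<Omega>"
  by (auto simp: bergman_space_def intro: L2_diff holomorphic_intros)

text \<open>Pulling back preserves inner products, so the transported disc operator satisfies the
  orthogonality that defines the projection. For uniqueness, the difference of two candidates lies
  in the Bergman space and is orthogonal to itself.\<close>

lemma bergman_projection_conformal:
  assumes conf: "conformal \<phi> unit_disc \<Omega>" and f: "f \<in> Lp_space 2 \<Omega>"
  shows "bergman_projection \<Omega> f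
    = conformal.pushforward \<phi> unit_disc \<Omega> (bergman_disc (conformal.pullback \<phi> f))"
proof -
  interpret conformal \<phi> unit_disc \<Omega> by (rule conf)
  define F where "F = pullback f"
  have F: "F \<in> Lp_space 2 unit_disc" unfolding F_def using f by (rule L2_pullback)
  define G where "G = pushforward (bergman_disc F)"
  have G: "G \<in> bergman_space \<Omega>" unfolding G_def using F by (intro bergman_pushforward bergman_disc_L2)
  have fm: "f \<in> borel_measurable (area_on \<Omega>)" using f by (simp add: L2_space_iff)
  have bm: "h \<in> borel_measurable (area_on \<Omega>)" if "h \<in> bergman_space \<Omega>" for h
    using that by (simp add: bergman_space_def L2_space_iff)
  have orth: "L2_inner \<Omega> (\<lambda>z. f z - G z) h = 0" if h: "h \<in> bergman_space \<Omega>" for h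
  proof -
    have "L2_inner \<Omega> (\<lambda>z. f z - G z) h = L2_inner unit_disc (pullback (\<lambda>z. f z - G z)) (pullback h)"
      using fm bm[OF G] bm[OF h] by (intro L2_inner_pullback) auto
    also have "\<dots> = L2_inner unit_disc (\<lambda>z. F z - bergman_disc F z) (pullback h)"
    proof -
      have "pullback (\<lambda>z. f z - G z) z = F z - bergman_disc F z" if "z \<in> unit_disc" for z
        using pullback_pushforward[OF that, of "bergman_disc F"]
        by (simp add: pullback_def F_def G_def left_diff_distrib)
      then show ?thesis unfolding L2_inner_def by (intro Bochner_Integration.integral_cong) auto
    qed
    also have "\<dots> = 0" using F bergman_pullback[OF h] by (rule bergman_disc_orthogonal)
    finally show ?thesis .
  qed
  have "bergman_projection \<Omega> f = G"
    unfolding bergman_projection_def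
  proof (rule the_equality)
    show "G \<in> bergman_space \<Omega> \<and> (\<forall>z. z \<notin> \<Omega> \<longrightarrow> G z = 0) \<and>
        (\<forall>h\<in>bergman_space \<Omega>. L2_inner \<Omega> (\<lambda>z. f z - G z) h = 0)"
      using G orth by (auto simp: G_def pushforward_def)
    fix g assume g: "g \<in> bergman_space \<Omega> \<and> (\<forall>z. z \<notin> \<Omega> \<longrightarrow> g z = 0) \<and>
        (\<forall>h\<in>bergman_space \<Omega>. L2_inner \<Omega> (\<lambda>z. f z - g z) h = 0)"
    define d where "d = (\<lambda>z. g z - G z)"
    have d: "d \<in> bergman_space \<Omega>" unfolding d_def using g G by (intro bergman_space_diff) auto
    have L2: "f \<in> Lp_space 2 \<Omega>" "g \<in> Lp_space 2 \<Omega>" "G \<in> Lp_space 2 \<Omega>" "d \<in> Lp_space 2 \<Omega>"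
      using f g G d by (auto simp: bergman_space_def)
    have "L2_inner \<Omega> d d = L2_inner \<Omega> (\<lambda>z. f z - G z) d - L2_inner \<Omega> (\<lambda>z. f z - g z) d"
      unfolding L2_inner_def
      using integrable_L2_mult[OF L2_diff[OF L2(1,3)] L2(4)] integrable_L2_mult[OF L2_diff[OF L2(1,2)] L2(4)]
      by (subst Bochner_Integration.integral_diff[symmetric])
         (auto simp: d_def algebra_simps intro!: Bochner_Integration.integral_cong)
    also have "\<dots> = 0" using orth[OF d] g d by simp
    finally have "d w = 0" if "w \<in> \<Omega>" for w using bergman_space_eq_0[OF d _ that] by simp
    then show "g = G" using g by (auto simp: fun_eq_iff d_def G_def pushforward_def)
  qed
  then show ?thesis by (simp add: G_def F_def)
qed

section \<open>The upper bound\<close>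

lemma ennpowr_mono: "x \<le> y \<Longrightarrow> a \<ge> 0 \<Longrightarrow> ennpowr x a \<le> ennpowr y a"
  by (auto simp: ennpowr_def less_top[symmetric] intro!: ennreal_leI powr_mono2 enn2real_mono dest: top_le)

lemma ennpowr_pos: "x > 0 \<Longrightarrow> ennpowr x a > 0"
  by (cases x) (auto simp: ennpowr_def)

text \<open>Hoelder's inequality for \<open>1 = w powr (1 / p) * s powr (1 - 1 / p)\<close> on
  \<open>E\<close>, obtained from Young's inequality after normalising both weights by their
  integrals. It gives \<open>W \<ge> 1\<close> in the upper bound and disposes of the Whitney disc
  in the lower bound.\<close>

lemma duality_lower_bound:
  fixes w s :: "'a \<Rightarrow> real"
  assumes p: "p > 1" and E: "E \<in> sets M" "measure M E > 0"
    and pos: "\<And>x. x \<in> E \<Longrightarrow> s x > 0" "\<And>x. x \<in> E \<Longrightarrow> w x = s x powr (1 - p)"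
    and int: "integrable M (\<lambda>x. indicator E x * w x)" "integrable M (\<lambda>x. indicator E x * s x)"
    and AB: "(\<integral>x. indicator E x * w x \<partial>M) > 0" "(\<integral>x. indicator E x * s x \<partial>M) > 0"
  shows "measure M E powr p \<le> (\<integral>x. indicator E x * w x \<partial>M) * (\<integral>x. indicator E x * s x \<partial>M) powr (p - 1)"
proof -
  define A where "A = (\<integral>x. indicator E x * w x \<partial>M)"
  define B where "B = (\<integral>x. indicator E x * s x \<partial>M)"
  define K where "K = (1 / A) powr (1 / p) * (1 / B) powr (1 - 1 / p)"
  have AB': "A > 0" "B > 0" using AB by (auto simp: A_def B_def)
  have fin: "emeasure M E < \<infinity>" using E(2) by (auto simp: measure_def enn2real_positive_iff)
  have intE: "integrable M (\<lambda>x. indicator E x * K)" using E fin by simp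
  have "measure M E * K = (\<integral>x. indicator E x * K \<partial>M)"
    using E fin sets.sets_into_space[OF E(1)] by (simp add: Int_absorb2)
  also have "\<dots> \<le> (\<integral>x. (1 / p / A) * (indicator E x * w x) + ((1 - 1 / p) / B) * (indicator E x * s x) \<partial>M)"
  proof (intro integral_mono intE Bochner_Integration.integrable_add integrable_mult_right int)
    fix x
    show "indicator E x * K \<le> (1 / p / A) * (indicator E x * w x) + ((1 - 1 / p) / B) * (indicator E x * s x)"
    proof (cases "x \<in> E")
      case True
      have w: "w x > 0" "s x > 0" using pos[OF True] by auto
      have "w x powr (1 / p) * s x powr (1 - 1 / p) = s x powr ((1 - p) * (1 / p) + (1 - 1 / p))"
        unfolding pos(2)[OF True] powr_powr powr_add ..
      also have "(1 - p) * (1 / p) + (1 - 1 / p) = 0" using p by (simp add: field_simps)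
      finally have 1: "w x powr (1 / p) * s x powr (1 - 1 / p) = 1" using w by simp
      have "K = (w x / A) powr (1 / p) * (s x / B) powr (1 - 1 / p)"
      proof -
        have "(w x / A) powr (1 / p) * (s x / B) powr (1 - 1 / p)
          = (w x powr (1 / p) * s x powr (1 - 1 / p)) * K"
          using w AB' by (simp add: powr_divide K_def)
        then show ?thesis by (simp only: 1 mult_1)
      qed
      also have "\<dots> \<le> 1 / p * (w x / A) + (1 - 1 / p) * (s x / B)"
        using w AB' p by (intro Youngs_inequality_0) auto
      finally show ?thesis using True by simp
    qed auto
  qed
  also have "\<dots> = (1 / p / A) * A + ((1 - 1 / p) / B) * B" using int by (simp add: A_def B_def)
  also have "\<dots> = 1" using AB' p by simp
  finally have "(measure M E * K) powr p \<le> 1 powr p" using p by (intro powr_mono2) (auto simp: K_def)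
  moreover have "(measure M E * K) powr p = measure M E powr p * (1 / A * (1 / B) powr (p - 1))"
  proof -
    have "K powr p = (1 / A) powr (1 / p * p) * (1 / B) powr ((1 - 1 / p) * p)"
      unfolding K_def using AB' by (subst powr_mult) (auto simp only: powr_powr powr_ge_zero)
    also have "\<dots> = (1 / A) powr 1 * (1 / B) powr (p - 1)"
      using p by (intro arg_cong2[where f = "(*)"] arg_cong2[where f = "(powr)"]) (auto simp: field_simps)
    finally show ?thesis using AB' by (subst powr_mult) (auto simp: K_def)
  qed
  ultimately have "measure M E powr p * (1 / A * (1 / B) powr (p - 1)) \<le> 1" by simp
  then have "measure M E powr p \<le> A * B powr (p - 1)" using AB' by (simp add: powr_divide field_simps)
  then show ?thesis by (simp add: A_def B_def)
qed

locale disc_conformal = conformal \<phi> unit_disc \<Omega> for \<phi> \<Omega> +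
  fixes p :: real
  assumes p: "p > 1"
begin

section \<open>The weight of a conformal mapping and its averages\<close>

definition w :: "complex \<Rightarrow> real" where "w z = cmod (deriv \<phi> z) powr (2 - p)"

definition s :: "complex \<Rightarrow> real" where "s z = w z powr (- 1 / (p - 1))"

lemma w_pos: "z \<in> unit_disc \<Longrightarrow> w z > 0" using deriv_nonzero[of z] by (simp add: w_def)

lemma s_pos: "z \<in> unit_disc \<Longrightarrow> s z > 0" using w_pos[of z] by (simp add: s_def)

lemma w_eq: "z \<in> unit_disc \<Longrightarrow> w z = s z powr (1 - p)"
proof -
  assume "z \<in> unit_disc"
  moreover have "- 1 / (p - 1) * (1 - p) = 1" using p by (simp add: field_simps)
  ultimately show ?thesis using w_pos[of z] by (simp only: s_def powr_powr) simp
qed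

lemma continuous_w: "continuous_on unit_disc w"
proof -
  have "continuous_on unit_disc (deriv \<phi>)"
    using hol(1) by (intro holomorphic_on_imp_continuous_on holomorphic_deriv) auto
  then show ?thesis unfolding w_def using deriv_nonzero
    by (intro continuous_intros) auto
qed

lemma continuous_s: "continuous_on unit_disc s"
  unfolding s_def using w_pos continuous_w by (intro continuous_intros) force+

lemma w_measurable [measurable]: "w \<in> borel_measurable disc_area"
  by (intro continuous_on_borel_measurable_area continuous_w) auto

lemma s_measurable [measurable]: "s \<in> borel_measurable disc_area"
  by (intro continuous_on_borel_measurable_area continuous_s) auto

text \<open>Extended values, because integrability of the weights is a conclusion: it follows from a
  finite \<open>Ap\<close> in the upper bound and from a finite operator norm in the lower
  bound.\<close>

definition nw :: "complex set \<Rightarrow> ennreal" where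
  "nw E = (\<integral>\<^sup>+z. ennreal (indicator E z * w z) \<partial>disc_area)"

definition ns :: "complex set \<Rightarrow> ennreal" where
  "ns E = (\<integral>\<^sup>+z. ennreal (indicator E z * s z) \<partial>disc_area)"

lemma set_nn_integral_disc:
  assumes "E \<subseteq> unit_disc"
  shows "(\<integral>\<^sup>+z\<in>E. ennreal (v z) \<partial>area) = (\<integral>\<^sup>+z. ennreal (indicator E z * v z) \<partial>disc_area)"
proof -
  have "(\<integral>\<^sup>+z. ennreal (indicator E z * v z) \<partial>disc_area)
    = (\<integral>\<^sup>+z. ennreal (indicator E z * v z) * indicator unit_disc z \<partial>area)"
    by (intro nn_integral_restrict_space) auto
  also have "\<dots> = (\<integral>\<^sup>+z\<in>E. ennreal (v z) \<partial>area)"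
    using assms by (intro nn_integral_cong) (auto simp: indicator_def)
  finally show ?thesis by simp
qed

lemma average_tent:
  "average (ball z r \<inter> ball 0 1) w = nw (tent z r) / emeasure disc_area (tent z r)"
  "average (ball z r \<inter> ball 0 1) s = ns (tent z r) / emeasure disc_area (tent z r)"
  unfolding average_def nw_def ns_def emeasure_tent
  using set_nn_integral_disc[OF tent_subset[of z r]] by (simp_all add: tent_def)

lemma nn_weight_pos:
  assumes E: "E \<in> sets disc_area" "measure disc_area E > 0"
    and v: "v \<in> borel_measurable disc_area" "\<And>z. z \<in> unit_disc \<Longrightarrow> v z > (0::real)"
  shows "(\<integral>\<^sup>+z. ennreal (indicator E z * v z) \<partial>disc_area) > 0"
proof -
  have sub: "E \<subseteq> unit_disc" using sets.sets_into_space[OF E(1)] by simp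
  have "(\<integral>\<^sup>+z. ennreal (indicator E z * v z) \<partial>disc_area) \<noteq> 0"
  proof
    assume "(\<integral>\<^sup>+z. ennreal (indicator E z * v z) \<partial>disc_area) = 0"
    then have "AE z in disc_area. ennreal (indicator E z * v z) = 0"
      using E v by (subst (asm) nn_integral_0_iff_AE) auto
    then have "AE z in disc_area. z \<notin> E"
      by (rule AE_mp) (use v sub in \<open>force intro!: AE_I2 simp: indicator_def split: if_splits\<close>)
    then have "emeasure disc_area E = 0"
      using E(1) sub by (subst (asm) AE_iff_measurable[where N = E]) auto
    then show False using E by (simp add: measure_def)
  qed
  then show ?thesis by (simp add: zero_less_iff_neq_zero)
qed

lemma nw_pos: "E \<in> sets disc_area \<Longrightarrow> measure disc_area E > 0 \<Longrightarrow> nw E > 0"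
  unfolding nw_def by (rule nn_weight_pos) (auto simp: w_pos)

lemma ns_pos: "E \<in> sets disc_area \<Longrightarrow> measure disc_area E > 0 \<Longrightarrow> ns E > 0"
  unfolding ns_def by (rule nn_weight_pos) (auto simp: s_pos)

lemma weight_integrals:
  assumes E: "E \<in> sets disc_area" and fin: "nw E < \<infinity>" "ns E < \<infinity>"
  shows "integrable disc_area (\<lambda>z. indicator E z * w z)" "integrable disc_area (\<lambda>z. indicator E z * s z)"
    "nw E = ennreal (\<integral>z. indicator E z * w z \<partial>disc_area)" "ns E = ennreal (\<integral>z. indicator E z * s z \<partial>disc_area)"
proof -
  have sub: "E \<subseteq> unit_disc" using sets.sets_into_space[OF E(1)] by simp
  have nn: "indicator E z * w z \<ge> 0" "indicator E z * s z \<ge> 0" for z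
    using w_pos[of z] s_pos[of z] sub by (auto simp: indicator_def less_imp_le subset_iff)
  have [measurable]: "E \<in> sets disc_area" by fact
  show i: "integrable disc_area (\<lambda>z. indicator E z * w z)" "integrable disc_area (\<lambda>z. indicator E z * s z)"
    using fin nn unfolding nw_def ns_def by (auto intro!: integrableI_nonneg)
  show "nw E = ennreal (\<integral>z. indicator E z * w z \<partial>disc_area)" "ns E = ennreal (\<integral>z. indicator E z * s z \<partial>disc_area)"
    unfolding nw_def ns_def using i nn by (auto intro!: nn_integral_eq_integral)
qed

lemma weight_product_ge:
  assumes E: "E \<in> sets disc_area" "measure disc_area E > 0" and fin: "nw E < \<infinity>" "ns E < \<infinity>"
  shows "measure disc_area E powr p \<le> enn2real (nw E) * enn2real (ns E) powr (p - 1)"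
proof -
  have sub: "E \<subseteq> unit_disc" using sets.sets_into_space[OF E(1)] by simp
  note W = weight_integrals[OF E(1) fin]
  have pos: "(\<integral>z. indicator E z * w z \<partial>disc_area) > 0" "(\<integral>z. indicator E z * s z \<partial>disc_area) > 0"
    using nw_pos[OF E] ns_pos[OF E] unfolding W(3,4) by simp_all
  have "measure disc_area E powr p
    \<le> (\<integral>z. indicator E z * w z \<partial>disc_area) * (\<integral>z. indicator E z * s z \<partial>disc_area) powr (p - 1)"
    using p E W(1,2) pos sub s_pos w_eq by (intro duality_lower_bound) auto
  then show ?thesis unfolding W(3,4) using pos by simp
qed

definition Ap :: ennreal where "Ap = Ap_plus p w"

lemma Ap_eq:
  "Ap = (SUP z \<in> sphere 0 1. SUP r \<in> {0<..}.
     nw (tent z r) / emeasure disc_area (tent z r) *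
     ennpowr (ns (tent z r) / emeasure disc_area (tent z r)) (p - 1))"
  unfolding Ap_def Ap_plus_def s_def[symmetric, abs_def] average_tent
  by (simp add: average_tent flip: s_def)

lemma tent_pos: "norm z = 1 \<Longrightarrow> r > 0 \<Longrightarrow> measure disc_area (tent z r) > 0"
proof -
  assume z: "norm z = 1" and r: "r > 0"
  have "0 < (min r 2)\<^sup>2 / 4" using r by simp
  also have "\<dots> \<le> measure disc_area (tent z (min r 2))" using z r by (intro measure_tent_ge) auto
  also have "\<dots> \<le> measure disc_area (tent z r)"
    by (intro disc_area.finite_measure_mono tent_sets tent_mono) auto
  finally show ?thesis .
qed

text \<open>Both weights have positive integral over a tent, so if one integral were infinite the
  product of averages would be infinite too. Multiplying out the averages then gives the
  quotient-free condition of \<open>laminar_Ap\<close>.\<close>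

lemma Ap_bound:
  assumes z: "norm z = 1" and r: "r > 0" and fin: "Ap < \<infinity>"
  shows "nw (tent z r) < \<infinity>" "ns (tent z r) < \<infinity>"
    "enn2real (nw (tent z r)) * enn2real (ns (tent z r)) powr (p - 1)
      \<le> enn2real Ap * measure disc_area (tent z r) powr p"
proof -
  let ?T = "tent z r"
  define \<mu> where "\<mu> = measure disc_area ?T"
  have \<mu>: "\<mu> > 0" using tent_pos[OF z r] by (simp add: \<mu>_def)
  have em: "emeasure disc_area ?T = ennreal \<mu>" by (simp add: \<mu>_def disc_area.emeasure_eq_measure)
  have "nw ?T / emeasure disc_area ?T * ennpowr (ns ?T / emeasure disc_area ?T) (p - 1) \<le> Ap"
    unfolding Ap_eq using z r by (intro SUP_upper2[of z] SUP_upper2[of r]) auto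
  then have le: "nw ?T / ennreal \<mu> * ennpowr (ns ?T / ennreal \<mu>) (p - 1) \<le> Ap" by (simp add: em)
  have pos: "nw ?T > 0" "ns ?T > 0" using nw_pos ns_pos tent_sets tent_pos[OF z r] by auto
  have dpos: "x / ennreal \<mu> > 0" if "x > 0" for x
    using that \<mu> by (simp add: divide_ennreal_def ennreal_zero_less_mult_iff inverse_ennreal)
  show fw: "nw ?T < \<infinity>"
  proof (rule ccontr)
    assume "\<not> nw ?T < \<infinity>"
    then have "nw ?T = top" by (simp add: less_top[symmetric])
    moreover have "ennpowr (ns ?T / ennreal \<mu>) (p - 1) \<noteq> 0"
      using ennpowr_pos[OF dpos[OF pos(2)], of "p - 1"] by auto
    ultimately show False using le fin \<mu> by (simp add: ennreal_top_divide ennreal_top_mult less_top[symmetric] top_unique)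
  qed
  show fs: "ns ?T < \<infinity>"
  proof (rule ccontr)
    assume "\<not> ns ?T < \<infinity>"
    then have "ns ?T = top" by (simp add: less_top[symmetric])
    moreover have "nw ?T / ennreal \<mu> \<noteq> 0" using dpos[OF pos(1)] by auto
    ultimately show False using le fin \<mu> by (simp add: ennreal_top_divide ennreal_mult_top less_top[symmetric] top_unique)
  qed
  define A B where "A = enn2real (nw ?T)" and "B = enn2real (ns ?T)"
  have AB: "nw ?T = ennreal A" "ns ?T = ennreal B" "A \<ge> 0" "B \<ge> 0"
    using fw fs by (auto simp: A_def B_def less_top)
  have "ennreal (A / \<mu> * (B / \<mu>) powr (p - 1)) = nw ?T / ennreal \<mu> * ennpowr (ns ?T / ennreal \<mu>) (p - 1)"
    using AB \<mu> by (simp add: divide_ennreal ennpowr_ennreal ennreal_mult[symmetric])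
  also have "\<dots> \<le> Ap" by (rule le)
  also have "Ap = ennreal (enn2real Ap)" using fin by (simp add: less_top)
  finally have "A / \<mu> * (B / \<mu>) powr (p - 1) \<le> enn2real Ap" by (subst (asm) ennreal_le_iff) auto
  then have "A / \<mu> * (B / \<mu>) powr (p - 1) * \<mu> powr p \<le> enn2real Ap * \<mu> powr p" by (intro mult_right_mono) auto
  also have "A / \<mu> * (B / \<mu>) powr (p - 1) * \<mu> powr p = A * B powr (p - 1)"
    using AB \<mu> powr_mult_base[of \<mu> "p - 1"] by (simp add: powr_divide field_simps)
  finally show "enn2real (nw ?T) * enn2real (ns ?T) powr (p - 1) \<le> enn2real Ap * measure disc_area ?T powr p"
    by (simp add: A_def B_def \<mu>_def)
qed

lemma upper_bound:
  "bergman_opnorm p \<Omega> \<le> ennreal (321159168 * max p (1 / (p - 1))) * ennpowr Ap (max 1 (1 / (p - 1)))"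
proof (cases "Ap < \<infinity>")
  case False
  then have "Ap = top" by (simp add: less_top[symmetric])
  moreover have "321159168 * max p (1 / (p - 1)) > 0" using p by (simp add: max_def)
  ultimately show ?thesis by (simp add: ennreal_mult_top)
next
  case True
  define W where "W = enn2real Ap"
  \<comment> \<open>Any radius of at least 2 yields the whole disc. Finiteness of \<open>Ap\<close>
    on this one tent makes both weights integrable on the disc, and duality there gives
    \<open>W \<ge> 1\<close>.\<close>
  have disc: "tent 1 3 = unit_disc" by (rule tent_eq_disc) auto
  have b3: "nw unit_disc < \<infinity>" "ns unit_disc < \<infinity>"
    "enn2real (nw unit_disc) * enn2real (ns unit_disc) powr (p - 1) \<le> enn2real Ap * measure disc_area unit_disc powr p"
    using Ap_bound[of 1 3] True unfolding disc by simp_all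
  have ind: "\<And>v. integrable disc_area (\<lambda>z. indicator unit_disc z * v z) \<Longrightarrow> integrable disc_area (v :: complex \<Rightarrow> real)"
    by (subst Bochner_Integration.integrable_cong[OF refl, of _ _ "\<lambda>z. indicator unit_disc z * v z" for v]) auto
  have disc_set: "unit_disc \<in> sets disc_area" using tent_sets[of 1 3] by (simp add: disc)
  have int_w: "integrable disc_area w" and int_s: "integrable disc_area s"
    using weight_integrals(1,2)[OF disc_set b3(1,2)] by (auto intro: ind)
  have W: "W \<ge> 1"
  proof -
    have "measure disc_area unit_disc powr p \<le> enn2real (nw unit_disc) * enn2real (ns unit_disc) powr (p - 1)"
      using b3 disc_set by (intro weight_product_ge) (auto simp: measure_unit_disc)
    then show ?thesis using b3(3) by (simp add: W_def measure_unit_disc)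
  qed
  define K where "K = 321159168 * (max p (1 / (p - 1)) * W powr max 1 (1 / (p - 1)))"
  have K: "K \<ge> 0" using p by (simp add: K_def)
  have "bergman_opnorm p \<Omega> \<le> ennreal K"
    unfolding bergman_opnorm_def
  proof (rule SUP_least, clarify)
    fix f assume f2: "f \<in> Lp_space 2 \<Omega>" and fp: "f \<in> Lp_space p \<Omega>" and norm: "Lp_norm p \<Omega> f \<le> 1"
    have fm: "f \<in> borel_measurable (area_on \<Omega>)" using f2 by (simp add: L2_space_iff)
    define F where "F = pullback f"
    have F2: "F \<in> Lp_space 2 unit_disc" unfolding F_def by (rule L2_pullback[OF f2])
    have Fm: "F \<in> borel_measurable disc_area" using F2 by (simp add: L2_space_iff)
    define Y where "Y = (\<integral>w. cmod (f w) powr p \<partial>area_on \<Omega>)"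
    have Y0: "Y \<ge> 0" unfolding Y_def by (intro Bochner_Integration.integral_nonneg) auto
    have "Y powr (1 / p) \<le> 1" using norm unfolding Lp_norm_eq[OF fp] Y_def[symmetric] by simp
    then have Y: "Y \<le> 1"
      using powr_mono2[of p "Y powr (1 / p)" 1] p Y0 by (simp add: powr_powr)
    have Yint: "(\<integral>\<^sup>+w. ennreal (cmod (f w) powr p) \<partial>area_on \<Omega>) = ennreal Y"
      unfolding Y_def using fp by (intro nn_integral_eq_integral) (auto simp: Lp_space_iff)
    have nnF: "(\<integral>\<^sup>+z. ennreal (cmod (F z) powr p * w z) \<partial>disc_area) = ennreal Y"
      using nn_integral_pullback[OF fm, of p] by (simp add: F_def w_def Yint)
    have nFm: "(\<lambda>z. cmod (F z)) \<in> borel_measurable disc_area"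
      by (rule measurable_compose[OF Fm borel_measurable_norm])
    have Fw_meas: "(\<lambda>z. cmod (F z) powr p * w z) \<in> borel_measurable disc_area"
      using nFm by measurable
    have Fw: "integrable disc_area (\<lambda>z. cmod (F z) powr p * w z)"
      using nnF Fw_meas w_pos by (intro integrableI_nonneg) (auto simp: less_imp_le)
    have Fw_eq: "(\<integral>z. cmod (F z) powr p * w z \<partial>disc_area) = Y"
    proof -
      have nn: "cmod (F z) powr p * w z \<ge> 0" if "z \<in> unit_disc" for z
        using w_pos[OF that] by simp
      then have "(\<integral>z. cmod (F z) powr p * w z \<partial>disc_area) \<ge> 0"
        by (intro Bochner_Integration.integral_nonneg) simp
      moreover have "(\<integral>\<^sup>+z. ennreal (cmod (F z) powr p * w z) \<partial>disc_area)
          = ennreal (\<integral>z. cmod (F z) powr p * w z \<partial>disc_area)"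
        using Fw nn by (intro nn_integral_eq_integral) auto
      ultimately show ?thesis using nnF Y0 by (simp add: ennreal_inj)
    qed
    have ap: "(\<integral>x. indicator (tent z r) x * w x \<partial>disc_area) * (\<integral>x. indicator (tent z r) x * s x \<partial>disc_area) powr (p - 1)
        \<le> W * measure disc_area (tent z r) powr p" if "norm z = 1" "r > 0" for z r
    proof -
      note b = Ap_bound[OF that True]
      note i = weight_integrals[OF tent_sets b(1,2)]
      have nn: "(\<integral>x. indicator (tent z r) x * w x \<partial>disc_area) \<ge> 0" "(\<integral>x. indicator (tent z r) x * s x \<partial>disc_area) \<ge> 0"
        using w_pos s_pos by (auto intro!: Bochner_Integration.integral_nonneg simp: less_imp_le)
      show ?thesis using b(3) nn unfolding i(3,4) W_def by simp
    qed
    have "(\<integral>\<^sup>+x. ennreal (pos_bergman (\<lambda>y. norm (F y)) x powr p * w x) \<partial>disc_area)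
        \<le> ennreal ((321159168 * (max p (1 / (p - 1)) * W powr max 1 (1 / (p - 1)))) powr p
          * (\<integral>x. cmod (F x) powr p * w x \<partial>disc_area))"
      using p W int_w int_s s_pos w_eq ap nFm Fw by (intro pos_bergman_weighted(2)[where s = s]) auto
    also have "\<dots> \<le> ennreal (K powr p)"
      unfolding Fw_eq K_def[symmetric] using Y by (intro ennreal_leI) (simp add: mult_left_le)
    finally have 1: "(\<integral>\<^sup>+x. ennreal (pos_bergman (\<lambda>y. norm (F y)) x powr p * w x) \<partial>disc_area) \<le> ennreal (K powr p)" .
    have proj: "bergman_projection \<Omega> f = pushforward (bergman_disc F)"
      unfolding F_def by (rule bergman_projection_conformal[OF _ f2]) (rule conformal_axioms)
    have bm: "bergman_disc F \<in> borel_measurable disc_area"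
      using bergman_disc_L2[OF F2] by (simp add: bergman_space_def L2_space_iff)
    have "(\<integral>\<^sup>+v. ennreal (cmod (bergman_projection \<Omega> f v) powr p) \<partial>area_on \<Omega>)
        = (\<integral>\<^sup>+z. ennreal (cmod (bergman_disc F z) powr p * w z) \<partial>disc_area)"
      unfolding proj w_def by (rule nn_integral_pushforward[OF bm])
    also have "\<dots> \<le> (\<integral>\<^sup>+x. ennreal (pos_bergman (\<lambda>y. norm (F y)) x powr p * w x) \<partial>disc_area)"
      using p w_pos by (intro nn_integral_mono ennreal_leI mult_right_mono powr_mono2 norm_bergman_disc_le)
        (auto simp: less_imp_le)
    also note 1
    finally have "Lp_norm p \<Omega> (bergman_projection \<Omega> f) \<le> ennpowr (ennreal (K powr p)) (1 / p)"
      unfolding Lp_norm_def using p by (intro ennpowr_mono) auto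
    also have "\<dots> = ennreal K" using K p by (simp add: ennpowr_ennreal powr_powr)
    finally show "Lp_norm p \<Omega> (bergman_projection \<Omega> f) \<le> ennreal K" .
  qed
  also have "ennreal K = ennreal (321159168 * max p (1 / (p - 1))) * ennreal (W powr max 1 (1 / (p - 1)))"
    unfolding K_def using p by (subst ennreal_mult[symmetric]) (auto simp: mult.assoc)
  also have "ennreal (W powr max 1 (1 / (p - 1))) = ennpowr Ap (max 1 (1 / (p - 1)))"
    using True by (simp add: ennpowr_def W_def less_top)
  finally show ?thesis .
qed

end

section \<open>The lower bound\<close>

lemma Re_of_real_mult: "Re (of_real a * z) = a * Re z"
  by simp

text \<open>After division by \<open>\<tau>\<close> the number is \<open>1 + \<eta>\<close> with
  \<open>norm \<eta> \<le> 1 / 5\<close>. Its square has real part at least 14/25 and modulus at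
  most 36/25, so it stays in a sector about the positive axis, and so does its inverse.\<close>

lemma Re_inverse_square_ge:
  fixes \<zeta> :: complex
  assumes \<tau>: "\<tau> > 0" and \<zeta>: "norm (\<zeta> - of_real \<tau>) \<le> \<tau> / 5"
  shows "1 / (10 * \<tau>\<^sup>2) \<le> Re (1 / \<zeta>\<^sup>2)"
proof -
  define \<eta> where "\<eta> = (\<zeta> - of_real \<tau>) / of_real \<tau>"
  have \<eta>: "norm \<eta> \<le> 1 / 5" using \<tau> \<zeta> by (simp add: \<eta>_def norm_divide field_simps)
  have \<zeta>_eq: "\<zeta> = of_real \<tau> * (1 + \<eta>)" using \<tau> by (simp add: \<eta>_def field_simps)
  define q where "q = (1 + \<eta>)\<^sup>2"
  have eta2: "norm (\<eta>\<^sup>2) \<le> 1 / 25"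
    using power_mono[OF \<eta>, of 2] by (simp add: norm_power power_divide)
  have "Re q = 1 + 2 * Re \<eta> + Re (\<eta>\<^sup>2)" by (simp add: q_def power2_eq_square algebra_simps)
  moreover have "- (1 / 5) \<le> Re \<eta>" using \<eta> abs_Re_le_cmod[of \<eta>] by linarith
  moreover have "- (1 / 25) \<le> Re (\<eta>\<^sup>2)" using eta2 abs_Re_le_cmod[of "\<eta>\<^sup>2"] by linarith
  ultimately have Re_q: "14 / 25 \<le> Re q" by linarith
  have "norm (1 + \<eta>) \<le> 6 / 5" using norm_triangle_ineq[of 1 \<eta>] \<eta> by simp
  then have "norm q \<le> (6 / 5)\<^sup>2" unfolding q_def norm_power by (intro power_mono) auto
  then have "(norm q)\<^sup>2 \<le> ((6 / 5)\<^sup>2)\<^sup>2" by (intro power_mono) auto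
  then have q2: "(norm q)\<^sup>2 \<le> 56 / 10" by (simp add: power2_eq_square)
  have q0: "(norm q)\<^sup>2 > 0" using Re_q by auto
  have "1 / 10 * (norm q)\<^sup>2 \<le> Re q" using q2 Re_q by linarith
  then have "1 / 10 \<le> Re q / (norm q)\<^sup>2" using q0 by (simp add: field_simps)
  also have "\<dots> = Re (1 / q)" by (simp add: Re_divide cmod_power2)
  finally have "1 / 10 \<le> Re (1 / q)" .
  moreover have "1 / \<zeta>\<^sup>2 = of_real (1 / \<tau>\<^sup>2) * (1 / q)" using \<tau> by (simp add: \<zeta>_eq q_def power_mult_distrib)
  then have "Re (1 / \<zeta>\<^sup>2) = 1 / \<tau>\<^sup>2 * Re (1 / q)" by (simp only: Re_of_real_mult)
  ultimately have "1 / \<tau>\<^sup>2 * (1 / 10) \<le> Re (1 / \<zeta>\<^sup>2)" using \<tau> by (simp only:) (intro mult_left_mono, auto)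
  then show ?thesis by (simp add: field_simps)
qed

context disc_conformal
begin

text \<open>The test function is \<open>s\<close> on \<open>E\<close>, normalised; since
  \<open>s powr p * w = s\<close>, its weighted norm is a power of \<open>ns E\<close>. As
  \<open>E\<close> stays away from the circle, \<open>s\<close> is bounded on it and the test
  function lies in \<open>L^2\<close>. On \<open>G\<close> the real part of its image is at least
  \<open>c\<close> times its integral. The second claim uses extended reals because
  \<open>nw G\<close> may still be infinite.\<close>

lemma opnorm_test:
  assumes n: "bergman_opnorm p \<Omega> = ennreal n" "n \<ge> 0"
    and E: "E \<in> sets disc_area" "measure disc_area E > 0" "E \<subseteq> ball 0 \<rho>" "\<rho> < 1"
    and G: "G \<in> sets disc_area"
    and c: "c > 0" and ker: "\<And>x y. x \<in> G \<Longrightarrow> y \<in> E \<Longrightarrow> c \<le> Re (1 / (1 - x * cnj y)\<^sup>2)"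
  shows "ns E < \<infinity>" "ennreal (c powr p * enn2real (ns E) powr (p - 1)) * nw G \<le> ennreal (n powr p)"
proof -
  have sub: "E \<subseteq> unit_disc" "G \<subseteq> unit_disc" using sets.sets_into_space[OF E(1)] sets.sets_into_space[OF G] by auto
  have [measurable]: "E \<in> sets disc_area" "G \<in> sets disc_area" by fact+
  obtain B where B: "\<And>y. y \<in> E \<Longrightarrow> s y \<le> B"
  proof -
    have "compact (s ` cball 0 \<rho>)"
      using E(4) continuous_s by (intro compact_continuous_image) (auto intro: continuous_on_subset)
    then have "bdd_above (s ` cball 0 \<rho>)" by (intro bounded_imp_bdd_above compact_imp_bounded)
    then obtain B where "\<forall>y\<in>cball 0 \<rho>. s y \<le> B" by (auto simp: bdd_above_def)
    then show ?thesis using E(3) by (intro that[of B]) (auto simp: subset_iff less_imp_le)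
  qed
  have s_nn: "indicator E y * s y \<ge> 0" for y using s_pos[of y] sub by (auto simp: indicator_def less_imp_le)
  have s_le: "indicator E y * s y \<le> \<bar>B\<bar>" for y using B[of y] by (auto simp: indicator_def)
  have int_s: "integrable disc_area (\<lambda>y. indicator E y * s y)"
    by (rule disc_area.integrable_const_bound[where B = "\<bar>B\<bar>"]) (use s_nn s_le in auto)
  define S where "S = (\<integral>y. indicator E y * s y \<partial>disc_area)"
  have nsE: "ns E = ennreal S" unfolding ns_def S_def using int_s s_nn by (intro nn_integral_eq_integral) auto
  then show "ns E < \<infinity>" by simp
  have S: "S > 0" using ns_pos[OF E(1,2)] by (simp add: nsE)
  define a where "a = S powr (1 / p)"
  have a: "a > 0" "a powr p = S" using S p by (auto simp: a_def powr_powr)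
  define F where "F = (\<lambda>y. complex_of_real (indicator E y * s y / a))"
  have Fm: "F \<in> borel_measurable disc_area"
  proof -
    have "(\<lambda>y. indicator E y * s y / a) \<in> borel_measurable disc_area" by measurable
    then show ?thesis unfolding F_def by simp
  qed
  have F2: "F \<in> Lp_space 2 unit_disc"
    unfolding L2_space_iff
  proof (intro conjI Fm disc_area.integrable_const_bound[where B = "(\<bar>B\<bar> / a)\<^sup>2"])
    show "AE y in disc_area. norm ((cmod (F y))\<^sup>2) \<le> (\<bar>B\<bar> / a)\<^sup>2"
    proof (intro AE_I2)
      fix y
      have "cmod (F y) \<le> \<bar>B\<bar> / a" unfolding F_def norm_of_real
        using s_nn[of y] s_le[of y] a by (simp add: divide_right_mono)
      then have "(cmod (F y))\<^sup>2 \<le> (\<bar>B\<bar> / a)\<^sup>2" by (intro power_mono) auto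
      then show "norm ((cmod (F y))\<^sup>2) \<le> (\<bar>B\<bar> / a)\<^sup>2" by simp
    qed
    show "(\<lambda>y. (cmod (F y))\<^sup>2) \<in> borel_measurable disc_area"
      using measurable_compose[OF Fm borel_measurable_norm] by (intro borel_measurable_power)
  qed
  define f where "f = pushforward F"
  have f2: "f \<in> Lp_space 2 \<Omega>" unfolding f_def by (rule L2_pushforward[OF F2])
  have nnf: "(\<integral>\<^sup>+v. ennreal (cmod (f v) powr p) \<partial>area_on \<Omega>) = 1"
  proof -
    have "(\<integral>\<^sup>+v. ennreal (cmod (f v) powr p) \<partial>area_on \<Omega>)
        = (\<integral>\<^sup>+z. ennreal (cmod (F z) powr p * w z) \<partial>disc_area)"
      unfolding f_def w_def by (rule nn_integral_pushforward[OF Fm])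
    also have "\<dots> = (\<integral>\<^sup>+z. ennreal (1 / S * (indicator E z * s z)) \<partial>disc_area)"
    proof (intro nn_integral_cong arg_cong[where f = ennreal])
      fix z assume "z \<in> space disc_area"
      then have z: "z \<in> unit_disc" by simp
      show "cmod (F z) powr p * w z = 1 / S * (indicator E z * s z)"
      proof (cases "z \<in> E")
        case True
        have "s z powr p * w z = s z"
          using s_pos[OF z] w_eq[OF z] by (simp add: powr_add[symmetric])
        moreover have "cmod (F z) = s z / a"
          unfolding F_def norm_of_real using True s_pos[OF z] a by simp
        ultimately show ?thesis using True s_pos[OF z] a
          by (simp add: powr_divide mult.commute)
      qed (simp add: F_def)
    qed
    also have "\<dots> = ennreal (\<integral>z. 1 / S * (indicator E z * s z) \<partial>disc_area)"
      using int_s s_nn S by (intro nn_integral_eq_integral integrable_mult_right AE_I2) auto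
    also have "(\<integral>z. 1 / S * (indicator E z * s z) \<partial>disc_area) = 1 / S * S"
      unfolding S_def by (rule integral_mult_right_zero)
    finally show ?thesis using S by simp
  qed
  have fp: "f \<in> Lp_space p \<Omega>"
    using f2 nnf unfolding Lp_space_def Lp_norm_def mem_Collect_eq ennpowr_less_top_iff by simp
  have "Lp_norm p \<Omega> f \<le> 1"
    unfolding Lp_norm_def nnf using ennpowr_ennreal[of 1 "1 / p"] by simp
  then have "Lp_norm p \<Omega> (bergman_projection \<Omega> f) \<le> bergman_opnorm p \<Omega>"
    unfolding bergman_opnorm_def using f2 fp by (intro SUP_upper) auto
  then have le: "Lp_norm p \<Omega> (bergman_projection \<Omega> f) \<le> ennreal n" by (simp add: n)
  have proj: "bergman_projection \<Omega> f = pushforward (bergman_disc F)"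
  proof -
    have "bergman_projection \<Omega> f = pushforward (bergman_disc (pullback f))"
      by (rule bergman_projection_conformal[OF _ f2]) (rule conformal_axioms)
    moreover have "bergman_disc (pullback f) = bergman_disc F"
      unfolding bergman_disc_def[abs_def]
      by (intro ext Bochner_Integration.integral_cong refl) (simp add: f_def pullback_pushforward)
    ultimately show ?thesis by simp
  qed
  have bm: "bergman_disc F \<in> borel_measurable disc_area"
    using bergman_disc_L2[OF F2] by (simp add: bergman_space_def L2_space_iff)
  define X where "X = (\<integral>\<^sup>+z. ennreal (cmod (bergman_disc F z) powr p * w z) \<partial>disc_area)"
  have "ennpowr X (1 / p) \<le> ennreal n"
    using le unfolding Lp_norm_def proj X_def w_def nn_integral_pushforward[OF bm] .
  then have X: "X \<le> ennreal (n powr p)"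
  proof (cases X)
    case (real r)
    then have "r powr (1 / p) \<le> n" using \<open>ennpowr X (1 / p) \<le> ennreal n\<close> n(2)
      by (simp add: ennpowr_ennreal)
    then have "(r powr (1 / p)) powr p \<le> n powr p" using p by (intro powr_mono2) auto
    then show ?thesis using real p by (simp add: powr_powr ennreal_leI)
  qed (simp add: ennpowr_def top_unique)
  have lower: "c * (S / a) \<le> cmod (bergman_disc F x)" if x: "x \<in> G" for x
  proof -
    have x1: "norm x < 1" using x sub by auto
    have Fint: "integrable disc_area (\<lambda>y. F y / (1 - x * cnj y)\<^sup>2)"
      using F2 x1 by (intro integrable_bergman_kernel L2_imp_integrable)
    have Re_eq: "Re (F y / (1 - x * cnj y)\<^sup>2) = (indicator E y * s y / a) * Re (1 / (1 - x * cnj y)\<^sup>2)" for y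
    proof -
      have "F y / (1 - x * cnj y)\<^sup>2 = of_real (indicator E y * s y / a) * (1 / (1 - x * cnj y)\<^sup>2)"
        by (simp add: F_def)
      then show ?thesis by (simp only: Re_of_real_mult)
    qed
    have "c * (S / a) = (\<integral>y. c / a * (indicator E y * s y) \<partial>disc_area)" by (simp add: S_def)
    also have "\<dots> \<le> (\<integral>y. Re (F y / (1 - x * cnj y)\<^sup>2) \<partial>disc_area)"
    proof (intro integral_mono integrable_mult_right int_s integrable_Re Fint)
      fix y
      show "c / a * (indicator E y * s y) \<le> Re (F y / (1 - x * cnj y)\<^sup>2)"
      proof (cases "y \<in> E")
        case True
        have "(indicator E y * s y / a) * c \<le> (indicator E y * s y / a) * Re (1 / (1 - x * cnj y)\<^sup>2)"
          using ker[OF x True] s_nn[of y] a by (intro mult_left_mono) auto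
        then show ?thesis unfolding Re_eq by (simp add: mult_ac)
      qed (simp add: F_def)
    qed
    also have "\<dots> = Re (bergman_disc F x)"
      unfolding bergman_disc_def by (rule integral_Re[OF Fint])
    also have "\<dots> \<le> cmod (bergman_disc F x)" by (rule complex_Re_le_cmod)
    finally show ?thesis .
  qed
  have "ennreal ((c * (S / a)) powr p) * nw G = (\<integral>\<^sup>+z. ennreal ((c * (S / a)) powr p) * ennreal (indicator G z * w z) \<partial>disc_area)"
    unfolding nw_def by (intro nn_integral_cmult[symmetric]) measurable
  also have "\<dots> \<le> X"
    unfolding X_def
  proof (intro nn_integral_mono)
    fix z assume "z \<in> space disc_area"
    then have z: "z \<in> unit_disc" by simp
    show "ennreal ((c * (S / a)) powr p) * ennreal (indicator G z * w z) \<le> ennreal (cmod (bergman_disc F z) powr p * w z)"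
    proof (cases "z \<in> G")
      case True
      have "(c * (S / a)) powr p \<le> cmod (bergman_disc F z) powr p"
        using lower[OF True] c S a p by (intro powr_mono2) auto
      then show ?thesis using True w_pos[OF z] by (simp add: ennreal_mult[symmetric] mult_right_mono)
    qed simp
  qed
  also note X
  finally have "ennreal ((c * (S / a)) powr p) * nw G \<le> ennreal (n powr p)" .
  moreover have "(c * (S / a)) powr p = c powr p * S powr (p - 1)"
    using c S a by (simp add: powr_mult powr_divide powr_diff)
  ultimately show "ennreal (c powr p * enn2real (ns E) powr (p - 1)) * nw G \<le> ennreal (n powr p)"
    using S by (simp add: nsE)
qed

text \<open>\<open>E\<close> is exhausted by its intersections with smaller discs. A single one of
  positive measure forces \<open>nw G\<close> to be finite; the bounds for \<open>ns\<close> are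
  then uniform and pass to \<open>E\<close> by monotone convergence.\<close>

lemma opnorm_test_general:
  assumes n: "bergman_opnorm p \<Omega> = ennreal n" "n \<ge> 0"
    and E: "E \<in> sets disc_area" "measure disc_area E > 0"
    and G: "G \<in> sets disc_area" "measure disc_area G > 0"
    and c: "c > 0" and ker: "\<And>x y. x \<in> G \<Longrightarrow> y \<in> E \<Longrightarrow> c \<le> Re (1 / (1 - x * cnj y)\<^sup>2)"
  shows "ns E < \<infinity>" "nw G < \<infinity>"
    "c powr p * enn2real (ns E) powr (p - 1) * enn2real (nw G) \<le> n powr p"
proof -
  have Esub: "E \<subseteq> unit_disc" using sets.sets_into_space[OF E(1)] by simp
  define D where "D = (\<lambda>k. E \<inter> ball 0 (radius_seq k))"
  have D: "D k \<in> sets disc_area" for k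
    unfolding D_def using E(1) by (auto simp: sets_area_on)
  have D_mono: "incseq D"
    unfolding D_def incseq_def using radius_seq_mono by (auto intro: order_less_le_trans[OF _ radius_seq_mono])
  have D_Un: "(\<Union>k. D k) = E"
  proof safe
    fix z assume z: "z \<in> E"
    then have "norm z < 1" using Esub by auto
    then have "\<forall>\<^sub>F k in sequentially. norm z < radius_seq k" by (rule order_tendstoD(1)[OF radius_seq_tendsto])
    then obtain k where "norm z < radius_seq k" by (auto simp: eventually_sequentially)
    then show "z \<in> (\<Union>k. D k)" using z by (auto simp: D_def)
  qed (auto simp: D_def)
  have "(\<lambda>k. measure disc_area (D k)) \<longlonglongrightarrow> measure disc_area E"
    using disc_area.finite_Lim_measure_incseq[of D] D D_mono D_Un by auto
  then have "\<forall>\<^sub>F k in sequentially. measure disc_area (D k) > 0"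
    using E(2) by (rule order_tendstoD(1))
  then obtain k0 where k0: "\<And>k. k \<ge> k0 \<Longrightarrow> measure disc_area (D k) > 0"
    by (auto simp: eventually_sequentially)
  have test: "ns (D k) < \<infinity>" "ennreal (c powr p * enn2real (ns (D k)) powr (p - 1)) * nw G \<le> ennreal (n powr p)" if "k \<ge> k0" for k
    using opnorm_test[OF n D k0[OF that] _ radius_seq_bounds(2)[of k] G(1) c] ker by (auto simp: D_def)
  have nwG: "nw G > 0" using nw_pos[OF G] .
  have pos: "c powr p * enn2real (ns (D k)) powr (p - 1) > 0" if "k \<ge> k0" for k
  proof -
    have "enn2real (ns (D k)) > 0"
      using ns_pos[OF D k0[OF that]] test(1)[OF that] by (simp add: enn2real_positive_iff)
    then show ?thesis using c by simp
  qed
  show fin: "nw G < \<infinity>"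
  proof (rule ccontr)
    assume "\<not> nw G < \<infinity>"
    then have "nw G = top" by (simp add: less_top[symmetric])
    then show False using test(2)[of k0] pos[of k0]
      by (auto simp: ennreal_mult_top top_unique split: if_splits)
  qed
  define g where "g = enn2real (nw G)"
  have g: "g > 0" "nw G = ennreal g" using nwG fin by (auto simp: g_def enn2real_positive_iff less_top)
  \<comment> \<open>The bound of \<open>opnorm_test\<close> solved for \<open>ns (D k)\<close>; the
    result does not depend on \<open>k\<close>.\<close>
  define L where "L = (n powr p / (c powr p * g)) powr (1 / (p - 1))"
  have L: "L \<ge> 0" "L powr (p - 1) = n powr p / (c powr p * g)"
    using p g by (auto simp: L_def powr_powr)
  have ub: "ns (D k) \<le> ennreal L" if "k \<ge> k0" for k
  proof -
    define t where "t = enn2real (ns (D k))"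
    have t: "t \<ge> 0" "ns (D k) = ennreal t" using test(1)[OF that] by (auto simp: t_def less_top)
    have "ennreal (c powr p * t powr (p - 1) * g) \<le> ennreal (n powr p)"
      using test(2)[OF that] g by (simp add: t_def[symmetric] ennreal_mult[symmetric])
    then have "c powr p * t powr (p - 1) * g \<le> n powr p" by (subst (asm) ennreal_le_iff) auto
    then have tL: "t powr (p - 1) \<le> L powr (p - 1)" unfolding L using c g by (simp add: field_simps)
    have "(t powr (p - 1)) powr (1 / (p - 1)) \<le> (L powr (p - 1)) powr (1 / (p - 1))"
      by (rule powr_mono2) (use p tL in auto)
    moreover have "(x powr (p - 1)) powr (1 / (p - 1)) = x" if "x \<ge> 0" for x :: real
      using that p by (simp add: powr_powr)
    ultimately have "t \<le> L" using t(1) L(1) by metis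
    then show ?thesis using t by (simp add: ennreal_leI)
  qed
  have "ns E = (SUP k. ns (D k))"
  proof -
    have m: "(\<lambda>z. ennreal (indicator (D k) z * s z)) \<in> borel_measurable disc_area" for k
      using D[of k] by measurable
    have inc: "incseq (\<lambda>k z. ennreal (indicator (D k) z * s z) * indicator unit_disc z)"
      using D_mono s_pos by (auto simp: incseq_def le_fun_def indicator_def less_imp_le subset_iff intro!: ennreal_leI)
    have "(SUP k. ns (D k)) = (SUP k. \<integral>\<^sup>+z. ennreal (indicator (D k) z * s z) * indicator unit_disc z \<partial>disc_area)"
      unfolding ns_def by (intro SUP_cong refl nn_integral_cong) auto
    also have "\<dots> = (\<integral>\<^sup>+z. (SUP k. ennreal (indicator (D k) z * s z) * indicator unit_disc z) \<partial>disc_area)"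
    proof (rule nn_integral_monotone_convergence_SUP[symmetric, OF inc])
      fix k
      have "(\<lambda>z. ennreal (indicator (D k) z * s z) * indicator unit_disc z) \<in> borel_measurable disc_area \<longleftrightarrow>
        (\<lambda>z. ennreal (indicator (D k) z * s z)) \<in> borel_measurable disc_area"
        by (rule measurable_cong) auto
      then show "(\<lambda>z. ennreal (indicator (D k) z * s z) * indicator unit_disc z) \<in> borel_measurable disc_area"
        using m[of k] by simp
    qed
    also have "\<dots> = ns E"
      unfolding ns_def
    proof (intro nn_integral_cong)
      fix z assume "z \<in> space disc_area"
      then have z: "z \<in> unit_disc" by simp
      show "(SUP k. ennreal (indicator (D k) z * s z) * indicator unit_disc z) = ennreal (indicator E z * s z)"
      proof (cases "z \<in> E")
        case True
        then obtain k where k: "z \<in> D k" using D_Un by auto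
        show ?thesis
        proof (rule antisym)
          show "(SUP k. ennreal (indicator (D k) z * s z) * indicator unit_disc z) \<le> ennreal (indicator E z * s z)"
            using True s_pos[OF z] by (intro SUP_least) (auto simp: indicator_def)
          show "ennreal (indicator E z * s z) \<le> (SUP k. ennreal (indicator (D k) z * s z) * indicator unit_disc z)"
            using True k z by (intro SUP_upper2[of k]) auto
        qed
      next
        case False
        then have "z \<notin> D k" for k using D_Un by auto
        then show ?thesis using False by simp
      qed
    qed
    finally show ?thesis by simp
  qed
  also have "\<dots> \<le> ennreal L"
  proof (rule SUP_least)
    fix k
    have "ns (D k) \<le> ns (D (max k k0))"
      unfolding ns_def using incseqD[OF D_mono, of k "max k k0"] s_pos D
      by (intro nn_integral_mono ennreal_leI) (auto simp: indicator_def less_imp_le subset_iff)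
    also have "\<dots> \<le> ennreal L" by (rule ub) simp
    finally show "ns (D k) \<le> ennreal L" .
  qed
  finally have le: "ns E \<le> ennreal L" .
  then show "ns E < \<infinity>" using ennreal_less_top[of L] by (simp add: le_less_trans)
  have "enn2real (ns E) \<le> L" using le L by (intro enn2real_leI)
  then have "enn2real (ns E) powr (p - 1) \<le> n powr p / (c powr p * g)"
    unfolding L(2)[symmetric] using p by (intro powr_mono2) auto
  then show "c powr p * enn2real (ns E) powr (p - 1) * enn2real (nw G) \<le> n powr p"
    unfolding g_def[symmetric] using c g by (simp add: field_simps)
qed

lemma lower_bound:
  "ennreal (1 / 2000) * ennpowr Ap (1 / (2 * p)) \<le> bergman_opnorm p \<Omega>"
proof (cases "bergman_opnorm p \<Omega> < \<infinity>")
  case False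
  then have "bergman_opnorm p \<Omega> = top" by (simp add: less_top[symmetric])
  then show ?thesis by simp
next
  case True
  define n where "n = enn2real (bergman_opnorm p \<Omega>)"
  have n: "bergman_opnorm p \<Omega> = ennreal n" "n \<ge> 0" using True by (auto simp: n_def less_top)
  have bound: "nw (tent z r) / emeasure disc_area (tent z r) *
     ennpowr (ns (tent z r) / emeasure disc_area (tent z r)) (p - 1) \<le> ennreal ((2000 * n) powr (2 * p))"
    if z: "norm z = 1" and r: "r > 0" for z r
  proof -
    \<comment> \<open>The distance of \<open>1 - x * cnj y\<close> from \<open>\<tau>\<close> has
      two sources of at most \<open>\<tau> / 10\<close> each: the radius of \<open>G\<close>, and
      the tent, whose radius is \<open>\<tau> / 10\<close> when \<open>10 * r \<le> 1\<close>. For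
      larger \<open>r\<close> the cap 1 centres \<open>G\<close> at the origin, where the second
      error vanishes for every tent.\<close>
    define \<tau> where "\<tau> = min 1 (10 * r)"
    have \<tau>: "\<tau> > 0" "\<tau> \<le> 1" using r by (auto simp: \<tau>_def)
    define T where "T = tent z r"
    define x0 where "x0 = of_real (1 - \<tau>) * z"
    define G where "G = ball x0 (\<tau> / 10)"
    have x0: "norm x0 = 1 - \<tau>" using \<tau> z by (simp only: x0_def norm_mult norm_of_real) simp
    have Gsub: "G \<subseteq> unit_disc"
    proof
      fix x assume "x \<in> G"
      then have "norm (x - x0) < \<tau> / 10" by (simp add: G_def dist_norm norm_minus_commute)
      then show "x \<in> unit_disc" using norm_triangle_sub[of x x0] x0 \<tau> by simp
    qed
    have Gs: "G \<in> sets disc_area" using Gsub by (auto simp: sets_area_on G_def)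
    have mG: "measure disc_area G = (\<tau> / 10)\<^sup>2"
      unfolding measure_def using Gsub \<tau> by (simp add: emeasure_area_on G_def emeasure_area_ball)
    have mG_pos: "measure disc_area G > 0" using \<tau> by (simp add: mG)
    have Ts: "T \<in> sets disc_area" and mT_pos: "measure disc_area T > 0"
      using tent_sets tent_pos[OF z r] by (auto simp: T_def)
    have mT: "\<tau>\<^sup>2 / 400 \<le> measure disc_area T"
    proof -
      have "(\<tau> / 10)\<^sup>2 / 4 \<le> measure disc_area (tent z (\<tau> / 10))" using \<tau> z by (intro measure_tent_ge) auto
      also have "\<dots> \<le> measure disc_area T" unfolding T_def
        using r by (intro disc_area.finite_measure_mono tent_sets tent_mono) (auto simp: \<tau>_def)
      finally show ?thesis by (simp add: power_divide)
    qed
    have near: "norm ((1 - x * cnj y) - of_real \<tau>) \<le> \<tau> / 5" if x: "x \<in> G" and y: "y \<in> T" for x y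
    proof -
      have dx: "norm (x - x0) < \<tau> / 10" using x by (simp add: G_def dist_norm norm_minus_commute)
      have y1: "norm y < 1" using y tent_subset[of z r] by (auto simp: T_def)
      have zz: "z * cnj z = 1" using z by (simp flip: complex_norm_square)
      have eq: "(1 - x * cnj y) - of_real \<tau> = - (x - x0) * cnj y - x0 * cnj (y - z)"
      proof -
        have "x0 * cnj z = of_real (1 - \<tau>)" using zz by (simp add: x0_def mult.assoc)
        then show ?thesis by (simp add: algebra_simps)
      qed
      have "norm ((x - x0) * cnj y) \<le> norm (x - x0) * 1"
        unfolding norm_mult using y1 by (intro mult_left_mono) auto
      then have 1: "norm ((x - x0) * cnj y) \<le> \<tau> / 10" using dx by simp
      have 2: "norm (x0 * cnj (y - z)) \<le> \<tau> / 10"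
      proof (cases "10 * r \<le> 1")
        case True
        then have "norm (y - z) \<le> \<tau> / 10"
          using y by (auto simp: T_def tent_def \<tau>_def dist_norm norm_minus_commute)
        moreover have "norm x0 * norm (y - z) \<le> 1 * norm (y - z)"
          using x0 \<tau> by (intro mult_right_mono) auto
        ultimately show ?thesis by (simp add: norm_mult flip: complex_cnj_diff)
      next
        case False
        then have "x0 = 0" by (simp add: x0_def \<tau>_def)
        then show ?thesis using \<tau> by simp
      qed
      have "norm ((1 - x * cnj y) - of_real \<tau>) \<le> norm ((x - x0) * cnj y) + norm (x0 * cnj (y - z))"
        unfolding eq using norm_triangle_ineq4[of "- (x - x0) * cnj y" "x0 * cnj (y - z)"]
        by (simp add: norm_mult norm_minus_commute)
      then show ?thesis using 1 2 by linarith
    qed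
    define c where "c = 1 / (10 * \<tau>\<^sup>2)"
    have c: "c > 0" using \<tau> by (simp add: c_def)
    have k1: "c \<le> Re (1 / (1 - x * cnj y)\<^sup>2)" if "x \<in> G" "y \<in> T" for x y
      unfolding c_def using \<tau>(1) near[OF that] by (rule Re_inverse_square_ge)
    have k2: "c \<le> Re (1 / (1 - y * cnj x)\<^sup>2)" if "x \<in> G" "y \<in> T" for x y
    proof -
      have "norm (cnj ((1 - y * cnj x) - of_real \<tau>)) \<le> \<tau> / 5"
        using near[OF that] by (simp add: mult.commute)
      then have "norm ((1 - y * cnj x) - of_real \<tau>) \<le> \<tau> / 5" by (simp only: complex_mod_cnj)
      then show ?thesis unfolding c_def using \<tau>(1) by (intro Re_inverse_square_ge)
    qed
    note A1 = opnorm_test_general[OF n Ts mT_pos Gs mG_pos c k1]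
    note A2 = opnorm_test_general[OF n Gs mG_pos Ts mT_pos c k2]
    define wT sT wG sG where "wT = enn2real (nw T)" and "sT = enn2real (ns T)"
      and "wG = enn2real (nw G)" and "sG = enn2real (ns G)"
    have nn: "wT \<ge> 0" "sT \<ge> 0" "wG \<ge> 0" "sG \<ge> 0" by (auto simp: wT_def sT_def wG_def sG_def)
    have e: "nw T = ennreal wT" "ns T = ennreal sT"
      using A1(1) A2(2) by (auto simp: wT_def sT_def less_top)
    define mt mg where "mt = measure disc_area T" and "mg = measure disc_area G"
    have mm: "mt > 0" "mg > 0" using mT_pos mG_pos by (auto simp: mt_def mg_def)
    have G_ge: "mg powr p \<le> wG * sG powr (p - 1)"
      unfolding mg_def wG_def sG_def using A1(2) A2(1) Gs mG_pos by (intro weight_product_ge)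
    \<comment> \<open>The mixed factors regroup into one product over \<open>T\<close> and one over
      \<open>G\<close>. The latter is at least \<open>mg powr p\<close> by duality and can be
      replaced by it.\<close>
    have "(c powr p * sT powr (p - 1) * wG) * (c powr p * sG powr (p - 1) * wT) \<le> n powr p * n powr p"
      using A1(3) A2(3) nn unfolding wT_def[symmetric] sT_def[symmetric] wG_def[symmetric] sG_def[symmetric]
      by (intro mult_mono) auto
    then have "(c powr p * c powr p * (wT * sT powr (p - 1))) * (wG * sG powr (p - 1)) \<le> n powr p * n powr p"
      by (simp add: mult_ac)
    moreover have "(c powr p * c powr p * (wT * sT powr (p - 1))) * mg powr p
        \<le> (c powr p * c powr p * (wT * sT powr (p - 1))) * (wG * sG powr (p - 1))"
      using G_ge nn by (intro mult_left_mono) auto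
    ultimately have main: "(c powr p * c powr p * (wT * sT powr (p - 1))) * mg powr p \<le> n powr p * n powr p"
      by linarith
    \<comment> \<open>With \<open>c = 1 / (10 * \<tau>\<^sup>2)\<close>,
      \<open>mg = \<tau>\<^sup>2 / 100\<close> and \<open>mt \<ge> \<tau>\<^sup>2 / 400\<close>, all
      powers of \<open>\<tau>\<close> cancel and \<open>1 / 2000\<^sup>2\<close> is left. The root
      of order \<open>2 * p\<close> of its \<open>p\<close>-th power is the constant 1/2000 of the
      lower bound.\<close>
    have const: "1 / 4000000 \<le> c * c * mg * mt"
    proof -
      have "1 / 4000000 = c * c * mg * (\<tau>\<^sup>2 / 400)"
        using \<tau> by (simp add: c_def mg_def mG power2_eq_square field_simps)
      also have "\<dots> \<le> c * c * mg * mt" using mT c mm by (intro mult_left_mono) (auto simp: mt_def)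
      finally show ?thesis .
    qed
    define X where "X = wT / mt * (sT / mt) powr (p - 1)"
    have "(1 / 4000000) powr p * X \<le> (c * c * mg * mt) powr p * (wT / mt * (sT / mt) powr (p - 1))"
      unfolding X_def using const nn mm p by (intro mult_right_mono powr_mono2) auto
    also have "\<dots> = (c powr p * c powr p * (wT * sT powr (p - 1))) * mg powr p"
      using c mm nn powr_mult_base[of mt "p - 1"] by (simp add: powr_mult powr_divide field_simps)
    also note main
    finally have "X \<le> 4000000 powr p * (n powr p * n powr p)"
      by (simp add: powr_divide field_simps)
    also have "\<dots> = (2000 * n) powr (2 * p)"
    proof -
      have "(2000 * n) powr (2 * p) = (2000 * n) powr p * (2000 * n) powr p"
        by (simp add: powr_add[symmetric])
      also have "\<dots> = (2000 * n * (2000 * n)) powr p" using n(2) by (subst powr_mult) auto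
      also have "2000 * n * (2000 * n) = 4000000 * (n * n)" by simp
      finally show ?thesis using n(2) by (simp add: powr_mult)
    qed
    finally have "X \<le> (2000 * n) powr (2 * p)" .
    moreover have "nw T / emeasure disc_area T * ennpowr (ns T / emeasure disc_area T) (p - 1)
        = ennreal X"
      unfolding X_def using e mm nn by (simp add: disc_area.emeasure_eq_measure mt_def[symmetric] divide_ennreal ennpowr_ennreal ennreal_mult[symmetric])
    ultimately show ?thesis unfolding T_def by (simp only: ennreal_leI)
  qed
  have "Ap \<le> ennreal ((2000 * n) powr (2 * p))"
    unfolding Ap_eq using bound by (intro SUP_least) auto
  then have "ennpowr Ap (1 / (2 * p)) \<le> ennpowr (ennreal ((2000 * n) powr (2 * p))) (1 / (2 * p))"
    using p by (intro ennpowr_mono) auto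
  also have "\<dots> = ennreal (2000 * n)" using n(2) p by (simp add: ennpowr_ennreal powr_powr)
  finally have "ennreal (1 / 2000) * ennpowr Ap (1 / (2 * p)) \<le> ennreal (1 / 2000) * ennreal (2000 * n)"
    by (intro mult_left_mono) auto
  also have "\<dots> = ennreal n" using n(2) by (simp add: ennreal_mult[symmetric])
  finally show ?thesis by (simp add: n)
qed

end

theorem theorem3p2:
  shows "\<exists>c C :: real. c > 0 \<and> C > 0 \<and>
    (\<forall>(\<Omega> :: complex set) (\<phi> :: complex \<Rightarrow> complex) (p :: real).
       open \<Omega> \<and> connected \<Omega> \<and> simply_connected \<Omega> \<and> \<Omega> \<noteq> {} \<and> \<Omega> \<noteq> UNIV \<and>
       conformal_mapping \<phi> (ball 0 1) \<Omega> \<and> 1 < p \<longrightarrow>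
       ennreal c * ennpowr (Ap_plus p (\<lambda>z. cmod (deriv \<phi> z) powr (2 - p))) (1 / (2 * p))
         \<le> bergman_opnorm p \<Omega> \<and>
       bergman_opnorm p \<Omega>
         \<le> ennreal (C * max p (1 / (p - 1))) *
            ennpowr (Ap_plus p (\<lambda>z. cmod (deriv \<phi> z) powr (2 - p))) (max 1 (1 / (p - 1))))"
proof (rule exI[of _ "1 / 2000"], rule exI[of _ 321159168], intro conjI allI impI)
  fix \<Omega> :: "complex set" and \<phi> :: "complex \<Rightarrow> complex" and p :: real
  assume *: "open \<Omega> \<and> connected \<Omega> \<and> simply_connected \<Omega> \<and> \<Omega> \<noteq> {} \<and> \<Omega> \<noteq> UNIV \<and>
       conformal_mapping \<phi> (ball 0 1) \<Omega> \<and> 1 < p"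
  interpret disc_conformal \<phi> \<Omega> p
    by unfold_locales (use * in auto)
  have Ap: "Ap_plus p (\<lambda>z. cmod (deriv \<phi> z) powr (2 - p)) = Ap"
    unfolding Ap_def w_def[abs_def] ..
  show "ennreal (1 / 2000) * ennpowr (Ap_plus p (\<lambda>z. cmod (deriv \<phi> z) powr (2 - p))) (1 / (2 * p))
      \<le> bergman_opnorm p \<Omega>"
    unfolding Ap by (rule lower_bound)
  show "bergman_opnorm p \<Omega> \<le> ennreal (321159168 * max p (1 / (p - 1))) *
      ennpowr (Ap_plus p (\<lambda>z. cmod (deriv \<phi> z) powr (2 - p))) (max 1 (1 / (p - 1)))"
    unfolding Ap by (rule upper_bound)
qed auto

end
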